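(* Let $R$ be a Hermite ring such that for each $a\in R$, all self-dual projective $R/Ra$-modules of rank $1$ generated by $2$ elements are free. Then the following properties hold: (1) $R$ is a $WU_2$ ring iff it is an elementary divisor ring. (2) If $R$ is an $(SU)_2$ ring, then $R$ is an elementary divisor ring.
   Context: Rings are commutative with identity; $U(R)$ is the group of units; $Um(R^2)$ is the set of pairs generating the unit ideal. A module $P$ over a ring $S$ is self-dual if $P\cong \mathrm{Hom}_S(P,S)$. $R$ is a Hermite ring (in the sense of Kaplansky) if for every $(p,q)\in R^2$ there are $r\in R$ and $(s,t)\in Um(R^2)$ with $p=rs$, $q=rt$. $R$ is a $WU_2$ ring if for each $(a,b)\in Um(R^2)$ and $c\in R$, the image of the natural product homomorphism $U(R/Rac)\times U(R/Rbc)\to U(R/Rc)$ contains $\{x^2\mid x\in U(R/Rc)\}$. $R$ is an $(SU)_2$ ring if for each $A\in\mathbb{M}_2(R)$ there exists $N\in GL_2(R)$ such that $AN$ is symmetric. $R$ is an elementary divisor ring if for all $m,n\ge 1$ each $m\times n$ matrix over $R$ is equivalent (via multiplication by invertible matrices on the left and right) to a matrix whose off-diagonal entries are $0$ and whose diagonal entries $a_{1,1},\ldots,a_{s,s}$, $s=\min\{m,n\}$, satisfy $a_{i,i}\mid a_{i+1,i+1}$ for $1\le i\le s-1$. *)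

theory Defs
  imports
    "HOL-Algebra.QuotRing"
    "HOL-Algebra.Divisibility"
    "Jordan_Normal_Form.Matrix"
    "Jordan_Normal_Form.Missing_VectorSpace"
begin

hide_const (open) Multiset.mult

section \<open>Modules\<close>

definition module_iso :: "('s, 'r) ring_scheme \<Rightarrow> ('s, 'm) module \<Rightarrow> ('s, 'n) module \<Rightarrow> bool"
  where "module_iso S M N \<longleftrightarrow>
    (\<exists>f \<in> module_hom S M N. bij_betw f (carrier M) (carrier N))"

definition module_basis :: "('s, 'r) ring_scheme \<Rightarrow> ('s, 'm) module \<Rightarrow> 'm set \<Rightarrow> bool"
  where "module_basis S M B \<longleftrightarrow>
    B \<subseteq> carrier M \<and> \<not> module.lin_dep S M B \<and> module.span S M B = carrier M"

definition free_module :: "('s, 'r) ring_scheme \<Rightarrow> ('s, 'm) module \<Rightarrow> bool"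
  where "free_module S M \<longleftrightarrow> module S M \<and> (\<exists>B. module_basis S M B)"

text \<open>Projective means: direct summand of a free module. The complement may be taken with
  carrier in the type \<^typ>\<open>'m \<Rightarrow> 's\<close> without loss of generality: the finitely supported
  functions \<open>carrier P \<rightarrow> carrier S\<close> form a free module that maps onto \<open>P\<close>, and if \<open>P\<close> is
  projective then the kernel of this map is a complement.\<close>

definition projective_module :: "('s, 'r) ring_scheme \<Rightarrow> ('s, 'm) module \<Rightarrow> bool"
  where "projective_module S P \<longleftrightarrow> module S P \<and>
    (\<exists>Q :: ('s, 'm \<Rightarrow> 's) module. module S Q \<and> free_module S (direct_sum P Q))"

text \<open>The fields \<open>mult\<close> and \<open>one\<close> of a module record carry no meaning unless
  the module is a ring; they are left \<open>undefined\<close> below.\<close>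

definition self_module :: "('s, 'r) ring_scheme \<Rightarrow> ('s, 's) module"
  where "self_module S = \<lparr>carrier = carrier S, mult = mult S, one = one S,
    zero = zero S, add = add S, smult = mult S\<rparr>"

text \<open>Linear forms are represented by functions that are \<open>undefined\<close> outside the carrier,
  so that equality of forms is equality on the carrier.\<close>

definition dual_module :: "('s, 'r) ring_scheme \<Rightarrow> ('s, 'm) module \<Rightarrow> ('s, 'm \<Rightarrow> 's) module"
  where "dual_module S P = \<lparr>
    carrier = module_hom S P (self_module S) \<inter> extensional (carrier P),
    mult = undefined, one = undefined,
    zero = (\<lambda>x\<in>carrier P. \<zero>\<^bsub>S\<^esub>),
    add = (\<lambda>f g. \<lambda>x\<in>carrier P. f x \<oplus>\<^bsub>S\<^esub> g x),
    smult = (\<lambda>a f. \<lambda>x\<in>carrier P. a \<otimes>\<^bsub>S\<^esub> f x)\<rparr>"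

definition self_dual :: "('s, 'r) ring_scheme \<Rightarrow> ('s, 'm) module \<Rightarrow> bool"
  where "self_dual S P \<longleftrightarrow> module_iso S P (dual_module S P)"

definition two_generated :: "('s, 'r) ring_scheme \<Rightarrow> ('s, 'm) module \<Rightarrow> bool"
  where "two_generated S P \<longleftrightarrow>
    (\<exists>x\<in>carrier P. \<exists>y\<in>carrier P. module.span S P {x, y} = carrier P)"


text \<open>Every module over \<open>R Quot I\<close> generated by two elements is isomorphic to one whose carrier
  lives in the type \<^typ>\<open>'a \<times> 'a\<close>, where \<^typ>\<open>'a\<close> is the element type of \<open>R\<close>. Hence nothing is
  lost by letting a quantifier over such modules range over that carrier type only.\<close>

lemma two_generated_iso_type:
  fixes P :: "('s,'m) module" and f :: "'s \<Rightarrow> 'a"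
  assumes P: "module S P" and 2: "two_generated S P" and f: "inj_on f (carrier S)"
  shows "\<exists>P' :: ('s, 'a \<times> 'a) module. module S P' \<and> module_iso S P P'"
proof -
  interpret module S P by fact
  from 2 obtain x y where x: "x \<in> carrier P" "y \<in> carrier P" "span {x,y} = carrier P"
    by (auto simp: two_generated_def)
  have "\<exists>a\<in>carrier S. \<exists>b\<in>carrier S. z = a \<odot>\<^bsub>P\<^esub> x \<oplus>\<^bsub>P\<^esub> b \<odot>\<^bsub>P\<^esub> y" if "z \<in> carrier P" for z
  proof -
    from that x obtain c where c: "c \<in> {x,y} \<rightarrow> carrier S" "z = lincomb c {x,y}"
      by (auto simp: finite_span)
    show ?thesis
    proof (cases "x = y")
      case True with c x show ?thesis by (intro bexI[of _ "c x"] bexI[of _ "\<zero>\<^bsub>S\<^esub>"]) (auto simp: lincomb_def)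
    next
      case False with c x show ?thesis by (intro bexI[of _ "c x"] bexI[of _ "c y"]) (auto simp: lincomb_def)
    qed
  qed
  then obtain a b where ab: "\<And>z. z \<in> carrier P \<Longrightarrow> a z \<in> carrier S \<and> b z \<in> carrier S \<and> z = a z \<odot>\<^bsub>P\<^esub> x \<oplus>\<^bsub>P\<^esub> b z \<odot>\<^bsub>P\<^esub> y"
    by metis
  define g where "g z = (f (a z), f (b z))" for z
  have g: "inj_on g (carrier P)"
  proof (rule inj_onI)
    fix z w assume zw: "z \<in> carrier P" "w \<in> carrier P" "g z = g w"
    then have "a z = a w" "b z = b w"
      using ab f by (auto simp: g_def dest: inj_onD)
    then show "z = w"
      using ab[OF zw(1)] ab[OF zw(2)] by simp
  qed
  define h where "h = the_inv_into (carrier P) g"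
  have hg [simp]: "h (g z) = z" if "z \<in> carrier P" for z
    using that g by (simp add: h_def the_inv_into_f_f)
  define P' :: "('s, 'a \<times> 'a) module" where "P' = \<lparr>carrier = g ` carrier P, mult = undefined, one = undefined,
    zero = g \<zero>\<^bsub>P\<^esub>, add = (\<lambda>u v. g (h u \<oplus>\<^bsub>P\<^esub> h v)), smult = (\<lambda>c u. g (c \<odot>\<^bsub>P\<^esub> h u))\<rparr>"
  have ag: "abelian_group P'"
  proof (rule abelian_groupI, goal_cases)
    case (6 z) then show ?case by (auto simp: P'_def intro!: bexI[of _ "\<ominus>\<^bsub>P\<^esub> _"] M.l_neg arg_cong[of _ _ g])
  qed (auto simp: P'_def M.a_ac)
  have "module S P'"
    by (rule moduleI[OF R.is_cring ag]) (auto simp: P'_def smult_l_distr smult_r_distr smult_assoc1)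
  moreover have "module_iso S P P'"
    unfolding module_iso_def using g
    by (intro bexI[of _ g]) (auto simp: P'_def module_hom_def bij_betw_def)
  ultimately show ?thesis by blast
qed

lemma (in ideal) quot_coset_eqI: "y \<in> I +> x \<Longrightarrow> x \<in> carrier R \<Longrightarrow> I +> x = I +> y"
  using a_repr_independence[OF _ _ a_subgroup] by blast

lemma two_generated_quot_iso_type:
  fixes R :: "('a,'r) ring_scheme" and P :: "('a set,'m) module"
  assumes "ideal I R" "module (R Quot I) P" "two_generated (R Quot I) P"
  shows "\<exists>P' :: ('a set, 'a \<times> 'a) module. module (R Quot I) P' \<and> module_iso (R Quot I) P P'"
proof -
  interpret I: ideal I R by fact
  have "inj_on (\<lambda>X. SOME x. x \<in> X) (carrier (R Quot I))"
  proof (rule inj_onI)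
    fix X Y assume X: "X \<in> carrier (R Quot I)" and Y: "Y \<in> carrier (R Quot I)" and e: "(SOME x. x \<in> X) = (SOME x. x \<in> Y)"
    then obtain x y where x: "X = I +>\<^bsub>R\<^esub> x" "x \<in> carrier R" "Y = I +>\<^bsub>R\<^esub> y" "y \<in> carrier R"
      by (auto simp: FactRing_def A_RCOSETS_def' )
    have "x \<in> X" "y \<in> Y" using x by (auto simp: I.a_rcos_self)
    then have s: "(SOME x. x \<in> X) \<in> X" "(SOME x. x \<in> Y) \<in> Y" by (metis someI)+
    then show "X = Y" using e x by (metis I.quot_coset_eqI)
  qed
  from two_generated_iso_type[OF assms(2,3) this] show ?thesis .
qed


section \<open>Localization at a prime and rank\<close>

definition frac_rel ::
    "('s, 'r) ring_scheme \<Rightarrow> 's set \<Rightarrow> ('s, 'm) module \<Rightarrow> (('m \<times> 's) \<times> ('m \<times> 's)) set"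
  where "frac_rel S p M =
    {((x, s), (y, t)). x \<in> carrier M \<and> y \<in> carrier M \<and>
       s \<in> carrier S - p \<and> t \<in> carrier S - p \<and>
       (\<exists>u \<in> carrier S - p. u \<odot>\<^bsub>M\<^esub> (t \<odot>\<^bsub>M\<^esub> x) = u \<odot>\<^bsub>M\<^esub> (s \<odot>\<^bsub>M\<^esub> y))}"

text \<open>\<open>fraction S p M x s\<close> is the fraction \<open>x / s\<close>, as an equivalence class.\<close>

definition fraction ::
    "('s, 'r) ring_scheme \<Rightarrow> 's set \<Rightarrow> ('s, 'm) module \<Rightarrow> 'm \<Rightarrow> 's \<Rightarrow> ('m \<times> 's) set"
  where "fraction S p M x s = frac_rel S p M `` {(x, s)}"

definition frac_add ::
    "('s, 'r) ring_scheme \<Rightarrow> 's set \<Rightarrow> ('s, 'm) module \<Rightarrow>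
      ('m \<times> 's) set \<Rightarrow> ('m \<times> 's) set \<Rightarrow> ('m \<times> 's) set"
  where "frac_add S p M X Y =
    (\<Union>(x, s)\<in>X. \<Union>(y, t)\<in>Y. fraction S p M (t \<odot>\<^bsub>M\<^esub> x \<oplus>\<^bsub>M\<^esub> s \<odot>\<^bsub>M\<^esub> y) (s \<otimes>\<^bsub>S\<^esub> t))"

definition frac_smult ::
    "('s, 'r) ring_scheme \<Rightarrow> 's set \<Rightarrow> ('s, 'm) module \<Rightarrow>
      ('s \<times> 's) set \<Rightarrow> ('m \<times> 's) set \<Rightarrow> ('m \<times> 's) set"
  where "frac_smult S p M A X =
    (\<Union>(a, s)\<in>A. \<Union>(x, t)\<in>X. fraction S p M (a \<odot>\<^bsub>M\<^esub> x) (s \<otimes>\<^bsub>S\<^esub> t))"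

definition localized_ring :: "('s, 'r) ring_scheme \<Rightarrow> 's set \<Rightarrow> ('s \<times> 's) set ring"
  where "localized_ring S p = \<lparr>
    carrier = (carrier S \<times> (carrier S - p)) // frac_rel S p (self_module S),
    mult = frac_smult S p (self_module S),
    one = fraction S p (self_module S) \<one>\<^bsub>S\<^esub> \<one>\<^bsub>S\<^esub>,
    zero = fraction S p (self_module S) \<zero>\<^bsub>S\<^esub> \<one>\<^bsub>S\<^esub>,
    add = frac_add S p (self_module S)\<rparr>"

definition localized_module ::
    "('s, 'r) ring_scheme \<Rightarrow> 's set \<Rightarrow> ('s, 'm) module \<Rightarrow> (('s \<times> 's) set, ('m \<times> 's) set) module"
  where "localized_module S p M = \<lparr>
    carrier = (carrier M \<times> (carrier S - p)) // frac_rel S p M,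
    mult = undefined, one = undefined,
    zero = fraction S p M \<zero>\<^bsub>M\<^esub> \<one>\<^bsub>S\<^esub>,
    add = frac_add S p M,
    smult = frac_smult S p M\<rparr>"

text \<open>A module has (constant) rank \<open>n\<close> if its localization at every prime ideal
  is free with a basis of \<open>n\<close> elements.\<close>

definition has_rank :: "('s, 'r) ring_scheme \<Rightarrow> ('s, 'm) module \<Rightarrow> nat \<Rightarrow> bool"
  where "has_rank S P n \<longleftrightarrow> (\<forall>p. primeideal p S \<longrightarrow>
    (\<exists>B. module_basis (localized_ring S p) (localized_module S p P) B \<and> finite B \<and> card B = n))"


section \<open>Matrices over a ring with explicit carrier\<close>

definition ring_mats :: "('a, 'r) ring_scheme \<Rightarrow> nat \<Rightarrow> nat \<Rightarrow> 'a mat set"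
  where "ring_mats R m n = {A \<in> carrier_mat m n. \<forall>i<m. \<forall>j<n. A $$ (i, j) \<in> carrier R}"

definition mat_mult :: "('a, 'r) ring_scheme \<Rightarrow> 'a mat \<Rightarrow> 'a mat \<Rightarrow> 'a mat"
  where "mat_mult R A B = mat (dim_row A) (dim_col B)
    (\<lambda>(i, j). \<Oplus>\<^bsub>R\<^esub>k\<in>{..<dim_col A}. A $$ (i, k) \<otimes>\<^bsub>R\<^esub> B $$ (k, j))"

definition mat_one :: "('a, 'r) ring_scheme \<Rightarrow> nat \<Rightarrow> 'a mat"
  where "mat_one R n = mat n n (\<lambda>(i, j). if i = j then \<one>\<^bsub>R\<^esub> else \<zero>\<^bsub>R\<^esub>)"

definition GL :: "nat \<Rightarrow> ('a, 'r) ring_scheme \<Rightarrow> 'a mat set"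
  where "GL n R = {N \<in> ring_mats R n n.
    \<exists>N' \<in> ring_mats R n n. mat_mult R N N' = mat_one R n \<and> mat_mult R N' N = mat_one R n}"


section \<open>Classes of commutative rings\<close>

definition Um2 :: "('a, 'r) ring_scheme \<Rightarrow> ('a \<times> 'a) set"
  where "Um2 R = {(a, b) \<in> carrier R \<times> carrier R. Idl\<^bsub>R\<^esub> {a, b} = carrier R}"

definition hermite_ring :: "('a, 'r) ring_scheme \<Rightarrow> bool"
  where "hermite_ring R \<longleftrightarrow> (\<forall>p\<in>carrier R. \<forall>q\<in>carrier R.
    \<exists>r\<in>carrier R. \<exists>(s, t)\<in>Um2 R. p = r \<otimes>\<^bsub>R\<^esub> s \<and> q = r \<otimes>\<^bsub>R\<^esub> t)"

text \<open>For ideals \<open>I \<subseteq> J\<close> this is the natural projection from \<open>R Quot I\<close> to \<open>R Quot J\<close>: all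
  the cosets \<open>J +> x\<close> with \<open>x \<in> X\<close> coincide.\<close>

definition quot_proj :: "('a, 'r) ring_scheme \<Rightarrow> 'a set \<Rightarrow> 'a set \<Rightarrow> 'a set"
  where "quot_proj R J X = (\<Union>x\<in>X. J +>\<^bsub>R\<^esub> x)"

definition WU2_ring :: "('a, 'r) ring_scheme \<Rightarrow> bool"
  where "WU2_ring R \<longleftrightarrow> (\<forall>(a, b)\<in>Um2 R. \<forall>c\<in>carrier R.
    {x \<otimes>\<^bsub>R Quot (PIdl\<^bsub>R\<^esub> c)\<^esub> x | x. x \<in> Units (R Quot (PIdl\<^bsub>R\<^esub> c))} \<subseteq>
    (\<lambda>(y, z). quot_proj R (PIdl\<^bsub>R\<^esub> c) y \<otimes>\<^bsub>R Quot (PIdl\<^bsub>R\<^esub> c)\<^esub> quot_proj R (PIdl\<^bsub>R\<^esub> c) z) `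
      (Units (R Quot (PIdl\<^bsub>R\<^esub> (a \<otimes>\<^bsub>R\<^esub> c))) \<times> Units (R Quot (PIdl\<^bsub>R\<^esub> (b \<otimes>\<^bsub>R\<^esub> c)))))"

definition SU2_ring :: "('a, 'r) ring_scheme \<Rightarrow> bool"
  where "SU2_ring R \<longleftrightarrow> (\<forall>A\<in>ring_mats R 2 2. \<exists>N\<in>GL 2 R.
    transpose_mat (mat_mult R A N) = mat_mult R A N)"

definition elementary_divisor_ring :: "('a, 'r) ring_scheme \<Rightarrow> bool"
  where "elementary_divisor_ring R \<longleftrightarrow>
    (\<forall>m\<ge>1. \<forall>n\<ge>1. \<forall>A\<in>ring_mats R m n. \<exists>P\<in>GL m R. \<exists>Q\<in>GL n R.
      let D = mat_mult R (mat_mult R P A) Q in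
        (\<forall>i<m. \<forall>j<n. i \<noteq> j \<longrightarrow> D $$ (i, j) = \<zero>\<^bsub>R\<^esub>) \<and>
        (\<forall>i. Suc i < min m n \<longrightarrow> D $$ (i, i) divides\<^bsub>R\<^esub> D $$ (Suc i, Suc i)))"

end

theory Submission
  imports Defs "HOL-Decision_Procs.Commutative_Ring"
begin

text \<open>
  Reduce a matrix over a Hermite ring, as Kaplansky does, to triangular blocks
  \<open>A = (a, b; 0, c)\<close> with \<open>(a, b, c)\<close> unimodular. Such a block can be diagonalised as soon as
  \<open>x A y\<close> is a unit modulo \<open>det A\<close> for some row \<open>x\<close> and column \<open>y\<close>. Let \<open>S\<close> be a symmetric
  \<open>2 \<times> 2\<close> matrix which, modulo \<open>d\<close>, is unimodular of determinant \<open>0\<close>. Its image over \<open>R/Rd\<close> is a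
  rank one projective module, generated by two elements and self-dual by symmetry, hence free; so
  modulo \<open>d\<close> the matrix \<open>S\<close> is a unimodular column times a unimodular row, and \<open>x S y = 1\<close> can be
  solved modulo \<open>d\<close>. It remains to turn \<open>A\<close> into a symmetric matrix. In an \<open>(SU)\<^sub>2\<close> ring some \<open>A N\<close>
  is symmetric. In a \<open>WU\<^sub>2\<close> ring write \<open>a = g a'\<close> and \<open>c = g c'\<close> with \<open>(a', c')\<close> unimodular: then \<open>b\<close>
  is a unit modulo \<open>g\<close>, and a factorisation of \<open>b\<^sup>2\<close> modulo \<open>g\<close> into units modulo \<open>a\<close> and modulo \<open>c\<close>
  yields \<open>M\<close> such that \<open>M A\<close> is symmetric and, modulo \<open>a c\<close>, still unimodular. Conversely,
  diagonalising \<open>(a c, w; 0, b c)\<close> factors the unit \<open>w\<close> of \<open>R/Rc\<close>.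
\<close>

section \<open>Ring identities by reflection\<close>

text \<open>Only symmetric matrices are accessible to the hypothesis on modules: symmetry of
  \<open>S\<close> is what identifies its image with the dual of its image. Passing to the ring
  modulo \<open>det A\<close> is what creates rank one, since only there does the block have
  determinant \<open>0\<close>. The two classes of rings then differ in the factor they offer.
  \<open>N\<close> is invertible, so \<open>A N\<close> has the same entry ideal as
  \<open>A\<close>. \<open>M\<close> need not be invertible; it only has to keep the entries
  unimodular modulo \<open>a c\<close>, which is why \<open>symmetric_cond\<close> carries a
  modulus. The square in the definition of a \<open>WU2_ring\<close> arises as follows. With first
  column \<open>(\<mu> a, \<mu> b)\<close> and first row \<open>(\<mu> a, 0)\<close> for
  \<open>M\<close>, the lower right entry of \<open>M A\<close> is
  \<open>\<mu> b\<^sup>2 + c m\<close>. It should be a unit \<open>\<kappa>\<close> modulo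
  \<open>a\<close>, while \<open>\<mu>\<close> should be a unit modulo \<open>c\<close>. Modulo
  \<open>a\<close>, the term \<open>c m\<close> runs through the multiples of \<open>g\<close>, so
  \<open>\<kappa>\<close> has to agree with \<open>\<mu> b\<^sup>2\<close> modulo \<open>g\<close>.
  Writing \<open>\<nu>\<close> for the inverse of \<open>\<mu>\<close> modulo \<open>c\<close>, this
  asks for \<open>b\<^sup>2 = \<kappa> \<nu>\<close> modulo \<open>g\<close>.\<close>

context cring
begin

text \<open>As a relation, reification is carried out by resolution: the rules \<open>reify\<close>
  build the polynomial expression as the instance of a schematic variable. Evaluating
  \<open>norm\<close> then decides the identity, and only membership of the atoms in the carrier
  remains.\<close>

definition reifies :: "'a list \<Rightarrow> 'a \<Rightarrow> polex \<Rightarrow> bool"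
  where "reifies l x P \<longleftrightarrow> Ipolex l P = x"

lemma reify:
  "reifies l \<zero> (Const 0)"
  "reifies l \<one> (Const 1)"
  "reifies l x P \<Longrightarrow> reifies l y Q \<Longrightarrow> reifies l (x \<oplus> y) (Add P Q)"
  "reifies l x P \<Longrightarrow> reifies l y Q \<Longrightarrow> reifies l (x \<ominus> y) (Sub P Q)"
  "reifies l x P \<Longrightarrow> reifies l y Q \<Longrightarrow> reifies l (x \<otimes> y) (Mul P Q)"
  "reifies l x P \<Longrightarrow> reifies l (\<ominus> x) (Neg P)"
  "reifies (z # l) z (Var 0)"
  "reifies l z (Var n) \<Longrightarrow> reifies (x # l) z (Var (Suc n))"
  by (simp_all add: reifies_def)

lemma ring_eqI:
  assumes "reifies l x X" "reifies l y Y" "norm X = norm Y" "set l \<subseteq> carrier R"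
  shows "x = y"
  using norm_eq[of l X Y] assms by (auto simp: reifies_def in_carrier_def)

lemma reifies_closed: "reifies l x X \<Longrightarrow> set l \<subseteq> carrier R \<Longrightarrow> x \<in> carrier R"
proof -
  assume "reifies l x X" "set l \<subseteq> carrier R"
  then have "in_carrier l" "x = Ipol l (norm X)"
    using norm_ci[of l X] by (auto simp: reifies_def in_carrier_def)
  then show ?thesis by simp
qed

text \<open>The rule \<open>ring_eqIn\<close> proves \<open>x = y\<close> from \<open>n\<close> equations \<open>u = v\<close>, given multipliers \<open>c\<close> with
  \<open>x - y = \<Sum> c (u - v)\<close>.\<close>

lemma ring_eqI1:
  assumes u: "u = v"
    and r: "reifies l x X" "reifies l y Y" "reifies l c C" "reifies l u U" "reifies l v V"
    and n: "norm (Add X (Mul C V)) = norm (Add Y (Mul C U))" and l: "set l \<subseteq> carrier R"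
  shows "x = y"
proof -
  \<comment> \<open>By the premise on \<open>norm\<close> this holds without using
    \<open>u = v\<close>; afterwards the two added terms agree and cancel.\<close>
  have "x \<oplus> c \<otimes> v = y \<oplus> c \<otimes> u"
    by (rule ring_eqI[OF _ _ n l]) (use r in \<open>auto intro: reify\<close>)
  with r[THEN reifies_closed, OF l] show ?thesis by (simp add: u)
qed

lemma ring_eqI2:
  assumes u: "u = v" and u': "u' = v'"
    and r: "reifies l x X" "reifies l y Y" "reifies l c C" "reifies l u U" "reifies l v V"
      "reifies l c' C'" "reifies l u' U'" "reifies l v' V'"
    and n: "norm (Add X (Add (Mul C V) (Mul C' V'))) = norm (Add Y (Add (Mul C U) (Mul C' U')))"
    and l: "set l \<subseteq> carrier R"
  shows "x = y"
proof -
  have "x \<oplus> (c \<otimes> v \<oplus> c' \<otimes> v') = y \<oplus> (c \<otimes> u \<oplus> c' \<otimes> u')"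
    by (rule ring_eqI[OF _ _ n l]) (use r in \<open>auto intro: reify\<close>)
  with r[THEN reifies_closed, OF l] show ?thesis by (simp add: u u')
qed

lemma ring_eqI3:
  assumes u: "u = v" and u': "u' = v'" and u'': "u'' = v''"
    and r: "reifies l x X" "reifies l y Y" "reifies l c C" "reifies l u U" "reifies l v V"
      "reifies l c' C'" "reifies l u' U'" "reifies l v' V'"
      "reifies l c'' C''" "reifies l u'' U''" "reifies l v'' V''"
    and n: "norm (Add X (Add (Mul C V) (Add (Mul C' V') (Mul C'' V'')))) =
      norm (Add Y (Add (Mul C U) (Add (Mul C' U') (Mul C'' U''))))"
    and l: "set l \<subseteq> carrier R"
  shows "x = y"
proof -
  have "x \<oplus> (c \<otimes> v \<oplus> (c' \<otimes> v' \<oplus> c'' \<otimes> v'')) = y \<oplus> (c \<otimes> u \<oplus> (c' \<otimes> u' \<oplus> c'' \<otimes> u''))"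
    by (rule ring_eqI[OF _ _ n l]) (use r in \<open>auto intro: reify\<close>)
  with r[THEN reifies_closed, OF l] show ?thesis by (simp add: u u' u'')
qed

end

section \<open>Row and column operations\<close>

text \<open>Matrices are functions on pairs of naturals here, so that deleting the first row or
  column is substitution of \<open>Suc\<close>. A whole 2 by 2 matrix acts on two rows because a
  Bezout relation supplies exactly such a matrix.\<close>

definition row_op :: "('a, 'r) ring_scheme \<Rightarrow> nat \<Rightarrow> nat \<Rightarrow> 'a \<Rightarrow> 'a \<Rightarrow> 'a \<Rightarrow> 'a \<Rightarrow>
    (nat \<Rightarrow> nat \<Rightarrow> 'a) \<Rightarrow> nat \<Rightarrow> nat \<Rightarrow> 'a"
  where "row_op R i k p q r s f = (\<lambda>x y.
    if x = i then p \<otimes>\<^bsub>R\<^esub> f i y \<oplus>\<^bsub>R\<^esub> q \<otimes>\<^bsub>R\<^esub> f k y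
    else if x = k then r \<otimes>\<^bsub>R\<^esub> f i y \<oplus>\<^bsub>R\<^esub> s \<otimes>\<^bsub>R\<^esub> f k y else f x y)"

definition col_op :: "('a, 'r) ring_scheme \<Rightarrow> nat \<Rightarrow> nat \<Rightarrow> 'a \<Rightarrow> 'a \<Rightarrow> 'a \<Rightarrow> 'a \<Rightarrow>
    (nat \<Rightarrow> nat \<Rightarrow> 'a) \<Rightarrow> nat \<Rightarrow> nat \<Rightarrow> 'a"
  where "col_op R i k p q r s f = (\<lambda>x y.
    if y = i then p \<otimes>\<^bsub>R\<^esub> f x i \<oplus>\<^bsub>R\<^esub> q \<otimes>\<^bsub>R\<^esub> f x k
    else if y = k then r \<otimes>\<^bsub>R\<^esub> f x i \<oplus>\<^bsub>R\<^esub> s \<otimes>\<^bsub>R\<^esub> f x k else f x y)"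

text \<open>The side condition is determinant \<open>1\<close> for \<open>(p, q; r, s)\<close>,
  written without subtraction. The bounds \<open>m\<close> and \<open>n\<close> limit only the
  indices of the operations; entries outside the range are transformed along with the
  others.\<close>

inductive reach :: "('a, 'r) ring_scheme \<Rightarrow> nat \<Rightarrow> nat \<Rightarrow> (nat \<Rightarrow> nat \<Rightarrow> 'a) \<Rightarrow> (nat \<Rightarrow> nat \<Rightarrow> 'a) \<Rightarrow> bool"
  for R m n f where
  refl: "reach R m n f f"
| row: "\<lbrakk>reach R m n f g; i < m; k < m; i \<noteq> k;
    p \<in> carrier R; q \<in> carrier R; r \<in> carrier R; s \<in> carrier R;
    p \<otimes>\<^bsub>R\<^esub> s = \<one>\<^bsub>R\<^esub> \<oplus>\<^bsub>R\<^esub> q \<otimes>\<^bsub>R\<^esub> r\<rbrakk> \<Longrightarrow> reach R m n f (row_op R i k p q r s g)"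
| col: "\<lbrakk>reach R m n f g; i < n; k < n; i \<noteq> k;
    p \<in> carrier R; q \<in> carrier R; r \<in> carrier R; s \<in> carrier R;
    p \<otimes>\<^bsub>R\<^esub> s = \<one>\<^bsub>R\<^esub> \<oplus>\<^bsub>R\<^esub> q \<otimes>\<^bsub>R\<^esub> r\<rbrakk> \<Longrightarrow> reach R m n f (col_op R i k p q r s g)"

lemma reach_trans: "reach R m n g h \<Longrightarrow> reach R m n f g \<Longrightarrow> reach R m n f h"
  by (induction rule: reach.induct) (auto intro: reach.intros)

lemma reach_transpose: "reach R m n f g \<Longrightarrow> reach R n m (\<lambda>i j. f j i) (\<lambda>i j. g j i)"
proof (induction rule: reach.induct)
  case (row g i k p q r s)
  have "(\<lambda>x y. row_op R i k p q r s g y x) = col_op R i k p q r s (\<lambda>x y. g y x)"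
    by (simp add: row_op_def col_op_def)
  with row show ?case by (simp add: reach.col)
next
  case (col g i k p q r s)
  have "(\<lambda>x y. col_op R i k p q r s g y x) = row_op R i k p q r s (\<lambda>x y. g y x)"
    by (simp add: row_op_def col_op_def)
  with col show ?case by (simp add: reach.row)
qed (rule reach.refl)

text \<open>Lets an induction on rows treat all rows but the first. Column operations also act on
  row \<open>0\<close>, hence nothing is asserted about \<open>f' 0\<close>.\<close>

lemma reach_shift_rows:
  assumes "reach R m n (\<lambda>i. f (Suc i)) h"
  shows "\<exists>f'. reach R (Suc m) n f f' \<and> (\<lambda>i. f' (Suc i)) = h"
  using assms
proof (induction rule: reach.induct)
  case refl
  then show ?case by (auto intro: reach.refl)
next
  case (row g i k p q r s)
  then obtain f' where f': "reach R (Suc m) n f f'" "(\<lambda>i. f' (Suc i)) = g" by blast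
  have "(\<lambda>x. row_op R (Suc i) (Suc k) p q r s f' (Suc x)) = row_op R i k p q r s g"
    using f'(2) by (auto simp: row_op_def fun_eq_iff)
  moreover have "reach R (Suc m) n f (row_op R (Suc i) (Suc k) p q r s f')"
    using row f' by (intro reach.row) auto
  ultimately show ?case by blast
next
  case (col g i k p q r s)
  then obtain f' where f': "reach R (Suc m) n f f'" "(\<lambda>i. f' (Suc i)) = g" by blast
  have "(\<lambda>x. col_op R i k p q r s f' (Suc x)) = col_op R i k p q r s g"
    using f'(2) by (auto simp: col_op_def fun_eq_iff)
  moreover have "reach R (Suc m) n f (col_op R i k p q r s f')"
    using col f' by (intro reach.col) auto
  ultimately show ?case by blast
qed

context cring
begin

lemma reach_closed:
  assumes "reach R m n f g" "\<And>i j. f i j \<in> carrier R"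
  shows "g i j \<in> carrier R"
  using assms
  by (induction arbitrary: i j rule: reach.induct) (auto simp: row_op_def col_op_def)

lemma divides_lincomb:
  assumes "e \<in> carrier R" "x \<in> carrier R" "y \<in> carrier R" "p \<in> carrier R" "q \<in> carrier R"
    "e divides x" "e divides y"
  shows "e divides (p \<otimes> x \<oplus> q \<otimes> y)"
proof -
  from assms obtain c d where c: "c \<in> carrier R" "x = e \<otimes> c" and d: "d \<in> carrier R" "y = e \<otimes> d"
    by (auto simp: factor_def)
  then have "p \<otimes> x \<oplus> q \<otimes> y = e \<otimes> (p \<otimes> c \<oplus> q \<otimes> d)"
    using assms by (simp add: r_distr m_ac)
  with c d assms show ?thesis by (auto simp: factor_def)
qed

lemma divides_zero [simp]: "e \<in> carrier R \<Longrightarrow> e divides \<zero>"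
  by (auto simp: factor_def intro!: bexI[of _ \<zero>])

lemma reach_divides:
  assumes "reach R m n f g" "\<And>i j. f i j \<in> carrier R" "e \<in> carrier R"
    and "\<And>i j. i < m \<Longrightarrow> j < n \<Longrightarrow> e divides f i j" "i < m" "j < n"
  shows "e divides g i j"
  using assms
proof (induction arbitrary: i j rule: reach.induct)
  case (row g i k p q r s)
  then show ?case using reach_closed[OF row(1)]
    by (auto simp: row_op_def intro!: divides_lincomb)
next
  case (col g i k p q r s)
  then show ?case using reach_closed[OF col(1)]
    by (auto simp: col_op_def intro!: divides_lincomb)
qed auto

text \<open>Here, unlike in \<open>reach_shift_rows\<close>, the border is known to vanish. An
  operation on the inner block combines only zeros in row \<open>0\<close> and column
  \<open>0\<close>, so the corner survives.\<close>

lemma reach_shift: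
  assumes "reach R m n (\<lambda>i j. f (Suc i) (Suc j)) h"
    and f: "\<And>i j. f i j \<in> carrier R" "\<And>i. i < m \<Longrightarrow> f (Suc i) 0 = \<zero>" "\<And>j. j < n \<Longrightarrow> f 0 (Suc j) = \<zero>"
  shows "\<exists>f'. reach R (Suc m) (Suc n) f f' \<and> (\<lambda>i j. f' (Suc i) (Suc j)) = h \<and> f' 0 0 = f 0 0 \<and>
    (\<forall>i<m. f' (Suc i) 0 = \<zero>) \<and> (\<forall>j<n. f' 0 (Suc j) = \<zero>)"
  using assms(1)
proof (induction rule: reach.induct)
  case refl
  show ?case using f by (intro exI[of _ f]) (auto intro: reach.refl)
next
  case (row g i k p q r s)
  then obtain f' where f': "reach R (Suc m) (Suc n) f f'" "(\<lambda>i j. f' (Suc i) (Suc j)) = g"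
    "f' 0 0 = f 0 0" "\<And>i. i < m \<Longrightarrow> f' (Suc i) 0 = \<zero>" "\<And>j. j < n \<Longrightarrow> f' 0 (Suc j) = \<zero>" by blast
  show ?case
    using row f' by (intro exI[of _ "row_op R (Suc i) (Suc k) p q r s f'"] conjI reach.row)
      (auto simp: row_op_def fun_eq_iff)
next
  case (col g i k p q r s)
  then obtain f' where f': "reach R (Suc m) (Suc n) f f'" "(\<lambda>i j. f' (Suc i) (Suc j)) = g"
    "f' 0 0 = f 0 0" "\<And>i. i < m \<Longrightarrow> f' (Suc i) 0 = \<zero>" "\<And>j. j < n \<Longrightarrow> f' 0 (Suc j) = \<zero>" by blast
  show ?case
    using col f' by (intro exI[of _ "col_op R (Suc i) (Suc k) p q r s f'"] conjI reach.col)
      (auto simp: col_op_def fun_eq_iff)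
qed

text \<open>Each row operation subtracts a multiple of row \<open>0\<close> from another row. That
  row \<open>0\<close> itself is kept matters later: zeros already produced in it persist.\<close>

lemma reach_clear_column:
  assumes f: "\<And>i j. f i j \<in> carrier R" "\<And>i. i < m \<Longrightarrow> f 0 0 divides f i 0" and m: "0 < m"
  shows "\<exists>f'. reach R m n f f' \<and> f' 0 = f 0 \<and> (\<forall>i. 0 < i \<and> i < m \<longrightarrow> f' i 0 = \<zero>)"
proof -
  \<comment> \<open>Rows from \<open>t\<close> on are recorded as unchanged, so that the
    divisibility assumption on \<open>f\<close> still applies to the next row.\<close>
  have "\<exists>f'. reach R m n f f' \<and> f' 0 = f 0 \<and> (\<forall>i. 0 < i \<and> i < t \<longrightarrow> f' i 0 = \<zero>) \<and>
      (\<forall>i\<ge>t. f' i = f i)" if "0 < t" "t \<le> m" for t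
    using that
  proof (induction t)
    case (Suc t)
    show ?case
    proof (cases "t = 0")
      case True
      then show ?thesis by (intro exI[of _ f]) (auto intro: reach.refl)
    next
      case False
      with Suc obtain f' where f': "reach R m n f f'" "f' 0 = f 0"
        "\<And>i. 0 < i \<and> i < t \<Longrightarrow> f' i 0 = \<zero>" "\<And>i. i \<ge> t \<Longrightarrow> f' i = f i" by auto
      obtain c where c: "c \<in> carrier R" "f t 0 = f 0 0 \<otimes> c"
        using f(2)[of t] Suc by (auto simp: factor_def)
      have [simp]: "f' i j \<in> carrier R" for i j by (rule reach_closed[OF f'(1) f(1)])
      let ?g = "row_op R t 0 \<one> (\<ominus> c) \<zero> \<one> f'"
      have "reach R m n f ?g"
        using f' False Suc c by (intro reach.row) auto
      moreover have "?g 0 = f 0" using False f f'(2) by (auto simp: row_op_def fun_eq_iff)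
      moreover have "?g t 0 = \<zero>"
        using c f by (simp add: row_op_def f'(2,4) l_minus m_comm r_neg)
      ultimately show ?thesis using f'
        by (intro exI[of _ ?g]) (auto simp: row_op_def less_Suc_eq)
    qed
  qed simp
  from this[of m] m show ?thesis by auto
qed

section \<open>Unimodular rows over Hermite rings\<close>

lemma Um2_iff:
  "(a, b) \<in> Um2 R \<longleftrightarrow> a \<in> carrier R \<and> b \<in> carrier R \<and>
    (\<exists>x\<in>carrier R. \<exists>y\<in>carrier R. x \<otimes> a \<oplus> y \<otimes> b = \<one>)"
proof -
  have "Idl {a, b} = carrier R \<longleftrightarrow> (\<exists>x\<in>carrier R. \<exists>y\<in>carrier R. x \<otimes> a \<oplus> y \<otimes> b = \<one>)"
    if ab: "a \<in> carrier R" "b \<in> carrier R"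
  proof -
    interpret I: ideal "Idl {a, b}" R using ab by (intro genideal_ideal) auto
    let ?J = "PIdl a <+>\<^bsub>R\<^esub> PIdl b"
    interpret J: ideal ?J R using ab by (intro add_ideals cgenideal_ideal)
    have J: "z \<in> ?J \<longleftrightarrow> (\<exists>x\<in>carrier R. \<exists>y\<in>carrier R. z = x \<otimes> a \<oplus> y \<otimes> b)" for z
      unfolding set_add_def' cgenideal_def by blast
    have "a \<in> ?J" unfolding J
      by (rule bexI[of _ \<one>], rule bexI[of _ \<zero>]) (use ab in simp_all)
    moreover have "b \<in> ?J" unfolding J
      by (rule bexI[of _ \<zero>], rule bexI[of _ \<one>]) (use ab in simp_all)
    ultimately have "{a, b} \<subseteq> ?J" by blast
    then have sub: "Idl {a, b} \<subseteq> ?J" by (intro genideal_minimal J.is_ideal)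
    have mem: "a \<in> Idl {a, b}" "b \<in> Idl {a, b}" using ab genideal_self[of "{a, b}"] by auto
    show ?thesis
    proof
      assume "Idl {a, b} = carrier R"
      with sub have "\<one> \<in> ?J" by auto
      then show "\<exists>x\<in>carrier R. \<exists>y\<in>carrier R. x \<otimes> a \<oplus> y \<otimes> b = \<one>"
        unfolding J by metis
    next
      assume "\<exists>x\<in>carrier R. \<exists>y\<in>carrier R. x \<otimes> a \<oplus> y \<otimes> b = \<one>"
      then obtain x y where "x \<in> carrier R" "y \<in> carrier R" "\<one> = x \<otimes> a \<oplus> y \<otimes> b" by force
      then have "\<one> \<in> Idl {a, b}" using mem by (simp add: I.I_l_closed)
      then show "Idl {a, b} = carrier R" by (rule I.one_imp_carrier)
    qed
  qed
  then show ?thesis by (auto simp: Um2_def)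
qed

lemma hermiteE:
  assumes "hermite_ring R" "p \<in> carrier R" "q \<in> carrier R"
  obtains r s t x y where "r \<in> carrier R" "s \<in> carrier R" "t \<in> carrier R" "x \<in> carrier R" "y \<in> carrier R"
    "p = r \<otimes> s" "q = r \<otimes> t" "x \<otimes> s \<oplus> y \<otimes> t = \<one>"
proof -
  from assms obtain r s t where "r \<in> carrier R" "(s, t) \<in> Um2 R" "p = r \<otimes> s" "q = r \<otimes> t"
    unfolding hermite_ring_def by blast
  then show thesis using that unfolding Um2_iff by blast
qed

text \<open>Factor the pair \<open>a\<close>, \<open>b\<close> as \<open>r (s, t)\<close>, then the
  pair \<open>r\<close>, \<open>c\<close>, and multiply the two Bezout relations.\<close>

lemma hermite3E:
  assumes H: "hermite_ring R" and c: "a \<in> carrier R" "b \<in> carrier R" "c \<in> carrier R"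
  obtains g a' b' c' x y z where "g \<in> carrier R" "a' \<in> carrier R" "b' \<in> carrier R" "c' \<in> carrier R"
    "x \<in> carrier R" "y \<in> carrier R" "z \<in> carrier R"
    "a = g \<otimes> a'" "b = g \<otimes> b'" "c = g \<otimes> c'" "x \<otimes> a' \<oplus> y \<otimes> b' \<oplus> z \<otimes> c' = \<one>"
proof -
  from hermiteE[OF H c(1,2)] obtain r s t x y where
    1: "r \<in> carrier R" "s \<in> carrier R" "t \<in> carrier R" "x \<in> carrier R" "y \<in> carrier R"
    "a = r \<otimes> s" "b = r \<otimes> t" "x \<otimes> s \<oplus> y \<otimes> t = \<one>" .
  from hermiteE[OF H 1(1) c(3)] obtain g u c' v w where
    2: "g \<in> carrier R" "u \<in> carrier R" "c' \<in> carrier R" "v \<in> carrier R" "w \<in> carrier R"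
    "r = g \<otimes> u" "c = g \<otimes> c'" "v \<otimes> u \<oplus> w \<otimes> c' = \<one>" .
  have "v \<otimes> x \<otimes> (u \<otimes> s) \<oplus> v \<otimes> y \<otimes> (u \<otimes> t) \<oplus> w \<otimes> c' = \<one>"
    by (rule ring_eqI2[OF 1(8) 2(8), of "[x,y,s,t,u,v,w,c']" _ _ _ _ "v \<otimes> u" _ _ _ \<one>],
      (rule reify)+, code_simp, use 1 2 in simp)
  then show thesis
    using 1 2 by (intro that[of g "u \<otimes> s" "u \<otimes> t" c' "v \<otimes> x" "v \<otimes> y" w]) (auto simp: m_ac)
qed

text \<open>In the basis \<open>(s, t), (- v, u)\<close> of \<open>R\<^sup>2\<close> the row \<open>(p, q) = r (s, t)\<close> has coordinates \<open>(r, 0)\<close>;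
  these are replaced by \<open>(r, d)\<close>.\<close>

lemma hermite_lift_unimodular:
  assumes H: "hermite_ring R" and c: "p \<in> carrier R" "q \<in> carrier R" "d \<in> carrier R"
    "e \<in> carrier R" "f \<in> carrier R" "k \<in> carrier R"
    and 1: "e \<otimes> p \<oplus> f \<otimes> q \<oplus> k \<otimes> d = \<one>"
  obtains m n x y where "m \<in> carrier R" "n \<in> carrier R" "x \<in> carrier R" "y \<in> carrier R"
    "x \<otimes> (p \<oplus> m \<otimes> d) \<oplus> y \<otimes> (q \<oplus> n \<otimes> d) = \<one>"
proof -
  from hermiteE[OF H c(1,2)] obtain r s t u v where
    2: "r \<in> carrier R" "s \<in> carrier R" "t \<in> carrier R" "u \<in> carrier R" "v \<in> carrier R"
    "p = r \<otimes> s" "q = r \<otimes> t" "u \<otimes> s \<oplus> v \<otimes> t = \<one>" .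
  have 3: "(e \<otimes> s \<oplus> f \<otimes> t) \<otimes> r \<oplus> k \<otimes> d = \<one>"
    by (rule ring_eqI1[OF 1[unfolded 2], of "[e,f,k,d,r,s,t]" _ _ _ _ \<one>], (rule reify)+, code_simp, use c 2 in simp)
  define w where "w = e \<otimes> s \<oplus> f \<otimes> t"
  have w [simp]: "w \<in> carrier R" using c 2 by (simp add: w_def)
  \<comment> \<open>The two coefficients describe the linear form with value \<open>w\<close> on
    \<open>(s, t)\<close> and \<open>k\<close> on \<open>(- v, u)\<close>. It sends the new row to
    \<open>w r + k d\<close>, which is \<open>1\<close>.\<close>
  have 4: "(w \<otimes> u \<ominus> k \<otimes> t) \<otimes> (r \<otimes> s \<oplus> (\<ominus> v) \<otimes> d) \<oplus> (w \<otimes> v \<oplus> k \<otimes> s) \<otimes> (r \<otimes> t \<oplus> u \<otimes> d) = \<one>"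
    by (rule ring_eqI2[OF 2(8) 3[folded w_def], of "[w,k,d,r,s,t,u,v]" _ _ _ _ "w \<otimes> r \<oplus> k \<otimes> d" _ _ _ \<one>],
      (rule reify)+, code_simp, use c 2 in simp)
  show thesis
    using c 2 by (intro that[OF _ _ _ _ 4[folded 2(6,7)]]) simp_all
qed

text \<open>Column operations replace two entries of row \<open>0\<close> by a gcd and
  \<open>0\<close>. They touch every row, so the later clauses record what survives elsewhere:
  columns before \<open>c\<close>, rows that vanish from \<open>c\<close> on, and common divisors of
  a row. With \<open>c = 1\<close> the lemma condenses row \<open>0\<close> outside its first entry
  without spoiling a row whose only possibly nonzero entry is in column \<open>0\<close>.\<close>

lemma reach_clear_row_hermite:
  assumes H: "hermite_ring R" and f: "\<And>i j. f i j \<in> carrier R" and c: "c < n"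
  obtains f' where "reach R m n f f'" "\<forall>j. c < j \<and> j < n \<longrightarrow> f' 0 j = \<zero>"
    "\<forall>i. \<forall>j<c. f' i j = f i j"
    "\<forall>i. (\<forall>j. c \<le> j \<and> j < n \<longrightarrow> f i j = \<zero>) \<longrightarrow> (\<forall>j. c \<le> j \<and> j < n \<longrightarrow> f' i j = \<zero>)"
    "\<forall>i. \<forall>e\<in>carrier R. (\<forall>j<n. e divides f i j) \<longrightarrow> (\<forall>j<n. e divides f' i j)"
    "\<forall>j. c \<le> j \<and> j < n \<longrightarrow> f' 0 c divides f 0 j"
proof -
  \<comment> \<open>Induction on the number \<open>t\<close> of columns treated; the columns not yet
    reached are still those of \<open>f\<close>.\<close>
  have "\<exists>f'. reach R m n f f' \<and> (\<forall>j. c < j \<and> j < t \<longrightarrow> f' 0 j = \<zero>) \<and>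
    (\<forall>i. \<forall>j<c. f' i j = f i j) \<and> (\<forall>i. \<forall>j\<ge>t. f' i j = f i j) \<and>
    (\<forall>i. (\<forall>j. c \<le> j \<and> j < n \<longrightarrow> f i j = \<zero>) \<longrightarrow> (\<forall>j. c \<le> j \<and> j < n \<longrightarrow> f' i j = \<zero>)) \<and>
    (\<forall>i. \<forall>e\<in>carrier R. (\<forall>j<n. e divides f i j) \<longrightarrow> (\<forall>j<n. e divides f' i j)) \<and>
    (\<forall>j. c \<le> j \<and> j < t \<longrightarrow> f' 0 c divides f 0 j)" if "c < t" "t \<le> n" for t
    using that
  proof (induction t)
    case (Suc t)
    show ?case
    proof (cases "t = c")
      case True
      have "f 0 c divides f 0 c" using f by (auto simp: factor_def intro!: bexI[of _ \<one>])
      with True show ?thesis by (intro exI[of _ f]) (auto intro: reach.refl simp: less_Suc_eq)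
    next
      case False
      with Suc obtain f' where f': "reach R m n f f'" "\<And>j. c < j \<Longrightarrow> j < t \<Longrightarrow> f' 0 j = \<zero>"
        "\<And>i j. j < c \<Longrightarrow> f' i j = f i j" "\<And>i j. j \<ge> t \<Longrightarrow> f' i j = f i j"
        "\<And>i j. (\<forall>j. c \<le> j \<and> j < n \<longrightarrow> f i j = \<zero>) \<Longrightarrow> c \<le> j \<Longrightarrow> j < n \<Longrightarrow> f' i j = \<zero>"
        "\<And>i j e. e \<in> carrier R \<Longrightarrow> (\<forall>j<n. e divides f i j) \<Longrightarrow> j < n \<Longrightarrow> e divides f' i j"
        "\<And>j. c \<le> j \<Longrightarrow> j < t \<Longrightarrow> f' 0 c divides f 0 j" by auto
      have ct: "c < t" using False Suc by auto
      have f'c [simp]: "f' i j \<in> carrier R" for i j by (rule reach_closed[OF f'(1) f(1)])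
      from hermiteE[OF H f'c[of 0 c] f'c[of 0 t]] obtain r s u x y where
        r: "r \<in> carrier R" "s \<in> carrier R" "u \<in> carrier R" "x \<in> carrier R" "y \<in> carrier R"
        "f' 0 c = r \<otimes> s" "f' 0 t = r \<otimes> u" "x \<otimes> s \<oplus> y \<otimes> u = \<one>" .
      \<comment> \<open>The determinant is \<open>x s + y u = 1\<close>; the entries
        \<open>r s\<close> and \<open>r u\<close> of row \<open>0\<close> become \<open>r\<close>
        and \<open>0\<close>.\<close>
      let ?g = "col_op R c t x y (\<ominus> u) s f'"
      have "x \<otimes> s = x \<otimes> s \<oplus> y \<otimes> u \<oplus> y \<otimes> (\<ominus> u)"
        using r(1-5) by (simp add: a_assoc r_neg r_minus)
      then have "reach R m n f ?g"
        using f' ct Suc c r by (intro reach.col) auto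
      moreover have "?g 0 t = \<zero>"
      proof -
        have "(\<ominus> u) \<otimes> (r \<otimes> s) \<oplus> s \<otimes> (r \<otimes> u) = \<zero>"
          by (rule ring_eqI[of "[r,s,u]"], (rule reify)+, code_simp, use r in simp)
        then show ?thesis using r ct by (simp add: col_op_def)
      qed
      moreover have gc: "?g 0 c = r"
      proof -
        have "?g 0 c = r \<otimes> (x \<otimes> s \<oplus> y \<otimes> u)" using r(1-7) ct by (simp add: col_op_def r_distr m_ac)
        then show ?thesis using r by simp
      qed
      moreover have "r divides f 0 j" if "c \<le> j" "j < Suc t" for j
      proof (cases "j = t")
        case True
        then have "f 0 j = r \<otimes> u" using r(7) f'(4)[of t 0] by simp
        then show ?thesis using r(3) unfolding factor_def by blast
      next
        case False
        with that f'(7)[of j] obtain v where "v \<in> carrier R" "f 0 j = r \<otimes> s \<otimes> v"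
          using r by (auto simp: factor_def)
        with r show ?thesis by (auto simp: factor_def m_assoc)
      qed
      moreover have "e divides ?g i j" if e: "e \<in> carrier R" "\<forall>j<n. e divides f i j" "j < n" for i j e
      proof -
        have "e divides f' i j'" if "j' < n" for j' using f'(6) e that by blast
        then show ?thesis unfolding col_op_def using e r ct Suc(3) by (simp add: divides_lincomb)
      qed
      moreover have "?g i j = \<zero>" if z: "\<forall>j. c \<le> j \<and> j < n \<longrightarrow> f i j = \<zero>" "c \<le> j" "j < n" for i j
      proof -
        have "f' i j' = \<zero>" if "c \<le> j'" "j' < n" for j' using f'(5) z that by blast
        then show ?thesis unfolding col_op_def using z r ct Suc(3) by simp
      qed
      moreover have "?g 0 j = \<zero>" if "c < j" "j < t" for j
        using that f'(2) by (simp add: col_op_def)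
      moreover have "?g i j = f i j" if "j < c \<or> Suc t \<le> j" for i j
        using that f'(3,4) ct by (auto simp: col_op_def)
      ultimately show ?thesis
        by (intro exI[of _ ?g]) (auto simp: less_Suc_eq)
    qed
  qed simp
  from this[OF c order_refl] show thesis
  proof (elim exE conjE, goal_cases)
    case (1 f')
    then show thesis by (intro that[of f'])
  qed
qed

text \<open>For \<open>A = (a, b; 0, c)\<close> unimodular, \<open>x A y = 1\<close> is solvable modulo \<open>det A\<close>.\<close>

definition kaplansky_cond :: bool where
  "kaplansky_cond \<longleftrightarrow> (\<forall>a\<in>carrier R. \<forall>b\<in>carrier R. \<forall>c\<in>carrier R.
    (\<exists>x\<in>carrier R. \<exists>y\<in>carrier R. \<exists>z\<in>carrier R. x \<otimes> a \<oplus> y \<otimes> b \<oplus> z \<otimes> c = \<one>) \<longrightarrow>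
    (\<exists>x1\<in>carrier R. \<exists>x2\<in>carrier R. \<exists>y1\<in>carrier R. \<exists>y2\<in>carrier R. \<exists>k\<in>carrier R.
      x1 \<otimes> a \<otimes> y1 \<oplus> x1 \<otimes> b \<otimes> y2 \<oplus> x2 \<otimes> c \<otimes> y2 \<oplus> k \<otimes> (a \<otimes> c) = \<one>))"

text \<open>Lift \<open>x\<close> to a unimodular row and complete it to a matrix \<open>L\<close> of determinant \<open>1\<close>. The first row
  of \<open>L A\<close> is unimodular modulo \<open>det A = det (L A)\<close>, which lies in the ideal generated by that row.\<close>

lemma kaplansky_row:
  assumes H: "hermite_ring R" and K: kaplansky_cond
    and c: "a \<in> carrier R" "b \<in> carrier R" "c \<in> carrier R"
    "x \<in> carrier R" "y \<in> carrier R" "z \<in> carrier R"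
    and 1: "x \<otimes> a \<oplus> y \<otimes> b \<oplus> z \<otimes> c = \<one>"
  obtains p q u v s t where "p \<in> carrier R" "q \<in> carrier R" "u \<in> carrier R" "v \<in> carrier R"
    "s \<in> carrier R" "t \<in> carrier R"
    "u \<otimes> p \<oplus> v \<otimes> q = \<one>" "s \<otimes> (p \<otimes> a) \<oplus> t \<otimes> (p \<otimes> b \<oplus> q \<otimes> c) = \<one>"
proof -
  have "\<exists>x\<in>carrier R. \<exists>y\<in>carrier R. \<exists>z\<in>carrier R. x \<otimes> a \<oplus> y \<otimes> b \<oplus> z \<otimes> c = \<one>"
    using c(4-6) 1 by blast
  from K[unfolded kaplansky_cond_def, rule_format, OF c(1-3) this] obtain x1 x2 y1 y2 k where
    2: "x1 \<in> carrier R" "x2 \<in> carrier R" "y1 \<in> carrier R" "y2 \<in> carrier R" "k \<in> carrier R"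
    "x1 \<otimes> a \<otimes> y1 \<oplus> x1 \<otimes> b \<otimes> y2 \<oplus> x2 \<otimes> c \<otimes> y2 \<oplus> k \<otimes> (a \<otimes> c) = \<one>"
    by blast
  have F: "(a \<otimes> y1 \<oplus> b \<otimes> y2) \<otimes> x1 \<oplus> (c \<otimes> y2) \<otimes> x2 \<oplus> k \<otimes> (a \<otimes> c) = \<one>"
    by (rule ring_eqI1[OF 2(6), of "[x1,x2,y1,y2,a,b,c,k]" _ _ _ _ \<one>], (rule reify)+, code_simp, use c 2 in simp)
  have C: "a \<otimes> c \<in> carrier R" "a \<otimes> y1 \<oplus> b \<otimes> y2 \<in> carrier R" "c \<otimes> y2 \<in> carrier R"
    using c 2 by simp_all
  from hermite_lift_unimodular[OF H 2(1,2) C 2(5) F] obtain m n u v where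
    3: "m \<in> carrier R" "n \<in> carrier R" "u \<in> carrier R" "v \<in> carrier R"
    "u \<otimes> (x1 \<oplus> m \<otimes> (a \<otimes> c)) \<oplus> v \<otimes> (x2 \<oplus> n \<otimes> (a \<otimes> c)) = \<one>" .
  define p where "p = x1 \<oplus> m \<otimes> (a \<otimes> c)"
  define q where "q = x2 \<oplus> n \<otimes> (a \<otimes> c)"
  define l where "l = k \<ominus> (m \<otimes> (a \<otimes> y1 \<oplus> b \<otimes> y2) \<oplus> n \<otimes> (c \<otimes> y2))"
  have pql: "p \<in> carrier R" "q \<in> carrier R" "l \<in> carrier R" using c 2 3 by (auto simp: p_def q_def l_def)
  have upvq: "u \<otimes> p \<oplus> v \<otimes> q = \<one>" using 3 by (simp add: p_def q_def)
  have 4: "p \<otimes> a \<otimes> y1 \<oplus> (p \<otimes> b \<oplus> q \<otimes> c) \<otimes> y2 \<oplus> l \<otimes> (a \<otimes> c) = \<one>"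
    unfolding p_def q_def l_def
    by (rule ring_eqI1[OF 2(6), of "[x1,x2,y1,y2,a,b,c,k,m,n]" _ _ _ _ \<one>], (rule reify)+, code_simp, use c 2 3 in simp)
  have "(y1 \<oplus> l \<otimes> u \<otimes> c \<ominus> l \<otimes> v \<otimes> b) \<otimes> (p \<otimes> a) \<oplus> (y2 \<oplus> l \<otimes> v \<otimes> a) \<otimes> (p \<otimes> b \<oplus> q \<otimes> c) = \<one>"
    by (rule ring_eqI2[OF 4 upvq, of "[y1,y2,a,b,c,l,p,q,u,v]" _ _ _ _ \<one> _ _ _ "l \<otimes> (a \<otimes> c)"],
      (rule reify)+, code_simp, use c 2 3 pql in simp)
  with upvq show thesis by (rule that[rotated 6]) (use c 2 3 pql in simp_all)
qed


section \<open>Diagonal reduction under \<open>kaplansky_cond\<close>\<close>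

lemma reach_block_gcd:
  assumes H: "hermite_ring R" and K: kaplansky_cond
    and f: "\<And>i j. f i j \<in> carrier R" and mn: "Suc 0 < m" "Suc 0 < n" and 0: "f 1 1 = \<zero>"
  shows "\<exists>f'. reach R m n f f' \<and> f' 0 0 divides f 0 0 \<and> f' 0 0 divides f 0 1 \<and> f' 0 0 divides f 1 0"
proof -
  \<comment> \<open>The block has its zero at the lower right. Exchanging its columns makes it upper
    triangular with diagonal \<open>f 0 1\<close>, \<open>f 1 0\<close> and off-diagonal entry
    \<open>f 0 0\<close>, which explains the order of the arguments.\<close>
  from hermite3E[OF H f[of 0 1] f[of 0 0] f[of 1 0]] obtain g a b c x y z where
    1: "g \<in> carrier R" "a \<in> carrier R" "b \<in> carrier R" "c \<in> carrier R"
    "x \<in> carrier R" "y \<in> carrier R" "z \<in> carrier R"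
    "f 0 1 = g \<otimes> a" "f 0 0 = g \<otimes> b" "f 1 0 = g \<otimes> c" "x \<otimes> a \<oplus> y \<otimes> b \<oplus> z \<otimes> c = \<one>" .
  from kaplansky_row[OF H K 1(2-7,11)] obtain p q u v s t where
    2: "p \<in> carrier R" "q \<in> carrier R" "u \<in> carrier R" "v \<in> carrier R" "s \<in> carrier R" "t \<in> carrier R"
    "u \<otimes> p \<oplus> v \<otimes> q = \<one>" "s \<otimes> (p \<otimes> a) \<oplus> t \<otimes> (p \<otimes> b \<oplus> q \<otimes> c) = \<one>" .
  \<comment> \<open>The unimodular row \<open>(p, q)\<close> is completed to determinant
    \<open>1\<close>. The column operation then combines the resulting first row to
    \<open>g\<close>; \<open>t\<close> precedes \<open>s\<close> because the columns are in the
    original order.\<close>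
  let ?f1 = "row_op R 0 1 p q (\<ominus> v) u f"
  let ?f2 = "col_op R 0 1 t s (\<ominus> (p \<otimes> a)) (p \<otimes> b \<oplus> q \<otimes> c) ?f1"
  have "p \<otimes> u = \<one> \<oplus> q \<otimes> (\<ominus> v)"
    by (rule ring_eqI1[OF 2(7), of "[p,q,u,v]" _ _ _ _ \<one>], (rule reify)+, code_simp, use 2 in simp)
  then have "reach R m n f ?f1"
    using mn 2 by (intro reach.row reach.refl) auto
  moreover have "t \<otimes> (p \<otimes> b \<oplus> q \<otimes> c) = \<one> \<oplus> s \<otimes> (\<ominus> (p \<otimes> a))"
    by (rule ring_eqI1[OF 2(8), of "[p,q,a,b,c,s,t]" _ _ _ _ \<one>], (rule reify)+, code_simp, use 1 2 in simp)
  ultimately have "reach R m n f ?f2"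
    using mn 1 2 by (intro reach.col) auto
  moreover have "?f2 0 0 = g"
  proof -
    have "t \<otimes> (p \<otimes> (g \<otimes> b) \<oplus> q \<otimes> (g \<otimes> c)) \<oplus> s \<otimes> (p \<otimes> (g \<otimes> a) \<oplus> q \<otimes> \<zero>) = g"
      by (rule ring_eqI1[OF 2(8), of "[p,q,a,b,c,s,t,g]" _ _ _ _ g], (rule reify)+, code_simp, use 1 2 in simp)
    then show ?thesis using 1 0 by (simp add: row_op_def col_op_def)
  qed
  ultimately show ?thesis using 1 by (intro exI[of _ ?f2]) (auto simp: factor_def)
qed

text \<open>Induction on the number of rows. The hypothesis, applied below row \<open>0\<close>,
  puts a common divisor of those rows into row \<open>1\<close>, column \<open>0\<close>, with zeros
  to its right. Condensing row \<open>0\<close> into columns \<open>0\<close> and \<open>1\<close>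
  leaves a 2 by 2 block with a zero at the lower right, and its gcd divides every entry of the
  matrix.\<close>

lemma reach_gcd_entry:
  assumes H: "hermite_ring R" and K: kaplansky_cond and "0 < m" "0 < n"
    and f: "\<And>i j. f i j \<in> carrier R"
  shows "\<exists>f'. reach R m n f f' \<and> (\<forall>i<m. \<forall>j<n. f' 0 0 divides f' i j) \<and>
    (\<forall>j. 0 < j \<and> j < n \<longrightarrow> f' 0 j = \<zero>) \<and> (\<forall>i. 0 < i \<and> i < m \<longrightarrow> f' i 0 = \<zero>)"
  using assms(3-)
proof (induction m arbitrary: f)
  case (Suc m)
  have clear: "\<exists>f'. reach R (Suc m) n f f' \<and> (\<forall>i<Suc m. \<forall>j<n. f' 0 0 divides f' i j) \<and>
    (\<forall>j. 0 < j \<and> j < n \<longrightarrow> f' 0 j = \<zero>) \<and> (\<forall>i. 0 < i \<and> i < Suc m \<longrightarrow> f' i 0 = \<zero>)"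
    if h: "reach R (Suc m) n f h" "\<And>i j. i < Suc m \<Longrightarrow> j < n \<Longrightarrow> h 0 0 divides h i j" for h
  proof -
    have hc: "h i j \<in> carrier R" for i j using reach_closed[OF h(1) Suc(4)] .
    \<comment> \<open>Row \<open>0\<close> is cleared first, as a column of the transpose. Clearing
      column \<open>0\<close> afterwards keeps row \<open>0\<close>, so the new zeros stay.\<close>
    have "\<exists>k'. reach R n (Suc m) (\<lambda>i j. h j i) k' \<and> k' 0 = (\<lambda>j. h j 0) \<and> (\<forall>i. 0 < i \<and> i < n \<longrightarrow> k' i 0 = \<zero>)"
      by (rule reach_clear_column) (use hc h Suc in auto)
    then obtain k' where k': "reach R n (Suc m) (\<lambda>i j. h j i) k'" "k' 0 = (\<lambda>j. h j 0)"
      "\<And>i. 0 < i \<Longrightarrow> i < n \<Longrightarrow> k' i 0 = \<zero>" by blast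
    define k where "k = (\<lambda>i j. k' j i)"
    have k: "reach R (Suc m) n h k" "\<And>j. k j 0 = h j 0" "\<And>i. 0 < i \<Longrightarrow> i < n \<Longrightarrow> k 0 i = \<zero>"
      using reach_transpose[OF k'(1)] k' by (auto simp: k_def)
    have kc: "k i j \<in> carrier R" for i j using reach_closed[OF k(1) hc] .
    have "\<exists>l. reach R (Suc m) n k l \<and> l 0 = k 0 \<and> (\<forall>i. 0 < i \<and> i < Suc m \<longrightarrow> l i 0 = \<zero>)"
      by (rule reach_clear_column) (use kc k h Suc in auto)
    then obtain l where l: "reach R (Suc m) n k l" "l 0 = k 0" "\<And>i. 0 < i \<Longrightarrow> i < Suc m \<Longrightarrow> l i 0 = \<zero>"
      by blast
    have "reach R (Suc m) n h l" using reach_trans[OF l(1) k(1)] .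
    then have "h 0 0 divides l i j" if "i < Suc m" "j < n" for i j
      using that hc h(2) by (intro reach_divides)
    moreover have "l 0 0 = h 0 0" using l k by simp
    moreover have "reach R (Suc m) n f l" using reach_trans[OF \<open>reach R (Suc m) n h l\<close> h(1)] .
    moreover have "l 0 j = \<zero>" if "0 < j" "j < n" for j using l(2) k(3) that by simp
    ultimately show ?thesis using l(3) by (intro exI[of _ l]) auto
  qed
  \<comment> \<open>an element that divides all entries of \<open>h\<close> also divides those of \<open>k\<close>\<close>
  have clear': ?case
    if h: "reach R (Suc m) n f h" and k: "reach R (Suc m) n h k"
      and d: "\<And>i j. i < Suc m \<Longrightarrow> j < n \<Longrightarrow> k 0 0 divides h i j" for h k
  proof (rule clear)
    show "reach R (Suc m) n f k" using reach_trans[OF k h] .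
    show "k 0 0 divides k i j" if "i < Suc m" "j < n" for i j
      using k d that reach_closed[OF h Suc(4)] reach_closed[OF k reach_closed[OF h Suc(4)]]
      by (intro reach_divides)
  qed
  show ?case
  \<comment> \<open>With a single row or a single column there is no 2 by 2 block, and the Hermite
    property alone yields the gcd.\<close>
  proof (cases "m = 0")
    case True
    from reach_clear_row_hermite[of f, OF H Suc(4) \<open>0 < n\<close>, of "Suc m"] obtain h where
      h: "reach R (Suc m) n f h" "\<forall>j. 0 < j \<and> j < n \<longrightarrow> h 0 j = \<zero>"
    "\<forall>i. \<forall>j<0. h i j = f i j"
    "\<forall>i. (\<forall>j. 0 \<le> j \<and> j < n \<longrightarrow> f i j = \<zero>) \<longrightarrow> (\<forall>j. 0 \<le> j \<and> j < n \<longrightarrow> h i j = \<zero>)"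
    "\<forall>i. \<forall>e\<in>carrier R. (\<forall>j<n. e divides f i j) \<longrightarrow> (\<forall>j<n. e divides h i j)"
    "\<forall>j. 0 \<le> j \<and> j < n \<longrightarrow> h 0 0 divides f 0 j" .
    show ?thesis by (rule clear'[OF reach.refl h(1)]) (use h(6) True in simp)
  next
    case False
    then obtain h where h: "reach R m n (\<lambda>i. f (Suc i)) h"
      "\<And>i j. i < m \<Longrightarrow> j < n \<Longrightarrow> h 0 0 divides h i j" "\<And>j. 0 < j \<Longrightarrow> j < n \<Longrightarrow> h 0 j = \<zero>"
      using Suc.IH[of "\<lambda>i. f (Suc i)"] Suc.prems by auto
    from reach_shift_rows[OF h(1)] obtain g where g: "reach R (Suc m) n f g" "(\<lambda>i. g (Suc i)) = h" by blast
    have gc: "g i j \<in> carrier R" for i j using reach_closed[OF g(1) Suc(4)] .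
    have gS: "g (Suc i) j = h i j" for i j using g(2) by (auto simp: fun_eq_iff)
    show ?thesis
    proof (cases "n = 1")
      case True
      from reach_clear_row_hermite[of "\<lambda>i j. g j i", OF H gc zero_less_Suc, of n m] obtain k where
        k: "reach R n (Suc m) (\<lambda>i j. g j i) k" "\<forall>j. 0 < j \<and> j < Suc m \<longrightarrow> k 0 j = \<zero>"
    "\<forall>i. \<forall>j<0. k i j = g j i"
    "\<forall>i. (\<forall>j. 0 \<le> j \<and> j < Suc m \<longrightarrow> g j i = \<zero>) \<longrightarrow> (\<forall>j. 0 \<le> j \<and> j < Suc m \<longrightarrow> k i j = \<zero>)"
    "\<forall>i. \<forall>e\<in>carrier R. (\<forall>j<Suc m. e divides g j i) \<longrightarrow> (\<forall>j<Suc m. e divides k i j)"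
    "\<forall>j. 0 \<le> j \<and> j < Suc m \<longrightarrow> k 0 0 divides g j 0" .
      show ?thesis
        by (rule clear'[OF g(1) reach_transpose[OF k(1)]]) (use k(6) True in simp)
    next
      case False
      with Suc have n: "1 < n" by auto
      from reach_clear_row_hermite[of g, OF H gc n, of "Suc m"] obtain k where
        k: "reach R (Suc m) n g k" "\<forall>j. 1 < j \<and> j < n \<longrightarrow> k 0 j = \<zero>"
    "\<forall>i. \<forall>j<1. k i j = g i j"
    "\<forall>i. (\<forall>j. 1 \<le> j \<and> j < n \<longrightarrow> g i j = \<zero>) \<longrightarrow> (\<forall>j. 1 \<le> j \<and> j < n \<longrightarrow> k i j = \<zero>)"
    "\<forall>i. \<forall>e\<in>carrier R. (\<forall>j<n. e divides g i j) \<longrightarrow> (\<forall>j<n. e divides k i j)"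
    "\<forall>j. 1 \<le> j \<and> j < n \<longrightarrow> k 0 1 divides g 0 j" .
      have kc: "k i j \<in> carrier R" for i j using reach_closed[OF k(1) gc] .
      have k1: "k 1 j = \<zero>" if "1 \<le> j" "j < n" for j
        by (rule k(4)[rule_format]) (use that h(3) gS[of 0] in auto)
      have k10: "k 1 0 = h 0 0" using k(3)[rule_format, of 0 1] gS[of 0] by simp
      obtain l where l: "reach R (Suc m) n k l" "l 0 0 divides k 0 0" "l 0 0 divides k 0 1" "l 0 0 divides k 1 0"
        using reach_block_gcd[OF H K, of k "Suc m" n] kc k1[of 1] n \<open>m \<noteq> 0\<close> by auto
      have lc: "l i j \<in> carrier R" for i j using reach_closed[OF l(1) kc] .
      have "l 0 0 divides k i j" if ij: "i < Suc m" "j < n" for i j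
      proof (cases i)
        case 0
        then show ?thesis using l(2,3) k(2) ij lc by (cases "j = 0"; cases "j = 1") auto
      next
        case (Suc i')
        \<comment> \<open>Row \<open>i\<close> of \<open>g\<close> is a row of \<open>h\<close>,
          hence divisible by \<open>h 0 0\<close>; condensing row \<open>0\<close> preserves common
          divisors of each row.\<close>
        have "h 0 0 divides k i j"
          by (rule k(5)[rule_format]) (use h(2) gS Suc ij gc[of 1 0] in auto)
        then show ?thesis using l(4) lc kc k10 by (metis divides_trans)
      qed
      then show ?thesis using clear'[OF reach_trans[OF k(1) g(1)] l(1)] by blast
    qed
  qed
qed simp

text \<open>The divisibility chain needs no separate argument: the corner divides the whole
  remaining block, and operations on that block preserve common divisors of its entries.\<close>

lemma reach_smith:
  assumes H: "hermite_ring R" and K: kaplansky_cond and f: "\<And>i j. f i j \<in> carrier R"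
  shows "\<exists>f'. reach R m n f f' \<and> (\<forall>i<m. \<forall>j<n. i \<noteq> j \<longrightarrow> f' i j = \<zero>) \<and>
    (\<forall>i. Suc i < min m n \<longrightarrow> f' i i divides f' (Suc i) (Suc i))"
  using f
proof (induction m arbitrary: n f)
  case 0
  show ?case by (auto intro: reach.refl)
next
  case (Suc m)
  show ?case
  proof (cases n)
    case 0
    then show ?thesis by (auto intro: reach.refl)
  next
    case n: (Suc n')
    have "0 < Suc m" "0 < n" using n by auto
    from reach_gcd_entry[where f = f, OF H K this Suc.prems] obtain g where
      g: "reach R (Suc m) n f g" "\<forall>i<Suc m. \<forall>j<n. g 0 0 divides g i j"
      "\<forall>j. 0 < j \<and> j < n \<longrightarrow> g 0 j = \<zero>" "\<forall>i. 0 < i \<and> i < Suc m \<longrightarrow> g i 0 = \<zero>"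
      by (elim exE conjE) (rule that)
    have gc: "g i j \<in> carrier R" for i j using reach_closed[OF g(1) Suc(2)] .
    from Suc.IH[of "\<lambda>i j. g (Suc i) (Suc j)" n', OF gc] obtain h where
      h: "reach R m n' (\<lambda>i j. g (Suc i) (Suc j)) h" "\<forall>i<m. \<forall>j<n'. i \<noteq> j \<longrightarrow> h i j = \<zero>"
      "\<forall>i. Suc i < min m n' \<longrightarrow> h i i divides h (Suc i) (Suc i)"
      by (elim exE conjE) (rule that)
    have "g (Suc i) 0 = \<zero>" if "i < m" for i using g(4) that by simp
    moreover have "g 0 (Suc j) = \<zero>" if "j < n'" for j using g(3) that n by simp
    ultimately have "\<exists>k. reach R (Suc m) (Suc n') g k \<and> (\<lambda>i j. k (Suc i) (Suc j)) = h \<and> k 0 0 = g 0 0 \<and>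
      (\<forall>i<m. k (Suc i) 0 = \<zero>) \<and> (\<forall>j<n'. k 0 (Suc j) = \<zero>)"
      by (rule reach_shift[OF h(1) gc])
    then obtain k where k: "reach R (Suc m) (Suc n') g k" "(\<lambda>i j. k (Suc i) (Suc j)) = h" "k 0 0 = g 0 0"
      "\<forall>i<m. k (Suc i) 0 = \<zero>" "\<forall>j<n'. k 0 (Suc j) = \<zero>"
      by (elim exE conjE) (rule that)
    have kS: "k (Suc i) (Suc j) = h i j" for i j using k(2) by (simp add: fun_eq_iff)
    have kd: "k 0 0 divides k i j" if "i < Suc m" "j < n" for i j
      unfolding k(3) by (rule reach_divides[where f = g, OF k(1) gc gc]) (use that g(2) n in auto)
    show ?thesis
    proof (intro exI[of _ k] conjI allI impI)
      show "reach R (Suc m) n f k" using reach_trans[OF k(1)] g(1) n by simp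
      show "k i j = \<zero>" if "i < Suc m" "j < n" "i \<noteq> j" for i j
        using that k(4,5) kS h(2) n by (cases i; cases j) auto
      show "k i i divides k (Suc i) (Suc i)" if "Suc i < min (Suc m) n" for i
        using that kd[of "Suc 0" "Suc 0", unfolded kS] kS h(3) n by (cases i) auto
    qed
  qed
qed

section \<open>Matrices with explicit carrier\<close>

lemma mat_mult_closed:
  "A \<in> ring_mats R m l \<Longrightarrow> B \<in> ring_mats R l n \<Longrightarrow> mat_mult R A B \<in> ring_mats R m n"
  by (auto simp: ring_mats_def mat_mult_def intro!: finsum_closed)

lemma mat_mult_assoc:
  assumes A: "A \<in> ring_mats R m k" and B: "B \<in> ring_mats R k l" and C: "C \<in> ring_mats R l n"
  shows "mat_mult R (mat_mult R A B) C = mat_mult R A (mat_mult R B C)"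
proof (rule eq_matI)
  fix i j
  assume "i < dim_row (mat_mult R A (mat_mult R B C))" "j < dim_col (mat_mult R A (mat_mult R B C))"
  then have ij: "i < m" "j < n" using A C by (auto simp: mat_mult_def ring_mats_def)
  have [simp]: "dim_row A = m" "dim_col A = k" "dim_row B = k" "dim_col B = l" "dim_col C = n"
    using A B C by (auto simp: ring_mats_def)
  have c: "\<And>i j. i < m \<Longrightarrow> j < k \<Longrightarrow> A $$ (i, j) \<in> carrier R"
    "\<And>i j. i < k \<Longrightarrow> j < l \<Longrightarrow> B $$ (i, j) \<in> carrier R"
    "\<And>i j. i < l \<Longrightarrow> j < n \<Longrightarrow> C $$ (i, j) \<in> carrier R"
    using A B C by (auto simp: ring_mats_def)
  have "mat_mult R (mat_mult R A B) C $$ (i, j) =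
      (\<Oplus>z\<in>{..<l}. (\<Oplus>y\<in>{..<k}. A $$ (i, y) \<otimes> B $$ (y, z)) \<otimes> C $$ (z, j))"
    using ij c by (auto simp: mat_mult_def intro!: finsum_cong')
  also have "\<dots> = (\<Oplus>z\<in>{..<l}. \<Oplus>y\<in>{..<k}. A $$ (i, y) \<otimes> (B $$ (y, z) \<otimes> C $$ (z, j)))"
    using ij c by (intro finsum_cong') (auto simp: finsum_ldistr m_assoc intro!: finsum_cong')
  also have "\<dots> = (\<Oplus>y\<in>{..<k}. \<Oplus>z\<in>{..<l}. A $$ (i, y) \<otimes> (B $$ (y, z) \<otimes> C $$ (z, j)))"
    using ij c by (intro finsum_finsum_swap) auto
  also have "\<dots> = (\<Oplus>y\<in>{..<k}. A $$ (i, y) \<otimes> (\<Oplus>z\<in>{..<l}. B $$ (y, z) \<otimes> C $$ (z, j)))"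
    using ij c by (intro finsum_cong') (auto simp: finsum_rdistr intro!: finsum_cong')
  also have "\<dots> = mat_mult R A (mat_mult R B C) $$ (i, j)"
    using ij c by (auto simp: mat_mult_def intro!: finsum_cong')
  finally show "mat_mult R (mat_mult R A B) C $$ (i, j) = mat_mult R A (mat_mult R B C) $$ (i, j)" .
qed (auto simp: mat_mult_def)

lemma finsum_delta_row:
  fixes i n :: nat
  assumes "i < n" "\<And>z. z < n \<Longrightarrow> g z \<in> carrier R" "a \<in> carrier R"
  shows "(\<Oplus>z\<in>{..<n}. a \<otimes> (if i = z then \<one> else \<zero>) \<otimes> g z) = a \<otimes> g i"
proof -
  have "(\<Oplus>z\<in>{..<n}. a \<otimes> (if i = z then \<one> else \<zero>) \<otimes> g z) =
      (\<Oplus>z\<in>{..<n}. if i = z then a \<otimes> g z else \<zero>)"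
    using assms by (intro finsum_cong') auto
  also have "\<dots> = a \<otimes> g i" using assms by (intro finsum_singleton) auto
  finally show ?thesis .
qed

lemma finsum_delta_row2:
  fixes i k n :: nat
  assumes ik: "i < n" "k < n" and g: "\<And>z. z < n \<Longrightarrow> g z \<in> carrier R" and a: "a \<in> carrier R" "b \<in> carrier R"
  shows "(\<Oplus>z\<in>{..<n}. (a \<otimes> (if i = z then \<one> else \<zero>) \<oplus> b \<otimes> (if k = z then \<one> else \<zero>)) \<otimes> g z)
    = a \<otimes> g i \<oplus> b \<otimes> g k"
proof -
  have "(\<Oplus>z\<in>{..<n}. (a \<otimes> (if i = z then \<one> else \<zero>) \<oplus> b \<otimes> (if k = z then \<one> else \<zero>)) \<otimes> g z) =
    (\<Oplus>z\<in>{..<n}. a \<otimes> (if i = z then \<one> else \<zero>) \<otimes> g z \<oplus> b \<otimes> (if k = z then \<one> else \<zero>) \<otimes> g z)"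
    using assms by (intro finsum_cong') (auto simp: l_distr)
  also have "\<dots> = (\<Oplus>z\<in>{..<n}. a \<otimes> (if i = z then \<one> else \<zero>) \<otimes> g z) \<oplus>
    (\<Oplus>z\<in>{..<n}. b \<otimes> (if k = z then \<one> else \<zero>) \<otimes> g z)"
    using assms by (intro finsum_addf) auto
  also have "\<dots> = a \<otimes> g i \<oplus> b \<otimes> g k"
    using finsum_delta_row[of i n g a] finsum_delta_row[of k n g b] assms by simp
  finally show ?thesis .
qed

text \<open>The identity matrix as a function. \<open>row_op\<close> applied to it gives the matrix
  by which that operation multiplies from the left.\<close>

definition delta :: "nat \<Rightarrow> nat \<Rightarrow> 'a"
  where "delta = (\<lambda>x y. if x = y then \<one> else \<zero>)"

lemma delta_closed [simp]: "delta i j \<in> carrier R"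
  by (simp add: delta_def)

lemma row_op_mat_mult:
  assumes ik: "i < m" "k < m" and pqrs: "p \<in> carrier R" "q \<in> carrier R" "r \<in> carrier R" "s \<in> carrier R"
    and f: "\<And>i j. f i j \<in> carrier R"
  shows "mat_mult R (mat m m (\<lambda>(x, y). row_op R i k p q r s delta x y)) (mat m n (\<lambda>(x, y). f x y))
    = mat m n (\<lambda>(x, y). row_op R i k p q r s f x y)"
proof (rule eq_matI)
  fix x y
  assume "x < dim_row (mat m n (\<lambda>(x, y). row_op R i k p q r s f x y))"
    "y < dim_col (mat m n (\<lambda>(x, y). row_op R i k p q r s f x y))"
  then have xy: "x < m" "y < n" by auto
  have "mat_mult R (mat m m (\<lambda>(x, y). row_op R i k p q r s delta x y)) (mat m n (\<lambda>(x, y). f x y)) $$ (x, y)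
    = (\<Oplus>z\<in>{..<m}. row_op R i k p q r s delta x z \<otimes> f z y)"
    using xy pqrs f by (auto simp: mat_mult_def row_op_def intro!: finsum_cong')
  also have "\<dots> = row_op R i k p q r s f x y"
    using finsum_delta_row2[of i m k "\<lambda>z. f z y" p q] finsum_delta_row2[of i m k "\<lambda>z. f z y" r s]
      finsum_delta_row[of x m "\<lambda>z. f z y" \<one>] xy ik pqrs f
    by (simp add: row_op_def delta_def)
  finally show "mat_mult R (mat m m (\<lambda>(x, y). row_op R i k p q r s delta x y)) (mat m n (\<lambda>(x, y). f x y)) $$ (x, y)
    = mat m n (\<lambda>(x, y). row_op R i k p q r s f x y) $$ (x, y)" using xy by simp
qed (auto simp: mat_mult_def)

lemma transpose_mat_mult:
  assumes "A \<in> ring_mats R m l" "B \<in> ring_mats R l n"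
  shows "transpose_mat (mat_mult R A B) = mat_mult R (transpose_mat B) (transpose_mat A)"
  by (rule eq_matI) (use assms in \<open>auto simp: mat_mult_def ring_mats_def m_comm intro!: finsum_cong'\<close>)

lemma transpose_ring_mats: "A \<in> ring_mats R m n \<Longrightarrow> transpose_mat A \<in> ring_mats R n m"
  by (auto simp: ring_mats_def)

lemma transpose_mat_fun: "transpose_mat (mat m n (\<lambda>(x, y). f x y)) = mat n m (\<lambda>(x, y). f y x)"
  by (rule eq_matI) auto

lemma col_op_mat_mult:
  assumes ik: "i < n" "k < n" and pqrs: "p \<in> carrier R" "q \<in> carrier R" "r \<in> carrier R" "s \<in> carrier R"
    and f: "\<And>i j. f i j \<in> carrier R"
  shows "mat_mult R (mat m n (\<lambda>(x, y). f x y)) (transpose_mat (mat n n (\<lambda>(x, y). row_op R i k p q r s delta x y)))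
    = mat m n (\<lambda>(x, y). col_op R i k p q r s f x y)"
proof -
  let ?E = "mat n n (\<lambda>(x, y). row_op R i k p q r s delta x y)"
  have E: "?E \<in> ring_mats R n n" using pqrs by (auto simp: ring_mats_def row_op_def)
  have F: "mat n m (\<lambda>(x, y). f y x) \<in> ring_mats R n m" using f by (auto simp: ring_mats_def)
  have "transpose_mat (mat_mult R ?E (mat n m (\<lambda>(x, y). f y x))) =
      mat_mult R (mat m n (\<lambda>(x, y). f x y)) (transpose_mat ?E)"
    using transpose_mat_mult[OF E F] by (simp add: transpose_mat_fun)
  also have "mat_mult R ?E (mat n m (\<lambda>(x, y). f y x)) =
      mat n m (\<lambda>(x, y). row_op R i k p q r s (\<lambda>x y. f y x) x y)"
    by (rule row_op_mat_mult) (use assms in auto)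
  also have "transpose_mat \<dots> = mat m n (\<lambda>(x, y). col_op R i k p q r s f x y)"
    by (simp add: transpose_mat_fun row_op_def col_op_def)
  finally show ?thesis ..
qed

lemma mat_one_delta: "mat_one R n = mat n n (\<lambda>(x, y). delta x y)"
  by (simp add: mat_one_def delta_def)

lemma transpose_mat_one: "transpose_mat (mat_one R n) = mat_one R n"
  by (rule eq_matI) (auto simp: mat_one_def)

lemma mat_one_closed: "mat_one R n \<in> ring_mats R n n"
  by (auto simp: mat_one_def ring_mats_def)

lemma mat_one_mult:
  assumes "A \<in> ring_mats R m n"
  shows "mat_mult R (mat_one R m) A = A"
proof (rule eq_matI)
  fix i j assume "i < dim_row A" "j < dim_col A"
  with assms have ij: "i < m" "j < n" "dim_row A = m" "\<And>i j. i < m \<Longrightarrow> j < n \<Longrightarrow> A $$ (i, j) \<in> carrier R"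
    by (auto simp: ring_mats_def)
  have "(\<Oplus>z\<in>{..<m}. (if i = z then \<one> else \<zero>) \<otimes> A $$ (z, j)) = A $$ (i, j)"
    using finsum_delta_row[of i m "\<lambda>z. A $$ (z, j)" \<one>] ij by (simp cong: finsum_cong)
  moreover have "mat_mult R (mat_one R m) A $$ (i, j) = (\<Oplus>z\<in>{..<m}. (if i = z then \<one> else \<zero>) \<otimes> A $$ (z, j))"
    using assms ij by (auto simp: mat_mult_def mat_one_def ring_mats_def intro!: finsum_cong')
  ultimately show "mat_mult R (mat_one R m) A $$ (i, j) = A $$ (i, j)" by simp
qed (use assms in \<open>auto simp: mat_mult_def mat_one_def ring_mats_def\<close>)

lemma mat_mult_one:
  assumes "A \<in> ring_mats R m n"
  shows "mat_mult R A (mat_one R n) = A"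
proof -
  have "transpose_mat (mat_mult R A (mat_one R n)) = transpose_mat A"
    using assms mat_one_mult[OF transpose_ring_mats[OF assms]]
    by (simp add: transpose_mat_mult[OF assms mat_one_closed] transpose_mat_one)
  then show ?thesis by (metis transpose_transpose)
qed

lemma GL_mult:
  assumes "A \<in> GL n R" "B \<in> GL n R"
  shows "mat_mult R A B \<in> GL n R"
proof -
  from assms obtain A' B' where A: "A \<in> ring_mats R n n" "A' \<in> ring_mats R n n"
    "mat_mult R A A' = mat_one R n" "mat_mult R A' A = mat_one R n"
    and B: "B \<in> ring_mats R n n" "B' \<in> ring_mats R n n"
    "mat_mult R B B' = mat_one R n" "mat_mult R B' B = mat_one R n"
    unfolding GL_def by blast
  have "mat_mult R (mat_mult R A B) (mat_mult R B' A') = mat_mult R A (mat_mult R (mat_mult R B B') A')"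
    using A(1,2) B(1,2) by (simp add: mat_mult_assoc[where m=n and k=n and l=n and n=n] mat_mult_closed[where m=n and l=n and n=n])
  also have "\<dots> = mat_one R n" using A B by (simp add: mat_one_mult)
  finally have 1: "mat_mult R (mat_mult R A B) (mat_mult R B' A') = mat_one R n" .
  have "mat_mult R (mat_mult R B' A') (mat_mult R A B) = mat_mult R B' (mat_mult R (mat_mult R A' A) B)"
    using A(1,2) B(1,2) by (simp add: mat_mult_assoc[where m=n and k=n and l=n and n=n] mat_mult_closed[where m=n and l=n and n=n])
  also have "\<dots> = mat_one R n" using A B by (simp add: mat_one_mult)
  finally have 2: "mat_mult R (mat_mult R B' A') (mat_mult R A B) = mat_one R n" .
  show ?thesis using 1 2 A(1,2) B(1,2) unfolding GL_def by (blast intro: mat_mult_closed)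
qed

lemma GL_transpose:
  assumes "A \<in> GL n R"
  shows "transpose_mat A \<in> GL n R"
proof -
  from assms obtain A' where A: "A \<in> ring_mats R n n" "A' \<in> ring_mats R n n"
    "mat_mult R A A' = mat_one R n" "mat_mult R A' A = mat_one R n"
    unfolding GL_def by blast
  have 1: "mat_mult R (transpose_mat A) (transpose_mat A') = mat_one R n"
    using transpose_mat_mult[OF A(2,1)] unfolding A(4) transpose_mat_one by (rule sym)
  have 2: "mat_mult R (transpose_mat A') (transpose_mat A) = mat_one R n"
    using transpose_mat_mult[OF A(1,2)] unfolding A(3) transpose_mat_one by (rule sym)
  show ?thesis
    using 1 2 transpose_ring_mats[OF A(1)] transpose_ring_mats[OF A(2)] unfolding GL_def by blast
qed

text \<open>The second operation is by the adjugate, which is the inverse because the determinant is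
  \<open>1\<close>.\<close>

lemma row_op_row_op:
  assumes "i \<noteq> k" "p \<in> carrier R" "q \<in> carrier R" "r \<in> carrier R" "s \<in> carrier R"
    and 1: "p \<otimes> s = \<one> \<oplus> q \<otimes> r" and f: "\<And>i j. f i j \<in> carrier R"
  shows "row_op R i k s (\<ominus> q) (\<ominus> r) p (row_op R i k p q r s f) = f"
proof (intro ext)
  fix x y
  have a: "s \<otimes> (p \<otimes> u \<oplus> q \<otimes> v) \<oplus> (\<ominus> q) \<otimes> (r \<otimes> u \<oplus> s \<otimes> v) = u"
    "(\<ominus> r) \<otimes> (p \<otimes> u \<oplus> q \<otimes> v) \<oplus> p \<otimes> (r \<otimes> u \<oplus> s \<otimes> v) = v"
    if "u \<in> carrier R" "v \<in> carrier R" for u v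
    by (rule ring_eqI1[OF 1, of "[p,q,r,s,u,v]" _ _ _ _ u], (rule reify)+, code_simp, use assms that in simp,
        rule ring_eqI1[OF 1, of "[p,q,r,s,u,v]" _ _ _ _ v], (rule reify)+, code_simp, use assms that in simp)
  show "row_op R i k s (\<ominus> q) (\<ominus> r) p (row_op R i k p q r s f) x y = f x y"
    using a[of "f i y" "f k y"] f assms(1) by (simp add: row_op_def)
qed

lemma row_op_GL:
  assumes "i < n" "k < n" "i \<noteq> k" "p \<in> carrier R" "q \<in> carrier R" "r \<in> carrier R" "s \<in> carrier R"
    and 1: "p \<otimes> s = \<one> \<oplus> q \<otimes> r"
  shows "mat n n (\<lambda>(x, y). row_op R i k p q r s delta x y) \<in> GL n R"
proof -
  have cl: "mat n n (\<lambda>(x, y). row_op R i k p q r s delta x y) \<in> ring_mats R n n"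
    if "p \<in> carrier R" "q \<in> carrier R" "r \<in> carrier R" "s \<in> carrier R" for p q r s
    using that by (auto simp: ring_mats_def row_op_def)
  \<comment> \<open>Proved for arbitrary coefficients, because the other inverse law is the same
    statement about the adjugate.\<close>
  have inv: "mat_mult R (mat n n (\<lambda>(x, y). row_op R i k s (\<ominus> q) (\<ominus> r) p delta x y))
      (mat n n (\<lambda>(x, y). row_op R i k p q r s delta x y)) = mat_one R n"
    if 2: "p \<in> carrier R" "q \<in> carrier R" "r \<in> carrier R" "s \<in> carrier R" "p \<otimes> s = \<one> \<oplus> q \<otimes> r" for p q r s
  proof -
    have "row_op R i k p q r s delta x y \<in> carrier R" for x y using 2 by (simp add: row_op_def)
    then show ?thesis
      using 2 assms(1-3) by (simp add: row_op_mat_mult row_op_row_op mat_one_delta)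
  qed
  have "s \<otimes> p = \<one> \<oplus> \<ominus> q \<otimes> \<ominus> r"
    using 1 assms(4-7) by (simp add: m_comm l_minus r_minus)
  from inv[OF _ _ _ _ this] inv[OF _ _ _ _ 1] cl assms(4-7) show ?thesis
    unfolding GL_def by (auto intro!: bexI[of _ "mat n n (\<lambda>(x, y). row_op R i k s (\<ominus> q) (\<ominus> r) p delta x y)"])
qed

lemma reach_imp_equivalent:
  assumes "reach R m n f g" and f: "\<And>i j. f i j \<in> carrier R"
  shows "\<exists>P\<in>GL m R. \<exists>Q\<in>GL n R.
    mat_mult R (mat_mult R P (mat m n (\<lambda>(x, y). f x y))) Q = mat m n (\<lambda>(x, y). g x y)"
  using assms(1)
proof (induction rule: reach.induct)
  case refl
  have "mat m n (\<lambda>(x, y). f x y) \<in> ring_mats R m n" using f by (auto simp: ring_mats_def)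
  moreover have "mat_one R k \<in> GL k R" for k
    unfolding GL_def using mat_one_closed mat_one_mult[OF mat_one_closed] by blast
  ultimately show ?case by (metis mat_one_mult mat_mult_one)
next
  case (row g i k p q r s)
  let ?F = "mat m n (\<lambda>(x, y). f x y)"
  let ?E = "mat m m (\<lambda>(x, y). row_op R i k p q r s delta x y)"
  from row obtain P Q where PQ: "P \<in> GL m R" "Q \<in> GL n R"
    "mat_mult R (mat_mult R P ?F) Q = mat m n (\<lambda>(x, y). g x y)" by blast
  have E: "?E \<in> GL m R" using row by (intro row_op_GL)
  have c: "?F \<in> ring_mats R m n" "P \<in> ring_mats R m m" "Q \<in> ring_mats R n n" "?E \<in> ring_mats R m m"
    using f PQ E by (auto simp: ring_mats_def GL_def)
  have "mat_mult R (mat_mult R (mat_mult R ?E P) ?F) Q = mat_mult R ?E (mat_mult R (mat_mult R P ?F) Q)"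
    using c by (simp add: mat_mult_assoc[OF c(4,2,1)] mat_mult_assoc[OF c(4) mat_mult_closed[OF c(2,1)] c(3)])
  also have "\<dots> = mat m n (\<lambda>(x, y). row_op R i k p q r s g x y)"
    unfolding PQ(3) using row reach_closed[OF row(1) f] by (intro row_op_mat_mult)
  finally show ?case using GL_mult[OF E PQ(1)] PQ(2) by blast
next
  case (col g i k p q r s)
  let ?F = "mat m n (\<lambda>(x, y). f x y)"
  let ?E = "transpose_mat (mat n n (\<lambda>(x, y). row_op R i k p q r s delta x y))"
  from col obtain P Q where PQ: "P \<in> GL m R" "Q \<in> GL n R"
    "mat_mult R (mat_mult R P ?F) Q = mat m n (\<lambda>(x, y). g x y)" by blast
  have E: "?E \<in> GL n R" using col by (intro row_op_GL GL_transpose)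
  have c: "?F \<in> ring_mats R m n" "P \<in> ring_mats R m m" "Q \<in> ring_mats R n n" "?E \<in> ring_mats R n n"
    using f PQ E by (auto simp: ring_mats_def GL_def)
  have "mat_mult R (mat_mult R P ?F) (mat_mult R Q ?E) = mat_mult R (mat_mult R (mat_mult R P ?F) Q) ?E"
    using c by (simp add: mat_mult_assoc[OF mat_mult_closed[OF c(2,1)] c(3,4)])
  also have "\<dots> = mat m n (\<lambda>(x, y). col_op R i k p q r s g x y)"
    unfolding PQ(3) using col reach_closed[OF col(1) f] by (intro col_op_mat_mult)
  finally show ?case using GL_mult[OF PQ(2) E] PQ(1) by blast
qed

lemma kaplansky_imp_elementary_divisor:
  assumes H: "hermite_ring R" and K: kaplansky_cond
  shows "elementary_divisor_ring R"
  unfolding elementary_divisor_ring_def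
proof (intro allI impI ballI)
  fix m n A assume mn: "1 \<le> m" "1 \<le> n" and A: "A \<in> ring_mats R m n"
  \<comment> \<open>The value \<open>\<zero>\<close> outside the range makes \<open>f\<close> closed
    at all indices, as the lemmas on \<open>reach\<close> demand.\<close>
  define f where "f = (\<lambda>i j. if i < m \<and> j < n then A $$ (i, j) else \<zero>)"
  have fc: "f i j \<in> carrier R" for i j using A by (simp add: f_def ring_mats_def)
  have Af: "A = mat m n (\<lambda>(x, y). f x y)" by (rule eq_matI) (use A in \<open>auto simp: f_def ring_mats_def\<close>)
  from reach_smith[where f = f and m = m and n = n, OF H K fc] obtain g where
    g: "reach R m n f g" "\<forall>i<m. \<forall>j<n. i \<noteq> j \<longrightarrow> g i j = \<zero>"
    "\<forall>i. Suc i < min m n \<longrightarrow> g i i divides g (Suc i) (Suc i)"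
    by (elim exE conjE) (rule that)
  from reach_imp_equivalent[where f = f, OF g(1) fc] obtain P Q where PQ: "P \<in> GL m R" "Q \<in> GL n R"
    "mat_mult R (mat_mult R P A) Q = mat m n (\<lambda>(x, y). g x y)" unfolding Af by blast
  show "\<exists>P\<in>GL m R. \<exists>Q\<in>GL n R. let D = mat_mult R (mat_mult R P A) Q in
    (\<forall>i<m. \<forall>j<n. i \<noteq> j \<longrightarrow> D $$ (i, j) = \<zero>) \<and>
    (\<forall>i. Suc i < min m n \<longrightarrow> D $$ (i, i) divides D $$ (Suc i, Suc i))"
    by (rule bexI[OF _ PQ(1)], rule bexI[OF _ PQ(2)]) (use g in \<open>simp add: PQ(3)\<close>)
qed

section \<open>Units of quotient rings\<close>

text \<open>Quotient elements are handled through representatives, with the multiple of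
  \<open>d\<close> explicit, so that equations modulo \<open>d\<close> become polynomial identities
  in \<open>R\<close>.\<close>

definition cong_mod :: "'a \<Rightarrow> 'a \<Rightarrow> 'a \<Rightarrow> bool"
  where "cong_mod d x y \<longleftrightarrow> (\<exists>k\<in>carrier R. x = y \<oplus> d \<otimes> k)"

definition unit_mod :: "'a \<Rightarrow> 'a \<Rightarrow> bool"
  where "unit_mod d x \<longleftrightarrow> (\<exists>x'\<in>carrier R. cong_mod d (x \<otimes> x') \<one>)"

lemma cgen_coset_eq:
  assumes "d \<in> carrier R" "x \<in> carrier R" "y \<in> carrier R"
  shows "PIdl d +> x = PIdl d +> y \<longleftrightarrow> cong_mod d x y"
proof -
  have "PIdl d +> x = PIdl d +> y \<longleftrightarrow> x \<ominus> y \<in> PIdl d"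
    using quotient_eq_iff_same_a_r_cos[OF cgenideal_ideal] assms by simp
  also have "\<dots> \<longleftrightarrow> (\<exists>k\<in>carrier R. x \<ominus> y = k \<otimes> d)" by (auto simp: cgenideal_def)
  also have "\<dots> \<longleftrightarrow> (\<exists>k\<in>carrier R. x = y \<oplus> d \<otimes> k)"
  proof (rule bex_cong[OF HOL.refl])
    fix k assume k: "k \<in> carrier R"
    show "x \<ominus> y = k \<otimes> d \<longleftrightarrow> x = y \<oplus> d \<otimes> k"
    proof
      assume 1: "x \<ominus> y = k \<otimes> d"
      show "x = y \<oplus> d \<otimes> k"
        by (rule ring_eqI1[OF 1, of "[x,y,d,k]" _ _ _ _ \<one>], (rule reify)+, code_simp, use k assms in simp)
    next
      assume 1: "x = y \<oplus> d \<otimes> k"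
      show "x \<ominus> y = k \<otimes> d"
        by (rule ring_eqI1[OF 1, of "[x,y,d,k]" _ _ _ _ \<one>], (rule reify)+, code_simp, use k assms in simp)
    qed
  qed
  finally show ?thesis by (simp add: cong_mod_def)
qed

lemma Units_quot_iff:
  assumes d: "d \<in> carrier R"
  shows "X \<in> Units (R Quot (PIdl d)) \<longleftrightarrow>
    (\<exists>x\<in>carrier R. X = PIdl d +> x \<and> unit_mod d x)"
proof -
  interpret I: ideal "PIdl d" R using d by (rule cgenideal_ideal)
  interpret Q: cring "R Quot (PIdl d)" by (rule I.quotient_is_cring) (rule is_cring)
  have carr: "X \<in> carrier (R Quot (PIdl d)) \<longleftrightarrow> (\<exists>x\<in>carrier R. X = PIdl d +> x)" for X
    by (auto simp: FactRing_def A_RCOSETS_def')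
  have "X \<in> Units (R Quot (PIdl d)) \<longleftrightarrow>
    (\<exists>x\<in>carrier R. \<exists>x'\<in>carrier R. X = PIdl d +> x \<and>
      (PIdl d +> x) \<otimes>\<^bsub>R Quot (PIdl d)\<^esub> (PIdl d +> x') = \<one>\<^bsub>R Quot (PIdl d)\<^esub>)"
    unfolding Units_def using Q.m_comm carr by (auto; metis)
  also have "\<dots> \<longleftrightarrow> (\<exists>x\<in>carrier R. \<exists>x'\<in>carrier R. X = PIdl d +> x \<and> PIdl d +> (x \<otimes> x') = PIdl d +> \<one>)"
    by (intro bex_cong HOL.refl) (simp add: FactRing_def I.rcoset_mult_add)
  also have "\<dots> \<longleftrightarrow> (\<exists>x\<in>carrier R. X = PIdl d +> x \<and> unit_mod d x)"
    using d by (intro bex_cong HOL.refl) (simp add: cgen_coset_eq unit_mod_def)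
  finally show ?thesis .
qed

lemma quot_proj_coset:
  assumes I: "ideal I R" and J: "ideal J R" and IJ: "I \<subseteq> J" and x: "x \<in> carrier R"
  shows "quot_proj R J (I +> x) = J +> x"
proof -
  interpret I: ideal I R by fact
  interpret J: ideal J R by fact
  have "J +> y = J +> x" if "y \<in> I +> x" for y
  proof -
    from that obtain i where i: "i \<in> I" "y = i \<oplus> x" by (auto simp: a_r_coset_def')
    then have "i \<in> carrier R" using I.a_subset by blast
    then have "y \<ominus> x = i" using i x by (simp add: minus_eq a_assoc r_neg)
    then show ?thesis using i IJ x \<open>i \<in> carrier R\<close>
      by (subst quotient_eq_iff_same_a_r_cos[OF J, symmetric]) auto
  qed
  moreover have "x \<in> I +> x" using x by (rule I.a_rcos_self)
  ultimately show ?thesis unfolding quot_proj_def by blast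
qed

lemma cgenideal_mult_subset:
  assumes "a \<in> carrier R" "c \<in> carrier R"
  shows "PIdl (a \<otimes> c) \<subseteq> PIdl c"
proof
  fix w assume "w \<in> PIdl (a \<otimes> c)"
  then obtain v where v: "v \<in> carrier R" "w = v \<otimes> (a \<otimes> c)" unfolding cgenideal_def by blast
  have "w = (v \<otimes> a) \<otimes> c" "v \<otimes> a \<in> carrier R" using v assms by (simp_all add: m_assoc)
  then show "w \<in> PIdl c" unfolding cgenideal_def by blast
qed

text \<open>Choosing representatives removes the quotient rings and the natural projections from the
  condition.\<close>

lemma WU2_ring_iff:
  "WU2_ring R \<longleftrightarrow> (\<forall>(a, b)\<in>Um2 R. \<forall>c\<in>carrier R. \<forall>x\<in>carrier R. unit_mod c x \<longrightarrow>
    (\<exists>y\<in>carrier R. \<exists>z\<in>carrier R.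
      unit_mod (a \<otimes> c) y \<and> unit_mod (b \<otimes> c) z \<and> cong_mod c (x \<otimes> x) (y \<otimes> z)))"
  (is "_ \<longleftrightarrow> (\<forall>(a, b)\<in>Um2 R. \<forall>c\<in>carrier R. ?P a b c)")
proof -
  have "({x \<otimes>\<^bsub>R Quot (PIdl c)\<^esub> x | x. x \<in> Units (R Quot (PIdl c))} \<subseteq>
    (\<lambda>(y, z). quot_proj R (PIdl c) y \<otimes>\<^bsub>R Quot (PIdl c)\<^esub> quot_proj R (PIdl c) z) `
      (Units (R Quot (PIdl (a \<otimes> c))) \<times> Units (R Quot (PIdl (b \<otimes> c))))) \<longleftrightarrow> ?P a b c"
    (is "?L \<subseteq> ?f ` (?U \<times> ?V) \<longleftrightarrow> _")
    if abc: "a \<in> carrier R" "b \<in> carrier R" "c \<in> carrier R" for a b c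
  proof -
    have mult: "(PIdl c +> x) \<otimes>\<^bsub>R Quot (PIdl c)\<^esub> (PIdl c +> y) = PIdl c +> (x \<otimes> y)"
      if "x \<in> carrier R" "y \<in> carrier R" for x y
      using ideal.rcoset_mult_add[OF cgenideal_ideal[OF abc(3)] that] by (simp add: FactRing_def)
    have proj: "quot_proj R (PIdl c) (PIdl (a \<otimes> c) +> x) = PIdl c +> x"
      if "a \<in> carrier R" "x \<in> carrier R" for a x
      by (rule quot_proj_coset[OF cgenideal_ideal cgenideal_ideal cgenideal_mult_subset]) (use that abc in simp_all)
    have img: "PIdl c +> w \<in> ?f ` (?U \<times> ?V) \<longleftrightarrow>
      (\<exists>y\<in>carrier R. \<exists>z\<in>carrier R. unit_mod (a \<otimes> c) y \<and> unit_mod (b \<otimes> c) z \<and> cong_mod c w (y \<otimes> z))"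
      if w: "w \<in> carrier R" for w
    proof -
      have "PIdl c +> w \<in> ?f ` (?U \<times> ?V) \<longleftrightarrow> (\<exists>Y\<in>?U. \<exists>Z\<in>?V. PIdl c +> w =
          quot_proj R (PIdl c) Y \<otimes>\<^bsub>R Quot (PIdl c)\<^esub> quot_proj R (PIdl c) Z)"
        by (simp add: image_iff Bex_def)
      also have "\<dots> \<longleftrightarrow> (\<exists>y\<in>carrier R. \<exists>z\<in>carrier R. unit_mod (a \<otimes> c) y \<and> unit_mod (b \<otimes> c) z \<and>
          PIdl c +> w = quot_proj R (PIdl c) (PIdl (a \<otimes> c) +> y) \<otimes>\<^bsub>R Quot (PIdl c)\<^esub>
            quot_proj R (PIdl c) (PIdl (b \<otimes> c) +> z))"
        unfolding Bex_def Units_quot_iff[OF m_closed[OF abc(1,3)]] Units_quot_iff[OF m_closed[OF abc(2,3)]]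
        by metis
      also have "\<dots> \<longleftrightarrow> (\<exists>y\<in>carrier R. \<exists>z\<in>carrier R. unit_mod (a \<otimes> c) y \<and> unit_mod (b \<otimes> c) z \<and>
          cong_mod c w (y \<otimes> z))"
        using abc w by (intro bex_cong HOL.refl) (simp add: proj mult cgen_coset_eq)
      finally show ?thesis .
    qed
    have "?L \<subseteq> ?f ` (?U \<times> ?V) \<longleftrightarrow> (\<forall>X\<in>Units (R Quot PIdl c). X \<otimes>\<^bsub>R Quot (PIdl c)\<^esub> X \<in> ?f ` (?U \<times> ?V))"
      by blast
    also have "\<dots> \<longleftrightarrow> (\<forall>x\<in>carrier R. unit_mod c x \<longrightarrow>
        (PIdl c +> x) \<otimes>\<^bsub>R Quot (PIdl c)\<^esub> (PIdl c +> x) \<in> ?f ` (?U \<times> ?V))"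
      unfolding Ball_def Units_quot_iff[OF abc(3)] by metis
    also have "\<dots> \<longleftrightarrow> ?P a b c"
      by (intro ball_cong HOL.refl) (simp only: mult img m_closed)
    finally show ?thesis .
  qed
  note eq = this
  show ?thesis unfolding WU2_ring_def
  proof (rule ball_cong[OF HOL.refl])
    fix X assume "X \<in> Um2 R"
    moreover obtain a b where X: "X = (a, b)" by (cases X)
    ultimately have ab: "a \<in> carrier R" "b \<in> carrier R" by (simp_all add: Um2_iff)
    show "(case X of (a, b) \<Rightarrow> \<forall>c\<in>carrier R.
        {x \<otimes>\<^bsub>R Quot (PIdl c)\<^esub> x | x. x \<in> Units (R Quot (PIdl c))} \<subseteq>
        (\<lambda>(y, z). quot_proj R (PIdl c) y \<otimes>\<^bsub>R Quot (PIdl c)\<^esub> quot_proj R (PIdl c) z) `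
          (Units (R Quot (PIdl (a \<otimes> c))) \<times> Units (R Quot (PIdl (b \<otimes> c))))) \<longleftrightarrow>
      (case X of (a, b) \<Rightarrow> \<forall>c\<in>carrier R. ?P a b c)"
      unfolding X prod.case[of _ a b] by (rule ball_cong[OF HOL.refl]) (rule eq[OF ab])
  qed
qed

section \<open>Elementary divisor rings satisfy the \<open>WU2_ring\<close> condition\<close>

lemma mat_mult_2:
  assumes "A \<in> ring_mats R 2 2" "B \<in> ring_mats R 2 2" "i < 2" "j < 2"
  shows "mat_mult R A B $$ (i, j) = A $$ (i, 0) \<otimes> B $$ (0, j) \<oplus> A $$ (i, 1) \<otimes> B $$ (1, j)"
proof -
  have c: "\<And>i j. i < 2 \<Longrightarrow> j < 2 \<Longrightarrow> A $$ (i, j) \<in> carrier R" "\<And>i j. i < 2 \<Longrightarrow> j < 2 \<Longrightarrow> B $$ (i, j) \<in> carrier R"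
    and [simp]: "dim_row A = 2" "dim_col A = 2" "dim_col B = 2"
    using assms by (auto simp: ring_mats_def)
  have "{..<2} = {1, 0::nat}" by auto
  then have "mat_mult R A B $$ (i, j) = (\<Oplus>k\<in>{1, 0::nat}. A $$ (i, k) \<otimes> B $$ (k, j))"
    using assms(3,4) by (simp add: mat_mult_def)
  also have "\<dots> = A $$ (i, 0) \<otimes> B $$ (0, j) \<oplus> A $$ (i, 1) \<otimes> B $$ (1, j)"
    using c assms(3,4) by (simp add: a_comm)
  finally show ?thesis .
qed

lemma mat_mult_divides:
  assumes A: "A \<in> ring_mats R 2 2" and B: "B \<in> ring_mats R 2 2" and e: "e \<in> carrier R"
    and d: "(\<forall>i<2. \<forall>j<2. e divides A $$ (i, j)) \<or> (\<forall>i<2. \<forall>j<2. e divides B $$ (i, j))"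
    and ij: "i < 2" "j < 2"
  shows "e divides mat_mult R A B $$ (i, j)"
proof -
  have A': "A $$ (i, j) \<in> carrier R" and B': "B $$ (i, j) \<in> carrier R" if "i < 2" "j < 2" for i j
    using that A B by (auto simp: ring_mats_def)
  from d show ?thesis
  proof
    assume "\<forall>i<2. \<forall>j<2. e divides A $$ (i, j)"
    then have "e divides (B $$ (0, j) \<otimes> A $$ (i, 0) \<oplus> B $$ (1, j) \<otimes> A $$ (i, 1))"
      using ij A' B' e by (intro divides_lincomb) auto
    then show ?thesis using ij A' B' by (simp add: mat_mult_2[OF A B ij] m_comm)
  next
    assume "\<forall>i<2. \<forall>j<2. e divides B $$ (i, j)"
    then show ?thesis unfolding mat_mult_2[OF A B ij]
      using ij A' B' e by (intro divides_lincomb) auto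
  qed
qed

text \<open>The first diagonal entry \<open>g\<close> of \<open>D = P A Q\<close> divides
  \<open>D\<close>, hence also \<open>A\<close>. So it divides \<open>a c\<close> and
  \<open>b c\<close>, therefore \<open>c\<close>, and it divides \<open>w\<close>, a unit modulo
  \<open>c\<close>: thus \<open>g\<close> is a unit. After rescaling, the first row of
  \<open>P\<close> and the first column of \<open>Q\<close> solve \<open>p A q = 1\<close>, and this
  one equation contains the factorisation.\<close>

lemma elementary_divisor_imp_WU2:
  assumes E: "elementary_divisor_ring R"
  shows "WU2_ring R"
  unfolding WU2_ring_iff
proof (intro ballI allI impI, clarify)
  fix a b c x
  assume ab: "(a, b) \<in> Um2 R" and c: "c \<in> carrier R" and "x \<in> carrier R" "unit_mod c x"
  then obtain x' k where x: "x \<in> carrier R" "x' \<in> carrier R" "k \<in> carrier R"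
    and xx: "x \<otimes> x' = \<one> \<oplus> c \<otimes> k" by (auto simp: unit_mod_def cong_mod_def)
  from ab obtain e f where ef: "a \<in> carrier R" "b \<in> carrier R" "e \<in> carrier R" "f \<in> carrier R"
    "e \<otimes> a \<oplus> f \<otimes> b = \<one>" by (auto simp: Um2_iff)
  define w where "w = x \<otimes> x"
  have w: "w \<in> carrier R" using x by (simp add: w_def)
  define A where "A = mat 2 2 (\<lambda>(i, j). if i = 0 then if j = 0 then a \<otimes> c else w else if j = 0 then \<zero> else b \<otimes> c)"
  have A: "A \<in> ring_mats R 2 2" using ef c w by (auto simp: A_def ring_mats_def)
  have A_entries: "A $$ (0, 0) = a \<otimes> c" "A $$ (0, 1) = w" "A $$ (1, 0) = \<zero>" "A $$ (1, 1) = b \<otimes> c"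
    by (simp_all add: A_def)
  from E[unfolded elementary_divisor_ring_def, rule_format, of 2 2, OF _ _ A] obtain P Q where
    P: "P \<in> GL 2 R" and Q: "Q \<in> GL 2 R" and
    D: "let D = mat_mult R (mat_mult R P A) Q in (\<forall>i<2. \<forall>j<2. i \<noteq> j \<longrightarrow> D $$ (i, j) = \<zero>) \<and>
        (\<forall>i. Suc i < min 2 2 \<longrightarrow> D $$ (i, i) divides D $$ (Suc i, Suc i))" by auto
  define D where "D = mat_mult R (mat_mult R P A) Q"
  have D0: "D $$ (0, 1) = \<zero>" "D $$ (1, 0) = \<zero>" "D $$ (0, 0) divides D $$ (1, 1)"
    using D by (auto simp: D_def[symmetric])
  obtain P' where P': "P \<in> ring_mats R 2 2" "P' \<in> ring_mats R 2 2" "mat_mult R P' P = mat_one R 2"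
    using P by (auto simp: GL_def)
  obtain Q' where Q': "Q \<in> ring_mats R 2 2" "Q' \<in> ring_mats R 2 2" "mat_mult R Q Q' = mat_one R 2"
    using Q by (auto simp: GL_def)
  have PA: "mat_mult R P A \<in> ring_mats R 2 2" using P' A mat_mult_closed by blast
  have Dc: "D \<in> ring_mats R 2 2" unfolding D_def using PA Q' mat_mult_closed by blast
  define g where "g = D $$ (0, 0)"
  have g: "g \<in> carrier R" using Dc by (simp add: g_def ring_mats_def)
  have gD: "\<forall>i<2. \<forall>j<2. g divides D $$ (i, j)"
  proof (intro allI impI)
    fix i j :: nat assume "i < 2" "j < 2"
    moreover have "g divides g" using g by simp
    ultimately show "g divides D $$ (i, j)"
      using D0 g unfolding g_def[symmetric] by (auto simp: less_2_cases_iff g_def)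
  qed
  have "mat_mult R P' (mat_mult R D Q') = mat_mult R P' (mat_mult R P A)"
    using mat_mult_assoc[OF PA Q'(1,2)] PA by (simp add: D_def Q'(3) mat_mult_one)
  also have "\<dots> = A"
    using mat_mult_assoc[OF P'(2,1) A] by (simp add: P'(3) mat_one_mult[OF A])
  finally have A_eq: "A = mat_mult R P' (mat_mult R D Q')" by simp
  have "\<forall>i<2. \<forall>j<2. g divides mat_mult R D Q' $$ (i, j)"
    using mat_mult_divides[OF Dc Q'(2) g] gD by blast
  then have gA: "g divides A $$ (i, j)" if "i < 2" "j < 2" for i j
    unfolding A_eq using mat_mult_divides[OF P'(2) mat_mult_closed[OF Dc Q'(2)] g] that by blast
  obtain g1 g2 g3 where g123: "g1 \<in> carrier R" "g2 \<in> carrier R" "g3 \<in> carrier R"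
    "a \<otimes> c = g \<otimes> g1" "w = g \<otimes> g2" "b \<otimes> c = g \<otimes> g3"
    using gA[of 0 0] gA[of 0 1] gA[of 1 1] unfolding A_entries factor_def by auto
  \<comment> \<open>From \<open>x x' = 1 + c k\<close> follows
    \<open>x\<^sup>2 x'\<^sup>2 = 1 + c (2 k + c k\<^sup>2)\<close>. Both \<open>x\<^sup>2\<close>
    and \<open>c\<close> are multiples of \<open>g\<close>; dividing out \<open>g\<close> gives its
    inverse.\<close>
  define h where "h = g2 \<otimes> x' \<otimes> x' \<ominus> (e \<otimes> g1 \<oplus> f \<otimes> g3) \<otimes> (k \<oplus> k \<oplus> c \<otimes> k \<otimes> k)"
  have h: "h \<in> carrier R" using g123 x ef c by (simp add: h_def)
  have ceq: "g \<otimes> (e \<otimes> g1 \<oplus> f \<otimes> g3) = c"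
    by (rule ring_eqI3[OF g123(4,6) ef(5), of "[g,g1,g3,e,f,a,b,c]" _ _ _ _ "\<ominus> e" _ _ _ "\<ominus> f" _ _ _ c],
      (rule reify)+, code_simp, use g123 g ef c in simp)
  define j where "j = e \<otimes> g1 \<oplus> f \<otimes> g3"
  have j: "j \<in> carrier R" using g123 ef by (simp add: j_def)
  have gh: "g \<otimes> h = \<one>"
    unfolding h_def j_def[symmetric]
    by (rule ring_eqI3[OF ceq[folded j_def] g123(5)[unfolded w_def] xx, of "[g,g2,j,x,x',k,c]" _ _ _ _
          "\<ominus> (k \<oplus> k \<oplus> c \<otimes> k \<otimes> k)" _ _ _ "\<ominus> (x' \<otimes> x')" _ _ _ "x \<otimes> x' \<oplus> \<one> \<oplus> c \<otimes> k"],
      (rule reify)+, code_simp, use g123 g j c x in simp)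
  define p1 p2 q1 q2 where "p1 = P $$ (0, 0)" and "p2 = P $$ (0, 1)" and
    "q1 = Q $$ (0, 0) \<otimes> h" and "q2 = Q $$ (1, 0) \<otimes> h"
  have pq: "p1 \<in> carrier R" "p2 \<in> carrier R" "q1 \<in> carrier R" "q2 \<in> carrier R"
    using P'(1) Q'(1) h by (simp_all add: p1_def p2_def q1_def q2_def ring_mats_def)
  have key: "p1 \<otimes> a \<otimes> c \<otimes> q1 \<oplus> (p1 \<otimes> w \<oplus> p2 \<otimes> (b \<otimes> c)) \<otimes> q2 = \<one>"
  proof -
    have Qc: "Q $$ (0, 0) \<in> carrier R" "Q $$ (1, 0) \<in> carrier R" using Q'(1) by (simp_all add: ring_mats_def)
    have "g = p1 \<otimes> (a \<otimes> c) \<otimes> Q $$ (0, 0) \<oplus> (p1 \<otimes> w \<oplus> p2 \<otimes> (b \<otimes> c)) \<otimes> Q $$ (1, 0)"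
      unfolding g_def D_def using mat_mult_2[OF PA Q'(1), of 0 0] mat_mult_2[OF P'(1) A, of 0 0]
        mat_mult_2[OF P'(1) A, of 0 1] pq ef c w by (simp add: A_entries p1_def p2_def del: One_nat_def)
    then have "\<one> = (p1 \<otimes> (a \<otimes> c) \<otimes> Q $$ (0, 0) \<oplus> (p1 \<otimes> w \<oplus> p2 \<otimes> (b \<otimes> c)) \<otimes> Q $$ (1, 0)) \<otimes> h"
      using gh by simp
    also have "\<dots> = p1 \<otimes> a \<otimes> c \<otimes> q1 \<oplus> (p1 \<otimes> w \<oplus> p2 \<otimes> (b \<otimes> c)) \<otimes> q2"
      unfolding q1_def q2_def
      by (rule ring_eqI[of "[p1,p2,a,b,c,w,h,Q $$ (0, 0), Q $$ (1, 0)]"], (rule reify)+, code_simp,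
        use Qc pq ef c w h in simp)
    finally show ?thesis ..
  qed
  \<comment> \<open>Read modulo \<open>a c\<close>, \<open>key\<close> says that
    \<open>p1 w + p2 b c\<close> has inverse \<open>q2\<close>; modulo \<open>b c\<close>, that
    \<open>a c q1 + w q2\<close> has inverse \<open>p1\<close>. Modulo \<open>c\<close> their
    product is \<open>w (p1 w q2)\<close>, and \<open>p1 w q2\<close> is \<open>1\<close>
    there.\<close>
  have y: "(p1 \<otimes> w \<oplus> p2 \<otimes> (b \<otimes> c)) \<otimes> q2 = \<one> \<oplus> a \<otimes> c \<otimes> (\<ominus> (p1 \<otimes> q1))"
    by (rule ring_eqI1[OF key, of "[p1,p2,q1,q2,w,a,b,c]" _ _ _ _ \<one>], (rule reify)+, code_simp, use pq ef c w in simp)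
  have z: "(a \<otimes> c \<otimes> q1 \<oplus> w \<otimes> q2) \<otimes> p1 = \<one> \<oplus> b \<otimes> c \<otimes> (\<ominus> (p2 \<otimes> q2))"
    by (rule ring_eqI1[OF key, of "[p1,p2,q1,q2,w,a,b,c]" _ _ _ _ \<one>], (rule reify)+, code_simp, use pq ef c w in simp)
  \<comment> \<open>The quotient by \<open>c\<close> of \<open>w\<close> times the left side of
    \<open>key\<close> minus the product of the two units.\<close>
  define n where "n = w \<otimes> (p1 \<otimes> a \<otimes> q1 \<oplus> p2 \<otimes> b \<otimes> q2) \<ominus> (p1 \<otimes> w \<otimes> a \<otimes> q1 \<oplus> p2 \<otimes> b \<otimes> (a \<otimes> c \<otimes> q1 \<oplus> w \<otimes> q2))"
  have n: "n \<in> carrier R" using pq ef c w by (simp add: n_def)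
  have "w = (p1 \<otimes> w \<oplus> p2 \<otimes> (b \<otimes> c)) \<otimes> (a \<otimes> c \<otimes> q1 \<oplus> w \<otimes> q2) \<oplus> c \<otimes> n"
    unfolding n_def
    by (rule ring_eqI1[OF key, of "[p1,p2,q1,q2,w,a,b,c]" _ _ _ _ "\<ominus> w"], (rule reify)+, code_simp, use pq ef c w in simp)
  then have w_eq: "x \<otimes> x = (p1 \<otimes> w \<oplus> p2 \<otimes> (b \<otimes> c)) \<otimes> (a \<otimes> c \<otimes> q1 \<oplus> w \<otimes> q2) \<oplus> c \<otimes> n"
    by (simp add: w_def)
  have cl: "p1 \<otimes> w \<oplus> p2 \<otimes> (b \<otimes> c) \<in> carrier R" "a \<otimes> c \<otimes> q1 \<oplus> w \<otimes> q2 \<in> carrier R"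
    "\<ominus> (p1 \<otimes> q1) \<in> carrier R" "\<ominus> (p2 \<otimes> q2) \<in> carrier R"
    using pq ef c w by simp_all
  have "unit_mod (a \<otimes> c) (p1 \<otimes> w \<oplus> p2 \<otimes> (b \<otimes> c))"
    unfolding unit_mod_def cong_mod_def using y pq(4) cl(3) by blast
  moreover have "unit_mod (b \<otimes> c) (a \<otimes> c \<otimes> q1 \<oplus> w \<otimes> q2)"
    unfolding unit_mod_def cong_mod_def using z pq(1) cl(4) by blast
  moreover have "cong_mod c (x \<otimes> x) ((p1 \<otimes> w \<oplus> p2 \<otimes> (b \<otimes> c)) \<otimes> (a \<otimes> c \<otimes> q1 \<oplus> w \<otimes> q2))"
    unfolding cong_mod_def using w_eq n by blast
  ultimately show "\<exists>y\<in>carrier R. \<exists>z\<in>carrier R.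
      unit_mod (a \<otimes> c) y \<and> unit_mod (b \<otimes> c) z \<and> cong_mod c (x \<otimes> x) (y \<otimes> z)"
    using cl(1,2) by blast
qed

section \<open>Reduction to symmetric matrices\<close>

text \<open>If \<open>A = (a, b; b, c)\<close> is unimodular of determinant \<open>0\<close> modulo \<open>d\<close>, then \<open>x A y = 1\<close> is solvable
  modulo \<open>d\<close>.\<close>

definition symmetric_cond :: bool where
  "symmetric_cond \<longleftrightarrow> (\<forall>d\<in>carrier R. \<forall>a\<in>carrier R. \<forall>b\<in>carrier R. \<forall>c\<in>carrier R.
    \<forall>x\<in>carrier R. \<forall>y\<in>carrier R. \<forall>z\<in>carrier R. \<forall>k\<in>carrier R. \<forall>l\<in>carrier R.
    x \<otimes> a \<oplus> y \<otimes> b \<oplus> z \<otimes> c \<oplus> d \<otimes> k = \<one> \<longrightarrow> a \<otimes> c = b \<otimes> b \<oplus> d \<otimes> l \<longrightarrow>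
    (\<exists>x1\<in>carrier R. \<exists>x2\<in>carrier R. \<exists>y1\<in>carrier R. \<exists>y2\<in>carrier R. \<exists>k\<in>carrier R.
      x1 \<otimes> a \<otimes> y1 \<oplus> x1 \<otimes> b \<otimes> y2 \<oplus> x2 \<otimes> b \<otimes> y1 \<oplus> x2 \<otimes> c \<otimes> y2 \<oplus> d \<otimes> k = \<one>))"

lemma symmetric_condE:
  assumes symmetric_cond
    and "d \<in> carrier R" "a \<in> carrier R" "b \<in> carrier R" "c \<in> carrier R"
      "x \<in> carrier R" "y \<in> carrier R" "z \<in> carrier R" "k \<in> carrier R" "l \<in> carrier R"
    and "x \<otimes> a \<oplus> y \<otimes> b \<oplus> z \<otimes> c \<oplus> d \<otimes> k = \<one>" "a \<otimes> c = b \<otimes> b \<oplus> d \<otimes> l"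
  obtains x1 x2 y1 y2 k where "x1 \<in> carrier R" "x2 \<in> carrier R" "y1 \<in> carrier R" "y2 \<in> carrier R" "k \<in> carrier R"
    "x1 \<otimes> a \<otimes> y1 \<oplus> x1 \<otimes> b \<otimes> y2 \<oplus> x2 \<otimes> b \<otimes> y1 \<oplus> x2 \<otimes> c \<otimes> y2 \<oplus> d \<otimes> k = \<one>"
  using assms(1)[unfolded symmetric_cond_def, rule_format, OF assms(2-12)] by blast

text \<open>For symmetric \<open>S = A N\<close> the entries stay unimodular, as \<open>A\<close> is
  recovered from \<open>S\<close> by the inverse of \<open>N\<close>. Taking
  \<open>det S = a c det N\<close> itself as the modulus makes the determinant condition automatic,
  and \<open>x S y = x A (N y)\<close> carries the solution back.\<close>

lemma SU2_imp_kaplansky: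
  assumes S: "SU2_ring R" and K: symmetric_cond
  shows kaplansky_cond
  unfolding kaplansky_cond_def
proof (intro ballI impI)
  fix a b c assume abc: "a \<in> carrier R" "b \<in> carrier R" "c \<in> carrier R"
  assume "\<exists>x\<in>carrier R. \<exists>y\<in>carrier R. \<exists>z\<in>carrier R. x \<otimes> a \<oplus> y \<otimes> b \<oplus> z \<otimes> c = \<one>"
  then obtain x y z where xyz: "x \<in> carrier R" "y \<in> carrier R" "z \<in> carrier R"
    "x \<otimes> a \<oplus> y \<otimes> b \<oplus> z \<otimes> c = \<one>" by blast
  define A where "A = mat 2 2 (\<lambda>(i, j). if i = 0 then if j = 0 then a else b else if j = 0 then \<zero> else c)"
  have A: "A \<in> ring_mats R 2 2" using abc by (auto simp: A_def ring_mats_def)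
  have A_entries: "A $$ (0, 0) = a" "A $$ (0, 1) = b" "A $$ (1, 0) = \<zero>" "A $$ (1, 1) = c"
    by (simp_all add: A_def)
  from S A obtain N where N: "N \<in> GL 2 R" and sym: "transpose_mat (mat_mult R A N) = mat_mult R A N"
    unfolding SU2_ring_def by blast
  from N obtain N' where N': "N \<in> ring_mats R 2 2" "N' \<in> ring_mats R 2 2" "mat_mult R N N' = mat_one R 2"
    by (auto simp: GL_def)
  define n11 n12 n21 n22 where "n11 = N $$ (0, 0)" and "n12 = N $$ (0, 1)" and "n21 = N $$ (1, 0)" and "n22 = N $$ (1, 1)"
  define m11 m12 m21 m22 where "m11 = N' $$ (0, 0)" and "m12 = N' $$ (0, 1)" and "m21 = N' $$ (1, 0)" and "m22 = N' $$ (1, 1)"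
  have nc: "n11 \<in> carrier R" "n12 \<in> carrier R" "n21 \<in> carrier R" "n22 \<in> carrier R"
    using N'(1) by (simp_all add: ring_mats_def n11_def n12_def n21_def n22_def)
  have mc: "m11 \<in> carrier R" "m12 \<in> carrier R" "m21 \<in> carrier R" "m22 \<in> carrier R"
    using N'(2) by (simp_all add: ring_mats_def m11_def m12_def m21_def m22_def)
  have nm: "n11 \<otimes> m11 \<oplus> n12 \<otimes> m21 = \<one>" "n11 \<otimes> m12 \<oplus> n12 \<otimes> m22 = \<zero>"
    "n21 \<otimes> m11 \<oplus> n22 \<otimes> m21 = \<zero>" "n21 \<otimes> m12 \<oplus> n22 \<otimes> m22 = \<one>"
    using mat_mult_2[OF N'(1,2), of 0 0] mat_mult_2[OF N'(1,2), of 0 1]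
      mat_mult_2[OF N'(1,2), of 1 0] mat_mult_2[OF N'(1,2), of 1 1]
    unfolding N'(3) n11_def n12_def n21_def n22_def m11_def m12_def m21_def m22_def
    by (simp_all add: mat_one_def del: One_nat_def)
  have AN: "mat_mult R A N \<in> ring_mats R 2 2" using A N'(1) mat_mult_closed by blast
  have "mat_mult R A N $$ (0, 1) = transpose_mat (mat_mult R A N) $$ (0, 1)" by (simp add: sym)
  also have "\<dots> = mat_mult R A N $$ (1, 0)" using AN by (auto simp: ring_mats_def)
  finally have s12: "a \<otimes> n12 \<oplus> b \<otimes> n22 = c \<otimes> n21"
    using mat_mult_2[OF A N'(1)] abc nc
    by (simp add: A_entries n11_def n12_def n21_def n22_def del: One_nat_def)
  define s where "s = a \<otimes> n11 \<oplus> b \<otimes> n21"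
  define t where "t = c \<otimes> n21"
  define u where "u = c \<otimes> n22"
  have stu: "s \<in> carrier R" "t \<in> carrier R" "u \<in> carrier R" using abc nc by (simp_all add: s_def t_def u_def)
  define d where "d = n11 \<otimes> n22 \<ominus> n12 \<otimes> n21"
  have d: "d \<in> carrier R" using nc by (simp add: d_def)
  have a_eq: "s \<otimes> m11 \<oplus> t \<otimes> m21 = a"
    unfolding s_def t_def
    by (rule ring_eqI3[OF s12 nm(1,3), of "[a,b,c,n11,n12,n21,n22,m11,m21]" _ _ _ _ "\<ominus> m21" _ _ _ a _ _ _ b],
      (rule reify)+, code_simp, use abc nc mc in simp)
  have b_eq: "s \<otimes> m12 \<oplus> t \<otimes> m22 = b"
    unfolding s_def t_def
    by (rule ring_eqI3[OF s12 nm(2,4), of "[a,b,c,n11,n12,n21,n22,m12,m22]" _ _ _ _ "\<ominus> m22" _ _ _ a _ _ _ b],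
      (rule reify)+, code_simp, use abc nc mc in simp)
  have c_eq: "t \<otimes> m12 \<oplus> u \<otimes> m22 = c"
    unfolding t_def u_def
    by (rule ring_eqI1[OF nm(4), of "[c,n21,n22,m12,m22]" _ _ _ _ c], (rule reify)+, code_simp, use abc nc mc in simp)
  \<comment> \<open>The coefficients come from inserting \<open>A = S N'\<close> into
    \<open>x a + y b + z c = 1\<close>.\<close>
  have 1: "(x \<otimes> m11 \<oplus> y \<otimes> m12) \<otimes> s \<oplus> (x \<otimes> m21 \<oplus> y \<otimes> m22 \<oplus> z \<otimes> m12) \<otimes> t \<oplus> z \<otimes> m22 \<otimes> u \<oplus> a \<otimes> c \<otimes> d \<otimes> \<zero> = \<one>"
  proof -
    have "(x \<otimes> m11 \<oplus> y \<otimes> m12) \<otimes> s \<oplus> (x \<otimes> m21 \<oplus> y \<otimes> m22 \<oplus> z \<otimes> m12) \<otimes> t \<oplus> z \<otimes> m22 \<otimes> u \<oplus> a \<otimes> c \<otimes> d \<otimes> \<zero>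
      = x \<otimes> (s \<otimes> m11 \<oplus> t \<otimes> m21) \<oplus> y \<otimes> (s \<otimes> m12 \<oplus> t \<otimes> m22) \<oplus> z \<otimes> (t \<otimes> m12 \<oplus> u \<otimes> m22)"
      by (rule ring_eqI[of "[x,y,z,s,t,u,m11,m12,m21,m22,a,c,d]"], (rule reify)+, code_simp,
        use xyz stu mc abc d in simp)
    then show ?thesis using xyz by (simp add: a_eq b_eq c_eq)
  qed
  have 2: "s \<otimes> u = t \<otimes> t \<oplus> a \<otimes> c \<otimes> d \<otimes> \<one>"
    unfolding s_def t_def u_def d_def
    by (rule ring_eqI1[OF s12, of "[a,b,c,n11,n12,n21,n22]" _ _ _ _ "c \<otimes> n21"], (rule reify)+, code_simp,
      use abc nc in simp)
  have cl: "a \<otimes> c \<otimes> d \<in> carrier R" "x \<otimes> m11 \<oplus> y \<otimes> m12 \<in> carrier R"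
    "x \<otimes> m21 \<oplus> y \<otimes> m22 \<oplus> z \<otimes> m12 \<in> carrier R" "z \<otimes> m22 \<in> carrier R"
    using abc d xyz mc by simp_all
  from symmetric_condE[OF K cl(1) stu cl(2-4) zero_closed one_closed 1 2] obtain x1 x2 y1 y2 k where
    3: "x1 \<in> carrier R" "x2 \<in> carrier R" "y1 \<in> carrier R" "y2 \<in> carrier R" "k \<in> carrier R"
    "x1 \<otimes> s \<otimes> y1 \<oplus> x1 \<otimes> t \<otimes> y2 \<oplus> x2 \<otimes> t \<otimes> y1 \<oplus> x2 \<otimes> u \<otimes> y2 \<oplus> a \<otimes> c \<otimes> d \<otimes> k = \<one>" .
  define Y1 Y2 where "Y1 = n11 \<otimes> y1 \<oplus> n12 \<otimes> y2" and "Y2 = n21 \<otimes> y1 \<oplus> n22 \<otimes> y2"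
  have Y: "Y1 \<in> carrier R" "Y2 \<in> carrier R" using nc 3 by (simp_all add: Y1_def Y2_def)
  have "x1 \<otimes> a \<otimes> Y1 \<oplus> x1 \<otimes> b \<otimes> Y2 \<oplus> x2 \<otimes> c \<otimes> Y2 \<oplus> (d \<otimes> k) \<otimes> (a \<otimes> c) = \<one>"
    unfolding Y1_def Y2_def
    by (rule ring_eqI2[OF 3(6)[unfolded s_def t_def u_def] s12,
          of "[a,b,c,d,k,n11,n12,n21,n22,x1,x2,y1,y2]" _ _ _ _ \<one> _ _ _ "x1 \<otimes> y2"],
      (rule reify)+, code_simp, use abc d nc 3 in simp)
  then show "\<exists>x1\<in>carrier R. \<exists>x2\<in>carrier R. \<exists>y1\<in>carrier R. \<exists>y2\<in>carrier R. \<exists>k\<in>carrier R.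
      x1 \<otimes> a \<otimes> y1 \<oplus> x1 \<otimes> b \<otimes> y2 \<oplus> x2 \<otimes> c \<otimes> y2 \<oplus> k \<otimes> (a \<otimes> c) = \<one>"
    using 3(1,2,5) Y d m_closed[OF d 3(5)] by blast
qed

text \<open>\<open>(r, s; s, t) = (\<mu> a, 0; \<mu> b, m) (a, b; 0, c)\<close>, where \<open>\<mu> \<nu> = 1\<close> modulo \<open>c\<close> and \<open>m\<close> is chosen such
  that \<open>t = \<mu> b\<^sup>2 + c m\<close> is congruent to the unit \<open>\<kappa>\<close> modulo \<open>a\<close>.\<close>

lemma WU2_imp_kaplansky:
  assumes H: "hermite_ring R" and W: "WU2_ring R" and K: symmetric_cond
  shows kaplansky_cond
  unfolding kaplansky_cond_def
proof (intro ballI impI)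
  fix a b c assume abc: "a \<in> carrier R" "b \<in> carrier R" "c \<in> carrier R"
  assume "\<exists>x\<in>carrier R. \<exists>y\<in>carrier R. \<exists>z\<in>carrier R. x \<otimes> a \<oplus> y \<otimes> b \<oplus> z \<otimes> c = \<one>"
  then obtain x y z where xyz: "x \<in> carrier R" "y \<in> carrier R" "z \<in> carrier R"
    "x \<otimes> a \<oplus> y \<otimes> b \<oplus> z \<otimes> c = \<one>" by blast
  from hermiteE[OF H abc(1,3)] obtain g a' c' e f where
    g: "g \<in> carrier R" "a' \<in> carrier R" "c' \<in> carrier R" "e \<in> carrier R" "f \<in> carrier R"
    "a = g \<otimes> a'" "c = g \<otimes> c'" "e \<otimes> a' \<oplus> f \<otimes> c' = \<one>" .
  have um: "(a', c') \<in> Um2 R" using g by (auto simp: Um2_iff)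
  have by1: "b \<otimes> y = \<one> \<oplus> g \<otimes> (\<ominus> (x \<otimes> a' \<oplus> z \<otimes> c'))"
    by (rule ring_eqI1[OF xyz(4)[unfolded g(6,7)], of "[x,y,z,b,g,a',c']" _ _ _ _ \<one>], (rule reify)+, code_simp,
      use abc xyz g in simp)
  have kc: "\<ominus> (x \<otimes> a' \<oplus> z \<otimes> c') \<in> carrier R" using xyz g by simp
  have "unit_mod g b" unfolding unit_mod_def cong_mod_def using by1 kc xyz(2) by blast
  \<comment> \<open>Since \<open>a' g = a\<close> and \<open>c' g = c\<close>, the factors obtained
    for \<open>b\<^sup>2\<close> modulo \<open>g\<close> are a unit modulo \<open>a\<close> and a
    unit modulo \<open>c\<close>.\<close>
  from bspec[OF W[unfolded WU2_ring_iff] um, unfolded prod.case, rule_format, OF g(1) abc(2) this]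
  obtain \<kappa> \<nu> where
    w0: "\<kappa> \<in> carrier R" "\<nu> \<in> carrier R" "unit_mod (a' \<otimes> g) \<kappa>" "unit_mod (c' \<otimes> g) \<nu>" "cong_mod g (b \<otimes> b) (\<kappa> \<otimes> \<nu>)"
    by blast
  from w0(3) obtain \<kappa>' k1 where w3: "\<kappa>' \<in> carrier R" "k1 \<in> carrier R" "\<kappa> \<otimes> \<kappa>' = \<one> \<oplus> a' \<otimes> g \<otimes> k1"
    unfolding unit_mod_def cong_mod_def by blast
  from w0(4) obtain \<mu> k2 where w4: "\<mu> \<in> carrier R" "k2 \<in> carrier R" "\<nu> \<otimes> \<mu> = \<one> \<oplus> c' \<otimes> g \<otimes> k2"
    unfolding unit_mod_def cong_mod_def by blast
  from w0(5) obtain k3 where w5: "k3 \<in> carrier R" "b \<otimes> b = \<kappa> \<otimes> \<nu> \<oplus> g \<otimes> k3"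
    unfolding cong_mod_def by blast
  note w = w0(1,2) w3(1,2) w4(1,2) w5(1) and w1 = w3(3) and w2 = w4(3) and w3 = w5(2)
  \<comment> \<open>\<open>h\<close> is the quotient in
    \<open>\<mu> b\<^sup>2 = \<kappa> + g h\<close>. Splitting \<open>h\<close> as
    \<open>e a' h + f c' h\<close>, the choice of \<open>m\<close> cancels the second part and
    leaves \<open>\<kappa>\<close> plus a multiple of \<open>a\<close>.\<close>
  define h where "h = \<kappa> \<otimes> c' \<otimes> k2 \<oplus> k3 \<otimes> \<mu>"
  define m where "m = \<ominus> (f \<otimes> h)"
  have hm: "h \<in> carrier R" "m \<in> carrier R" using g w by (simp_all add: h_def m_def)
  have w1': "\<kappa> \<otimes> \<kappa>' = \<one> \<oplus> a \<otimes> k1" and w2': "\<nu> \<otimes> \<mu> = \<one> \<oplus> c \<otimes> k2"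
    using w1 w2 g(1-5) by (simp_all add: g(6,7) m_comm)
  have "\<mu> \<otimes> b \<otimes> b = \<kappa> \<oplus> g \<otimes> h"
    unfolding h_def
    by (rule ring_eqI2[OF w2 w3, of "[\<kappa>,\<mu>,\<nu>,b,c',g,k2,k3]" _ _ _ _ \<kappa> _ _ _ \<mu>], (rule reify)+, code_simp, use w g abc in simp)
  then have "\<mu> \<otimes> b \<otimes> b \<oplus> c \<otimes> m = \<kappa> \<oplus> g \<otimes> h \<oplus> g \<otimes> c' \<otimes> m" using g by simp
  also have "\<dots> = \<kappa> \<oplus> g \<otimes> a' \<otimes> (e \<otimes> h)"
    unfolding m_def
    by (rule ring_eqI1[OF g(8), of "[\<kappa>,g,h,a',c',e,f]" _ _ _ _ "\<ominus> (g \<otimes> h)"], (rule reify)+, code_simp, use w g hm in simp)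
  finally have A22: "\<mu> \<otimes> b \<otimes> b \<oplus> c \<otimes> m = \<kappa> \<oplus> a \<otimes> (e \<otimes> h)" by (simp add: g)
  define r where "r = \<mu> \<otimes> a \<otimes> a"
  define s where "s = \<mu> \<otimes> a \<otimes> b"
  define t where "t = \<mu> \<otimes> b \<otimes> b \<oplus> c \<otimes> m"
  have rst: "r \<in> carrier R" "s \<in> carrier R" "t \<in> carrier R" using abc w hm by (simp_all add: r_def s_def t_def)
  \<comment> \<open>\<open>i\<close> and \<open>j\<close> are the quotients in \<alpha> and \<beta>.
    These state that the entry \<open>t\<close> is a unit modulo \<open>a\<close>, and that the
    quadratic form of the symmetric matrix takes a unit value at \<open>(x, y)\<close> modulo
    \<open>c\<close>.\<close>
  define i where "i = k1 \<oplus> e \<otimes> h \<otimes> \<kappa>'"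
  define j where "j = k2 \<otimes> (\<one> \<ominus> z \<otimes> c) \<otimes> (\<one> \<ominus> z \<otimes> c) \<oplus> (z \<otimes> z \<otimes> c \<ominus> (z \<oplus> z)) \<oplus> \<nu> \<otimes> y \<otimes> y \<otimes> m"
  have ij: "i \<in> carrier R" "j \<in> carrier R" using w g hm xyz abc by (simp_all add: i_def j_def)
  have \<alpha>: "t \<otimes> \<kappa>' = \<one> \<oplus> a \<otimes> i"
    unfolding t_def A22 i_def
    by (rule ring_eqI1[OF w1', of "[\<kappa>,\<kappa>',a,k1,e,h]" _ _ _ _ \<one>], (rule reify)+, code_simp, use w g hm abc in simp)
  have xayb: "x \<otimes> a \<oplus> y \<otimes> b = \<one> \<ominus> z \<otimes> c"
    by (rule ring_eqI1[OF xyz(4), of "[x,y,z,a,b,c]" _ _ _ _ \<one>], (rule reify)+, code_simp, use abc xyz in simp)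
  have \<beta>: "\<nu> \<otimes> (x \<otimes> x \<otimes> r \<oplus> (x \<otimes> y \<oplus> x \<otimes> y) \<otimes> s \<oplus> y \<otimes> y \<otimes> t) = \<one> \<oplus> c \<otimes> j"
  proof -
    have "\<nu> \<otimes> (x \<otimes> x \<otimes> r \<oplus> (x \<otimes> y \<oplus> x \<otimes> y) \<otimes> s \<oplus> y \<otimes> y \<otimes> t) =
      \<nu> \<otimes> \<mu> \<otimes> ((x \<otimes> a \<oplus> y \<otimes> b) \<otimes> (x \<otimes> a \<oplus> y \<otimes> b)) \<oplus> c \<otimes> (\<nu> \<otimes> y \<otimes> y \<otimes> m)"
      unfolding r_def s_def t_def
      by (rule ring_eqI[of "[\<nu>,\<mu>,x,y,a,b,c,m]"], (rule reify)+, code_simp, use abc xyz w hm in simp)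
    also have "\<dots> = \<one> \<oplus> c \<otimes> j"
      unfolding xayb w2' j_def
      by (rule ring_eqI[of "[\<nu>,k2,y,z,c,m]"], (rule reify)+, code_simp, use abc xyz w hm in simp)
    finally show ?thesis .
  qed
  \<comment> \<open>The deviations from \<open>1\<close> in \<alpha> and \<beta> are multiples of
    \<open>a\<close> and of \<open>c\<close>, so their product is a multiple of \<open>a c\<close>.
    Expanding that product yields unimodularity modulo \<open>a c\<close>, with \<open>B\<close> as
    the factor from \<alpha>.\<close>
  define B where "B = \<one> \<ominus> t \<otimes> \<kappa>'"
  have B: "B \<in> carrier R" using rst w by (simp add: B_def)
  have 1: "(\<nu> \<otimes> x \<otimes> x \<otimes> B) \<otimes> r \<oplus> (\<nu> \<otimes> (x \<otimes> y \<oplus> x \<otimes> y) \<otimes> B) \<otimes> s \<oplus> (\<kappa>' \<oplus> \<nu> \<otimes> y \<otimes> y \<otimes> B) \<otimes> t \<oplus> a \<otimes> c \<otimes> (i \<otimes> j) = \<one>"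
    unfolding B_def
    by (rule ring_eqI2[OF \<alpha> \<beta>, of "[\<nu>,\<kappa>',x,y,r,s,t,a,c,i,j]" _ _ _ _
          "\<one> \<ominus> \<nu> \<otimes> (x \<otimes> x \<otimes> r \<oplus> (x \<otimes> y \<oplus> x \<otimes> y) \<otimes> s \<oplus> y \<otimes> y \<otimes> t)" _ _ _ "\<ominus> (a \<otimes> i)"],
      (rule reify)+, code_simp, use abc xyz w rst ij in simp)
  have 2: "r \<otimes> t = s \<otimes> s \<oplus> a \<otimes> c \<otimes> (\<mu> \<otimes> a \<otimes> m)"
    unfolding r_def s_def t_def
    by (rule ring_eqI[of "[\<mu>,a,b,c,m]"], (rule reify)+, code_simp, use abc w hm in simp)
  have cl: "a \<otimes> c \<in> carrier R" "\<nu> \<otimes> x \<otimes> x \<otimes> B \<in> carrier R" "\<nu> \<otimes> (x \<otimes> y \<oplus> x \<otimes> y) \<otimes> B \<in> carrier R"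
    "\<kappa>' \<oplus> \<nu> \<otimes> y \<otimes> y \<otimes> B \<in> carrier R" "i \<otimes> j \<in> carrier R" "\<mu> \<otimes> a \<otimes> m \<in> carrier R"
    using abc xyz w ij hm B by simp_all
  from symmetric_condE[OF K cl(1) rst cl(2-6) 1 2] obtain x1 x2 y1 y2 k where
    3: "x1 \<in> carrier R" "x2 \<in> carrier R" "y1 \<in> carrier R" "y2 \<in> carrier R" "k \<in> carrier R"
    "x1 \<otimes> r \<otimes> y1 \<oplus> x1 \<otimes> s \<otimes> y2 \<oplus> x2 \<otimes> s \<otimes> y1 \<oplus> x2 \<otimes> t \<otimes> y2 \<oplus> a \<otimes> c \<otimes> k = \<one>" .
  \<comment> \<open>The row \<open>(x1, x2)\<close> times \<open>M\<close>, so that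
    \<open>X A y = x (M A) y\<close>.\<close>
  define X1 X2 where "X1 = x1 \<otimes> \<mu> \<otimes> a \<oplus> x2 \<otimes> \<mu> \<otimes> b" and "X2 = x2 \<otimes> m"
  have X: "X1 \<in> carrier R" "X2 \<in> carrier R" using abc w hm 3 by (simp_all add: X1_def X2_def)
  have "X1 \<otimes> a \<otimes> y1 \<oplus> X1 \<otimes> b \<otimes> y2 \<oplus> X2 \<otimes> c \<otimes> y2 \<oplus> k \<otimes> (a \<otimes> c) = \<one>"
    unfolding X1_def X2_def
    by (rule ring_eqI1[OF 3(6)[unfolded r_def s_def t_def], of "[a,b,c,\<mu>,m,k,x1,x2,y1,y2]" _ _ _ _ \<one>],
      (rule reify)+, code_simp, use abc w hm 3 in simp)
  then show "\<exists>x1\<in>carrier R. \<exists>x2\<in>carrier R. \<exists>y1\<in>carrier R. \<exists>y2\<in>carrier R. \<exists>k\<in>carrier R.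
      x1 \<otimes> a \<otimes> y1 \<oplus> x1 \<otimes> b \<otimes> y2 \<oplus> x2 \<otimes> c \<otimes> y2 \<oplus> k \<otimes> (a \<otimes> c) = \<one>"
    using 3(3-5) X by blast
qed

end

section \<open>Projective modules of rank one\<close>

context module
begin

section \<open>Linear forms, and bases of one or two elements\<close>

lemma self_module_simps [simp]:
  "carrier (self_module R) = carrier R" "a \<oplus>\<^bsub>self_module R\<^esub> b = a \<oplus> b"
  "a \<odot>\<^bsub>self_module R\<^esub> b = a \<otimes> b" "\<zero>\<^bsub>self_module R\<^esub> = \<zero>"
  by (simp_all add: self_module_def)

lemma functionalI:
  assumes "\<And>x. x \<in> carrier M \<Longrightarrow> f x \<in> carrier R"
    and "\<And>x y. x \<in> carrier M \<Longrightarrow> y \<in> carrier M \<Longrightarrow> f (x \<oplus>\<^bsub>M\<^esub> y) = f x \<oplus> f y"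
    and "\<And>a x. a \<in> carrier R \<Longrightarrow> x \<in> carrier M \<Longrightarrow> f (a \<odot>\<^bsub>M\<^esub> x) = a \<otimes> f x"
  shows "f \<in> module_hom R M (self_module R)"
  using assms by (auto simp: module_hom_def)

lemma functional_closed: "f \<in> module_hom R M (self_module R) \<Longrightarrow> x \<in> carrier M \<Longrightarrow> f x \<in> carrier R"
  and functional_add: "f \<in> module_hom R M (self_module R) \<Longrightarrow> x \<in> carrier M \<Longrightarrow> y \<in> carrier M \<Longrightarrow>
    f (x \<oplus>\<^bsub>M\<^esub> y) = f x \<oplus> f y"
  and functional_smult: "f \<in> module_hom R M (self_module R) \<Longrightarrow> a \<in> carrier R \<Longrightarrow> x \<in> carrier M \<Longrightarrow>
    f (a \<odot>\<^bsub>M\<^esub> x) = a \<otimes> f x"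
  by (auto simp: module_hom_def)

lemma functional_zero: "f \<in> module_hom R M (self_module R) \<Longrightarrow> f \<zero>\<^bsub>M\<^esub> = \<zero>"
  using functional_smult[of f \<zero> "\<zero>\<^bsub>M\<^esub>"] functional_closed[of f "\<zero>\<^bsub>M\<^esub>"] by simp

lemma functional_restrict:
  "f \<in> module_hom R M (self_module R) \<Longrightarrow> restrict f (carrier M) \<in> module_hom R M (self_module R)"
  by (auto simp: module_hom_def)

lemma span_pairI:
  assumes b: "b1 \<in> carrier M" "b2 \<in> carrier M"
    and z: "\<And>z. z \<in> carrier M \<Longrightarrow> \<exists>s\<in>carrier R. \<exists>t\<in>carrier R. z = s \<odot>\<^bsub>M\<^esub> b1 \<oplus>\<^bsub>M\<^esub> t \<odot>\<^bsub>M\<^esub> b2"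
  shows "span {b1, b2} = carrier M"
proof
  show "span {b1, b2} \<subseteq> carrier M" using b by (intro span_is_subset2) auto
  interpret N: submodule R "span {b1, b2}" M using b by (intro span_is_submodule) auto
  have "{b1, b2} \<subseteq> span {b1, b2}" using b by (intro in_own_span) auto
  then show "carrier M \<subseteq> span {b1, b2}" using z by blast
qed

lemma span_singleton: "b \<in> carrier M \<Longrightarrow> span {b} = (\<lambda>s. s \<odot>\<^bsub>M\<^esub> b) ` carrier R"
proof -
  assume b: "b \<in> carrier M"
  have "span {b} = {lincomb a {b} | a. a \<in> {b} \<rightarrow> carrier R}" using b by (intro finite_span) auto
  also have "\<dots> = {a b \<odot>\<^bsub>M\<^esub> b | a. a \<in> {b} \<rightarrow> carrier R}"
  proof -
    have "lincomb a {b} = a b \<odot>\<^bsub>M\<^esub> b" if "a \<in> {b} \<rightarrow> carrier R" for a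
      using b that by (auto simp: lincomb_def)
    then show ?thesis by (intro Collect_cong ex_cong1) (metis)
  qed
  also have "\<dots> = (\<lambda>s. s \<odot>\<^bsub>M\<^esub> b) ` carrier R"
  proof safe
    fix s assume "s \<in> carrier R"
    then show "\<exists>a. s \<odot>\<^bsub>M\<^esub> b = a b \<odot>\<^bsub>M\<^esub> b \<and> a \<in> {b} \<rightarrow> carrier R" by (intro exI[of _ "\<lambda>_. s"]) auto
  qed auto
  finally show ?thesis .
qed

lemma lin_indpt_singletonI:
  assumes b: "b \<in> carrier M" and 0: "\<And>s. s \<in> carrier R \<Longrightarrow> s \<odot>\<^bsub>M\<^esub> b = \<zero>\<^bsub>M\<^esub> \<Longrightarrow> s = \<zero>"
  shows "\<not> lin_dep {b}"
  by (rule finite_lin_indpt2) (use assms in \<open>auto simp: lincomb_def\<close>)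

lemma lin_indpt_pairI:
  assumes b: "b1 \<in> carrier M" "b2 \<in> carrier M" "b1 \<noteq> b2"
    and 0: "\<And>s t. s \<in> carrier R \<Longrightarrow> t \<in> carrier R \<Longrightarrow> s \<odot>\<^bsub>M\<^esub> b1 \<oplus>\<^bsub>M\<^esub> t \<odot>\<^bsub>M\<^esub> b2 = \<zero>\<^bsub>M\<^esub> \<Longrightarrow> s = \<zero> \<and> t = \<zero>"
  shows "\<not> lin_dep {b1, b2}"
proof (rule finite_lin_indpt2)
  fix a assume a: "a \<in> {b1, b2} \<rightarrow> carrier R" and l: "lincomb a {b1, b2} = \<zero>\<^bsub>M\<^esub>"
  have "lincomb a {b1, b2} = a b1 \<odot>\<^bsub>M\<^esub> b1 \<oplus>\<^bsub>M\<^esub> a b2 \<odot>\<^bsub>M\<^esub> b2"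
    using a b by (simp add: lincomb_def)
  with l 0[of "a b1" "a b2"] a show "\<forall>v\<in>{b1, b2}. a v = \<zero>" by auto
qed (use b in auto)

end

text \<open>\<open>module\<close> admits extended records, whereas \<open>dual_module\<close> and
  the notions built on it are defined for plain module records; the locale fixes that type.\<close>

locale plain_module = module R M for R :: "('a, 'r) ring_scheme" (structure) and M :: "('a, 'm) module" (structure)
begin

lemma dual_module_simps:
  "carrier (dual_module R M) = module_hom R M (self_module R) \<inter> extensional (carrier M)"
  "\<zero>\<^bsub>dual_module R M\<^esub> = (\<lambda>x\<in>carrier M. \<zero>)"
  "f \<oplus>\<^bsub>dual_module R M\<^esub> g = (\<lambda>x\<in>carrier M. f x \<oplus> g x)"
  "a \<odot>\<^bsub>dual_module R M\<^esub> f = (\<lambda>x\<in>carrier M. a \<otimes> f x)"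
  by (simp_all add: dual_module_def)

lemma functional_lincomb:
  assumes "f \<in> module_hom R M (self_module R)" "g \<in> module_hom R M (self_module R)"
    and "a \<in> carrier R" "b \<in> carrier R"
  shows "(\<lambda>x. a \<otimes> f x \<oplus> b \<otimes> g x) \<in> module_hom R M (self_module R)"
  using assms by (intro functionalI)
    (auto simp: functional_add functional_smult functional_closed R.r_distr R.m_ac R.a_ac)

lemma dual_module_eqI:
  assumes "f \<in> carrier (dual_module R M)" "g \<in> carrier (dual_module R M)"
    and "\<And>x. x \<in> carrier M \<Longrightarrow> f x = g x"
  shows "f = g"
  using assms by (auto simp: dual_module_simps intro: extensionalityI[of _ "carrier M"])

lemma dual_module_closed:
  assumes "f \<in> module_hom R M (self_module R)"
  shows "restrict f (carrier M) \<in> carrier (dual_module R M)"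
  using assms functional_restrict by (simp add: dual_module_simps)

lemma dual_module_functional: "f \<in> carrier (dual_module R M) \<Longrightarrow> f \<in> module_hom R M (self_module R)"
  by (simp add: dual_module_simps)

lemma dual_module_is_module: "module R (dual_module R M)"
proof -
  let ?D = "dual_module R M"
  have add: "f \<oplus>\<^bsub>?D\<^esub> g \<in> carrier ?D" if "f \<in> carrier ?D" "g \<in> carrier ?D" for f g
  proof -
    note fg = that[THEN dual_module_functional]
    have "(\<lambda>x. f x \<oplus> g x) \<in> module_hom R M (self_module R)"
      using fg by (intro functionalI) (auto simp: functional_add functional_smult functional_closed R.r_distr R.a_ac)
    then show ?thesis by (simp only: dual_module_simps(3) dual_module_closed)
  qed
  have smult: "a \<odot>\<^bsub>?D\<^esub> f \<in> carrier ?D" if "a \<in> carrier R" "f \<in> carrier ?D" for a f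
  proof -
    note f = that(2)[THEN dual_module_functional]
    have "(\<lambda>x. a \<otimes> f x) \<in> module_hom R M (self_module R)"
      using f that by (intro functionalI) (auto simp: functional_add functional_smult functional_closed R.r_distr R.m_ac)
    then show ?thesis by (simp only: dual_module_simps(4) dual_module_closed)
  qed
  have zero: "\<zero>\<^bsub>?D\<^esub> \<in> carrier ?D"
    unfolding dual_module_simps(2) by (intro dual_module_closed functionalI) auto
  note closed = add smult zero functional_closed[OF dual_module_functional]
  note [simp] = dual_module_simps(2-4)
  have neg: "\<exists>g\<in>carrier ?D. g \<oplus>\<^bsub>?D\<^esub> f = \<zero>\<^bsub>?D\<^esub>" if f: "f \<in> carrier ?D" for f
  proof (rule bexI)
    show "(\<ominus> \<one>) \<odot>\<^bsub>?D\<^esub> f \<in> carrier ?D" using f by (intro smult) auto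
    then show "(\<ominus> \<one>) \<odot>\<^bsub>?D\<^esub> f \<oplus>\<^bsub>?D\<^esub> f = \<zero>\<^bsub>?D\<^esub>"
      using f closed(4)[OF f] by (intro dual_module_eqI add zero) (auto simp: R.l_minus R.l_neg)
  qed
  have "abelian_group ?D"
  proof (rule abelian_groupI)
    show "(f \<oplus>\<^bsub>?D\<^esub> g) \<oplus>\<^bsub>?D\<^esub> h = f \<oplus>\<^bsub>?D\<^esub> (g \<oplus>\<^bsub>?D\<^esub> h)"
      if "f \<in> carrier ?D" "g \<in> carrier ?D" "h \<in> carrier ?D" for f g h
      using that closed(4)[OF that(1)] closed(4)[OF that(2)] closed(4)[OF that(3)]
      by (intro dual_module_eqI add) (auto simp: R.a_assoc)
    show "f \<oplus>\<^bsub>?D\<^esub> g = g \<oplus>\<^bsub>?D\<^esub> f" if "f \<in> carrier ?D" "g \<in> carrier ?D" for f g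
      using that closed(4)[OF that(1)] closed(4)[OF that(2)]
      by (intro dual_module_eqI add) (auto simp: R.a_comm)
    show "\<zero>\<^bsub>?D\<^esub> \<oplus>\<^bsub>?D\<^esub> f = f" if "f \<in> carrier ?D" for f
      using that closed(4)[OF that] by (intro dual_module_eqI add zero) auto
  qed (use add zero neg in auto)
  then show ?thesis
  proof (rule moduleI[OF R.is_cring])
    show "(a \<oplus> b) \<odot>\<^bsub>?D\<^esub> f = a \<odot>\<^bsub>?D\<^esub> f \<oplus>\<^bsub>?D\<^esub> b \<odot>\<^bsub>?D\<^esub> f"
      if "a \<in> carrier R" "b \<in> carrier R" "f \<in> carrier ?D" for a b f
      using that closed(4)[OF that(3)] by (intro dual_module_eqI add smult R.a_closed) (auto simp: R.l_distr)
    show "a \<odot>\<^bsub>?D\<^esub> (f \<oplus>\<^bsub>?D\<^esub> g) = a \<odot>\<^bsub>?D\<^esub> f \<oplus>\<^bsub>?D\<^esub> a \<odot>\<^bsub>?D\<^esub> g"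
      if "a \<in> carrier R" "f \<in> carrier ?D" "g \<in> carrier ?D" for a f g
      using that closed(4)[OF that(2)] closed(4)[OF that(3)]
      by (intro dual_module_eqI add smult) (auto simp: R.r_distr)
    show "(a \<otimes> b) \<odot>\<^bsub>?D\<^esub> f = a \<odot>\<^bsub>?D\<^esub> (b \<odot>\<^bsub>?D\<^esub> f)"
      if "a \<in> carrier R" "b \<in> carrier R" "f \<in> carrier ?D" for a b f
      using that closed(4)[OF that(3)] by (intro dual_module_eqI smult R.m_closed) (auto simp: R.m_assoc)
    show "\<one> \<odot>\<^bsub>?D\<^esub> f = f" if "f \<in> carrier ?D" for f
      using that closed(4)[OF that] by (intro dual_module_eqI smult) auto
  qed (rule smult)
qed

end

text \<open>A projective module given by a dual basis \<open>(p1, \<eta>1), (p2, \<eta>2)\<close>: it is isomorphic to the image of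
  the idempotent matrix \<open>(\<eta>i pj)\<close>, which has trace \<open>1\<close> and determinant \<open>0\<close>.\<close>

locale rank_one_module = plain_module +
  fixes p1 p2 \<eta>1 \<eta>2
  assumes p [simp]: "p1 \<in> carrier M" "p2 \<in> carrier M"
    and \<eta>: "\<eta>1 \<in> module_hom R M (self_module R)" "\<eta>2 \<in> module_hom R M (self_module R)"
    and expand: "z \<in> carrier M \<Longrightarrow> \<eta>1 z \<odot>\<^bsub>M\<^esub> p1 \<oplus>\<^bsub>M\<^esub> \<eta>2 z \<odot>\<^bsub>M\<^esub> p2 = z"
    and trace: "\<eta>1 p1 \<oplus> \<eta>2 p2 = \<one>"
    and minor: "z \<in> carrier M \<Longrightarrow> w \<in> carrier M \<Longrightarrow> \<eta>1 z \<otimes> \<eta>2 w = \<eta>2 z \<otimes> \<eta>1 w"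
    and one_neq_zero: "\<one> \<noteq> \<zero>"
begin

lemma eta_closed [simp]: "z \<in> carrier M \<Longrightarrow> \<eta>1 z \<in> carrier R" "z \<in> carrier M \<Longrightarrow> \<eta>2 z \<in> carrier R"
  using \<eta> by (auto intro: functional_closed)

lemmas eta_add = functional_add[OF \<eta>(1)] functional_add[OF \<eta>(2)]
lemmas eta_smult = functional_smult[OF \<eta>(1)] functional_smult[OF \<eta>(2)]

lemma eta_eqI:
  assumes "z \<in> carrier M" "w \<in> carrier M" "\<eta>1 z = \<eta>1 w" "\<eta>2 z = \<eta>2 w"
  shows "z = w"
  using expand[OF assms(1)] expand[OF assms(2)] unfolding assms(3,4) by (rule trans[OF sym])

lemma functional_expand:
  assumes f: "f \<in> module_hom R M (self_module R)" and z: "z \<in> carrier M"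
  shows "f z = \<eta>1 z \<otimes> f p1 \<oplus> \<eta>2 z \<otimes> f p2"
proof -
  have "f z = f (\<eta>1 z \<odot>\<^bsub>M\<^esub> p1 \<oplus>\<^bsub>M\<^esub> \<eta>2 z \<odot>\<^bsub>M\<^esub> p2)" by (simp add: expand z)
  then show ?thesis using f z by (simp add: functional_add functional_smult)
qed

text \<open>Every form is a combination of \<eta>1 and \<eta>2, so the vanishing of their 2 by 2
  minors passes on to the minors of any form with either of them.\<close>

lemma functional_eta_exchange:
  assumes f: "f \<in> module_hom R M (self_module R)" and z: "z \<in> carrier M" "w \<in> carrier M"
  shows "f z \<otimes> \<eta>1 w = f w \<otimes> \<eta>1 z" "f z \<otimes> \<eta>2 w = f w \<otimes> \<eta>2 z"
proof -
  note [simp] = functional_closed[OF f] z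
  note m = minor[OF z]
  show "f z \<otimes> \<eta>1 w = f w \<otimes> \<eta>1 z"
    unfolding functional_expand[OF f z(1)] functional_expand[OF f z(2)]
    by (rule R.ring_eqI1[OF m, of "[\<eta>1 z, \<eta>1 w, \<eta>2 z, \<eta>2 w, f p1, f p2]" _ _ _ _ "\<ominus> f p2"],
      (rule R.reify)+, code_simp, simp)
  show "f z \<otimes> \<eta>2 w = f w \<otimes> \<eta>2 z"
    unfolding functional_expand[OF f z(1)] functional_expand[OF f z(2)]
    by (rule R.ring_eqI1[OF m, of "[\<eta>1 z, \<eta>1 w, \<eta>2 z, \<eta>2 w, f p1, f p2]" _ _ _ _ "f p1"],
      (rule R.reify)+, code_simp, simp)
qed

text \<open>Any two elements are linearly related through any form. This is the shape in which rank
  one is used, both for bases and for localizations.\<close>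

lemma functional_exchange:
  assumes f: "f \<in> module_hom R M (self_module R)" and z: "z \<in> carrier M" "w \<in> carrier M"
  shows "f z \<odot>\<^bsub>M\<^esub> w = f w \<odot>\<^bsub>M\<^esub> z"
  using functional_eta_exchange[OF assms] functional_closed[OF f] z
  by (intro eta_eqI) (auto simp: eta_smult)

lemma two_generated: "two_generated R M"
  unfolding two_generated_def
proof (intro bexI)
  show "span {p1, p2} = carrier M"
  proof (rule span_pairI)
    show "\<exists>s\<in>carrier R. \<exists>t\<in>carrier R. z = s \<odot>\<^bsub>M\<^esub> p1 \<oplus>\<^bsub>M\<^esub> t \<odot>\<^bsub>M\<^esub> p2" if "z \<in> carrier M" for z
      by (rule bexI[of _ "\<eta>1 z"], rule bexI[of _ "\<eta>2 z"]) (use expand that in simp_all)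
  qed auto
qed auto

text \<open>The complement of a rank one summand of \<open>R\<^sup>2\<close> is dual to it under the determinant pairing.\<close>

lemma direct_sum_dual_basis:
  fixes b1 b2
  defines "b1 \<equiv> (p1, \<lambda>z\<in>carrier M. \<ominus> \<eta>2 z)" and "b2 \<equiv> (p2, \<lambda>z\<in>carrier M. \<eta>1 z)"
  shows "module_basis R (direct_sum M (dual_module R M)) {b1, b2}"
proof -
  let ?D = "dual_module R M" and ?S = "direct_sum M (dual_module R M)"
  interpret D: module R ?D by (rule dual_module_is_module)
  interpret S: module R ?S by (rule direct_sum_is_module) (unfold_locales)
  have S: "carrier ?S = carrier M \<times> carrier ?D" "\<zero>\<^bsub>?S\<^esub> = (\<zero>\<^bsub>M\<^esub>, \<zero>\<^bsub>?D\<^esub>)"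
    "v \<oplus>\<^bsub>?S\<^esub> w = (fst v \<oplus>\<^bsub>M\<^esub> fst w, snd v \<oplus>\<^bsub>?D\<^esub> snd w)"
    "a \<odot>\<^bsub>?S\<^esub> v = (a \<odot>\<^bsub>M\<^esub> fst v, a \<odot>\<^bsub>?D\<^esub> snd v)" for a v w
    by (simp_all add: direct_sum_def)
  have neg: "(\<lambda>z. \<ominus> \<eta>2 z) \<in> module_hom R M (self_module R)"
    by (intro functionalI) (auto simp: eta_add eta_smult R.minus_add R.r_minus)
  have D: "(\<lambda>z\<in>carrier M. \<ominus> \<eta>2 z) \<in> carrier ?D" "(\<lambda>z\<in>carrier M. \<eta>1 z) \<in> carrier ?D"
    using neg \<eta> by (auto intro: dual_module_closed)
  have b: "b1 \<in> carrier ?S" "b2 \<in> carrier ?S" using D by (auto simp: b1_def b2_def S)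
  have comb: "s \<odot>\<^bsub>?S\<^esub> b1 \<oplus>\<^bsub>?S\<^esub> t \<odot>\<^bsub>?S\<^esub> b2 =
    (s \<odot>\<^bsub>M\<^esub> p1 \<oplus>\<^bsub>M\<^esub> t \<odot>\<^bsub>M\<^esub> p2, \<lambda>z\<in>carrier M. t \<otimes> \<eta>1 z \<ominus> s \<otimes> \<eta>2 z)"
    if "s \<in> carrier R" "t \<in> carrier R" for s t
    using that by (auto simp: S b1_def b2_def dual_module_simps restrict_def fun_eq_iff
        R.minus_eq R.r_minus R.a_comm)
  have indep: "s = \<zero> \<and> t = \<zero>"
    if st: "s \<in> carrier R" "t \<in> carrier R" and 0: "s \<odot>\<^bsub>?S\<^esub> b1 \<oplus>\<^bsub>?S\<^esub> t \<odot>\<^bsub>?S\<^esub> b2 = \<zero>\<^bsub>?S\<^esub>" for s t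
  proof -
    from 0 have M0: "s \<odot>\<^bsub>M\<^esub> p1 \<oplus>\<^bsub>M\<^esub> t \<odot>\<^bsub>M\<^esub> p2 = \<zero>\<^bsub>M\<^esub>"
      and D0: "(\<lambda>z\<in>carrier M. t \<otimes> \<eta>1 z \<ominus> s \<otimes> \<eta>2 z) = (\<lambda>z\<in>carrier M. \<zero>)"
      unfolding comb[OF st] S(2) dual_module_simps by simp_all
    have D0': "t \<otimes> \<eta>1 z \<ominus> s \<otimes> \<eta>2 z = \<zero>" if "z \<in> carrier M" for z
      using fun_cong[OF D0, of z] that by simp
    have M0': "s \<otimes> \<eta>1 p1 \<oplus> t \<otimes> \<eta>1 p2 = \<zero>" "s \<otimes> \<eta>2 p1 \<oplus> t \<otimes> \<eta>2 p2 = \<zero>"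
      using arg_cong[OF M0, of \<eta>1] arg_cong[OF M0, of \<eta>2] st \<eta>
      by (simp_all add: eta_add eta_smult functional_zero)
    \<comment> \<open>By \<open>trace\<close>, \<open>s\<close> is the sum of
      \<open>s \<eta>1 p1\<close> and \<open>s \<eta>2 p2\<close>. The relation in \<open>M\<close>
      makes the first \<open>- t \<eta>1 p2\<close>, the relation between forms makes the second
      \<open>t \<eta>1 p2\<close>.\<close>
    have "s = \<zero>"
      by (rule R.ring_eqI3[OF M0'(1) D0'[OF p(2)] trace, of "[s,t,\<eta>1 p1,\<eta>1 p2,\<eta>2 p1,\<eta>2 p2]" _ _ _ _ \<one> _ _ _ "\<ominus> \<one>" _ _ _ "\<ominus> s"],
        (rule R.reify)+, code_simp, use st in simp)
    moreover have "t = \<zero>"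
      by (rule R.ring_eqI3[OF M0'(2) D0'[OF p(1)] trace, of "[s,t,\<eta>1 p1,\<eta>1 p2,\<eta>2 p1,\<eta>2 p2]" _ _ _ _ \<one> _ _ _ \<one> _ _ _ "\<ominus> t"],
        (rule R.reify)+, code_simp, use st in simp)
    ultimately show ?thesis ..
  qed
  have "b1 \<noteq> b2"
  proof
    assume eq: "b1 = b2"
    have "\<one> \<odot>\<^bsub>?S\<^esub> b1 \<oplus>\<^bsub>?S\<^esub> (\<ominus> \<one>) \<odot>\<^bsub>?S\<^esub> b2 = \<zero>\<^bsub>?S\<^esub>"
      using b unfolding eq by (simp add: S.smult_l_minus S.M.r_neg)
    from indep[OF _ _ this] one_neq_zero show False by simp
  qed
  then have "\<not> S.lin_dep {b1, b2}" by (rule S.lin_indpt_pairI[OF b]) (rule indep)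
  moreover have "S.span {b1, b2} = carrier ?S"
  proof (rule S.span_pairI[OF b])
    fix v assume "v \<in> carrier ?S"
    then obtain z f where v: "v = (z, f)" "z \<in> carrier M" "f \<in> carrier ?D" by (auto simp: S)
    note f = dual_module_functional[OF v(3)]
    have [simp]: "f p1 \<in> carrier R" "f p2 \<in> carrier R" using functional_closed[OF f] by auto
    \<comment> \<open>The element \<open>z\<close> alone has coordinates
      \<open>(\<eta>1 z, \<eta>2 z)\<close>, its form part vanishing by \<open>minor\<close>. The
      form \<open>f\<close> alone has coordinates \<open>(- f p2, f p1)\<close>, its module part
      vanishing by the exchange of \<open>p1\<close> and \<open>p2\<close>.\<close>
    let ?s = "\<eta>1 z \<ominus> f p2" and ?t = "\<eta>2 z \<oplus> f p1"
    have st: "?s \<in> carrier R" "?t \<in> carrier R" using v by auto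
    have "v = ?s \<odot>\<^bsub>?S\<^esub> b1 \<oplus>\<^bsub>?S\<^esub> ?t \<odot>\<^bsub>?S\<^esub> b2"
      unfolding comb[OF st] v(1) prod.inject
    proof
      have fx: "f p2 \<otimes> \<eta>1 p1 = f p1 \<otimes> \<eta>1 p2" "f p2 \<otimes> \<eta>2 p1 = f p1 \<otimes> \<eta>2 p2"
        using functional_eta_exchange[OF f p(2,1)] .
      have ex: "\<eta>1 z = \<eta>1 z \<otimes> \<eta>1 p1 \<oplus> \<eta>2 z \<otimes> \<eta>1 p2" "\<eta>2 z = \<eta>1 z \<otimes> \<eta>2 p1 \<oplus> \<eta>2 z \<otimes> \<eta>2 p2"
        using functional_expand[OF \<eta>(1) v(2)] functional_expand[OF \<eta>(2) v(2)] .
      have [simp]: "z \<in> carrier M" by fact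
      show "z = ?s \<odot>\<^bsub>M\<^esub> p1 \<oplus>\<^bsub>M\<^esub> ?t \<odot>\<^bsub>M\<^esub> p2"
      proof (rule eta_eqI)
        have "\<eta>1 z = ?s \<otimes> \<eta>1 p1 \<oplus> ?t \<otimes> \<eta>1 p2"
          by (rule R.ring_eqI2[OF fx(1) ex(1), of "[\<eta>1 z,\<eta>2 z,f p1,f p2,\<eta>1 p1,\<eta>1 p2]" _ _ _ _ \<one> _ _ _ \<one>],
            (rule R.reify)+, code_simp, simp)
        then show "\<eta>1 z = \<eta>1 (?s \<odot>\<^bsub>M\<^esub> p1 \<oplus>\<^bsub>M\<^esub> ?t \<odot>\<^bsub>M\<^esub> p2)" using st by (simp add: eta_add eta_smult)
        have "\<eta>2 z = ?s \<otimes> \<eta>2 p1 \<oplus> ?t \<otimes> \<eta>2 p2"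
          by (rule R.ring_eqI2[OF fx(2) ex(2), of "[\<eta>1 z,\<eta>2 z,f p1,f p2,\<eta>2 p1,\<eta>2 p2]" _ _ _ _ \<one> _ _ _ \<one>],
            (rule R.reify)+, code_simp, simp)
        then show "\<eta>2 z = \<eta>2 (?s \<odot>\<^bsub>M\<^esub> p1 \<oplus>\<^bsub>M\<^esub> ?t \<odot>\<^bsub>M\<^esub> p2)" using st by (simp add: eta_add eta_smult)
      qed (use st in auto)
      show "f = (\<lambda>w\<in>carrier M. ?t \<otimes> \<eta>1 w \<ominus> ?s \<otimes> \<eta>2 w)"
      proof (rule dual_module_eqI[OF v(3)])
              show "(\<lambda>w\<in>carrier M. ?t \<otimes> \<eta>1 w \<ominus> ?s \<otimes> \<eta>2 w) \<in> carrier ?D"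
        proof -
          have "?s \<odot>\<^bsub>?S\<^esub> b1 \<oplus>\<^bsub>?S\<^esub> ?t \<odot>\<^bsub>?S\<^esub> b2 \<in> carrier ?S" using st b by simp
          then show ?thesis unfolding comb[OF st] by (simp add: S)
        qed
        fix w assume w: "w \<in> carrier M"
        have "f w = ?t \<otimes> \<eta>1 w \<ominus> ?s \<otimes> \<eta>2 w"
          by (rule R.ring_eqI2[OF functional_expand[OF f w] minor[OF v(2) w],
                of "[\<eta>1 z,\<eta>2 z,\<eta>1 w,\<eta>2 w,f p1,f p2,f w]" _ _ _ _ \<one> _ _ _ \<one>],
              (rule R.reify)+, code_simp, use w functional_closed[OF f w] in simp)
        then show "f w = (\<lambda>w\<in>carrier M. ?t \<otimes> \<eta>1 w \<ominus> ?s \<otimes> \<eta>2 w) w" using w by simp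
      qed
    qed
    then show "\<exists>s\<in>carrier R. \<exists>t\<in>carrier R. v = s \<odot>\<^bsub>?S\<^esub> b1 \<oplus>\<^bsub>?S\<^esub> t \<odot>\<^bsub>?S\<^esub> b2" using st by blast
  qed
  ultimately show ?thesis using b unfolding module_basis_def by auto
qed

text \<open>The dual serves as the complement; its carrier type is the one prescribed in
  \<open>projective_module\<close>.\<close>

lemma projective: "projective_module R M"
  unfolding projective_module_def free_module_def
  using direct_sum_dual_basis dual_module_is_module direct_sum_is_module[OF module_axioms dual_module_is_module]
    module_axioms by blast

text \<open>Think of \<open>x1\<close>, \<open>x2\<close> as the columns of a symmetric matrix
  \<open>A\<close> whose image is \<open>M\<close>; \<open>sym\<close> is its symmetry, and the
  \<open>c\<close> are coefficients of a dual basis in terms of these columns. The isomorphism comes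
  from the pairing of \<open>A u\<close> with \<open>A v\<close> given by \<open>u A v\<close>,
  which depends only on the two images because \<open>A\<close> is symmetric.\<close>

lemma self_dual:
  assumes x: "x1 \<in> carrier M" "x2 \<in> carrier M" and sym: "\<eta>1 x2 = \<eta>2 x1"
    and c: "c11 \<in> carrier R" "c12 \<in> carrier R" "c21 \<in> carrier R" "c22 \<in> carrier R"
    and p1: "p1 = c11 \<odot>\<^bsub>M\<^esub> x1 \<oplus>\<^bsub>M\<^esub> c12 \<odot>\<^bsub>M\<^esub> x2" and p2: "p2 = c21 \<odot>\<^bsub>M\<^esub> x1 \<oplus>\<^bsub>M\<^esub> c22 \<odot>\<^bsub>M\<^esub> x2"
  shows "self_dual R M"
proof -
  \<comment> \<open>\<phi>1 and \<phi>2 choose a preimage linearly: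
    \<open>z = \<phi>1 z x1 + \<phi>2 z x2\<close>. The resulting form satisfies
    \<open>\<theta> z x1 = \<eta>1 z\<close> and \<open>\<theta> z x2 = \<eta>2 z\<close>.\<close>
  define \<phi>1 where "\<phi>1 z = \<eta>1 z \<otimes> c11 \<oplus> \<eta>2 z \<otimes> c21" for z
  define \<phi>2 where "\<phi>2 z = \<eta>1 z \<otimes> c12 \<oplus> \<eta>2 z \<otimes> c22" for z
  define \<theta> where "\<theta> z = (\<lambda>w\<in>carrier M. \<phi>1 z \<otimes> \<eta>1 w \<oplus> \<phi>2 z \<otimes> \<eta>2 w)" for z
  have \<phi>c [simp]: "\<phi>1 z \<in> carrier R" "\<phi>2 z \<in> carrier R" if "z \<in> carrier M" for z
    using that c by (auto simp: \<phi>1_def \<phi>2_def)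
  have z: "f z = \<phi>1 z \<otimes> f x1 \<oplus> \<phi>2 z \<otimes> f x2"
    if z: "z \<in> carrier M" and f: "f \<in> module_hom R M (self_module R)" for z f
  proof -
    have fp: "f p1 = c11 \<otimes> f x1 \<oplus> c12 \<otimes> f x2" "f p2 = c21 \<otimes> f x1 \<oplus> c22 \<otimes> f x2"
      unfolding p1 p2 using c x f by (simp_all add: functional_add functional_smult)
    show ?thesis
      unfolding functional_expand[OF f z] fp \<phi>1_def \<phi>2_def
      by (rule R.ring_eqI[of "[\<eta>1 z,\<eta>2 z,c11,c12,c21,c22,f x1,f x2]"], (rule R.reify)+, code_simp,
        use z x c functional_closed[OF f] in simp)
  qed
  have \<theta>_dual: "\<theta> z \<in> carrier (dual_module R M)" if "z \<in> carrier M" for z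
    unfolding \<theta>_def using that by (intro dual_module_closed functional_lincomb \<eta>) auto
  have \<theta>_x: "\<theta> z x1 = \<eta>1 z" "\<theta> z x2 = \<eta>2 z" if "z \<in> carrier M" for z
    unfolding \<theta>_def using x sym z[OF that \<eta>(1)] z[OF that \<eta>(2)] by simp_all
  have "\<theta> \<in> module_hom R M (dual_module R M)"
    unfolding module_hom_def
  proof (intro CollectI conjI allI impI)
    show "\<theta> \<in> carrier M \<rightarrow> carrier (dual_module R M)" using \<theta>_dual by auto
    show "\<theta> (v \<oplus>\<^bsub>M\<^esub> w) = \<theta> v \<oplus>\<^bsub>dual_module R M\<^esub> \<theta> w" if vw: "v \<in> carrier M \<and> w \<in> carrier M" for v w
    proof -
      have "\<phi>1 (v \<oplus>\<^bsub>M\<^esub> w) \<otimes> \<eta>1 u \<oplus> \<phi>2 (v \<oplus>\<^bsub>M\<^esub> w) \<otimes> \<eta>2 u =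
        (\<phi>1 v \<otimes> \<eta>1 u \<oplus> \<phi>2 v \<otimes> \<eta>2 u) \<oplus> (\<phi>1 w \<otimes> \<eta>1 u \<oplus> \<phi>2 w \<otimes> \<eta>2 u)" if "u \<in> carrier M" for u
        unfolding \<phi>1_def \<phi>2_def eta_add[OF vw[THEN conjunct1] vw[THEN conjunct2]]
        by (rule R.ring_eqI[of "[\<eta>1 u,\<eta>2 u,\<eta>1 v,\<eta>2 v,\<eta>1 w,\<eta>2 w,c11,c12,c21,c22]"], (rule R.reify)+, code_simp,
          use vw that c in simp)
      then show ?thesis unfolding \<theta>_def dual_module_simps by (auto simp: restrict_def fun_eq_iff)
    qed
    show "\<theta> (a \<odot>\<^bsub>M\<^esub> v) = a \<odot>\<^bsub>dual_module R M\<^esub> \<theta> v" if av: "a \<in> carrier R \<and> v \<in> carrier M" for a v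
    proof -
      have "\<phi>1 (a \<odot>\<^bsub>M\<^esub> v) \<otimes> \<eta>1 u \<oplus> \<phi>2 (a \<odot>\<^bsub>M\<^esub> v) \<otimes> \<eta>2 u = a \<otimes> (\<phi>1 v \<otimes> \<eta>1 u \<oplus> \<phi>2 v \<otimes> \<eta>2 u)"
        if "u \<in> carrier M" for u
        unfolding \<phi>1_def \<phi>2_def eta_smult[OF av[THEN conjunct1] av[THEN conjunct2]]
        by (rule R.ring_eqI[of "[\<eta>1 u,\<eta>2 u,\<eta>1 v,\<eta>2 v,a,c11,c12,c21,c22]"], (rule R.reify)+, code_simp,
          use av that c in simp)
      then show ?thesis unfolding \<theta>_def dual_module_simps by (auto simp: restrict_def fun_eq_iff)
    qed
  qed
  moreover have "bij_betw \<theta> (carrier M) (carrier (dual_module R M))"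
  proof (rule bij_betw_imageI)
    show "inj_on \<theta> (carrier M)"
    proof (rule inj_onI)
      fix v w assume "v \<in> carrier M" "w \<in> carrier M" "\<theta> v = \<theta> w"
      then show "v = w" using \<theta>_x[of v] \<theta>_x[of w] by (intro eta_eqI) simp_all
    qed
    show "\<theta> ` carrier M = carrier (dual_module R M)"
    proof (intro equalityI subsetI)
      fix f assume f': "f \<in> carrier (dual_module R M)"
      note f = dual_module_functional[OF f']
      \<comment> \<open>The element with coordinates \<open>f x1\<close>, \<open>f x2\<close>. Then
        \<open>\<theta> v\<close> and \<open>f\<close> agree on \<open>x1\<close> and
        \<open>x2\<close>, which determine a form.\<close>
      define v where "v = f x1 \<odot>\<^bsub>M\<^esub> p1 \<oplus>\<^bsub>M\<^esub> f x2 \<odot>\<^bsub>M\<^esub> p2"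
      have fx: "f x1 \<in> carrier R" "f x2 \<in> carrier R" using functional_closed[OF f] x by auto
      have v: "v \<in> carrier M" using fx by (simp add: v_def)
      have "\<eta>1 v = \<eta>1 x1 \<otimes> f p1 \<oplus> \<eta>2 x1 \<otimes> f p2" "\<eta>2 v = \<eta>1 x2 \<otimes> f p1 \<oplus> \<eta>2 x2 \<otimes> f p2"
        unfolding v_def using fx x functional_closed[OF f] functional_eta_exchange[OF f x(1) p(1)]
          functional_eta_exchange[OF f x(2) p(2)]
        by (simp_all add: eta_add eta_smult sym R.m_comm)
      then have v_x: "\<eta>1 v = f x1" "\<eta>2 v = f x2"
        using functional_expand[OF f x(1)] functional_expand[OF f x(2)] by simp_all
      have "\<theta> v = f"
      proof (rule dual_module_eqI[OF \<theta>_dual[OF v] f'])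
        fix w assume w: "w \<in> carrier M"
        show "\<theta> v w = f w"
          using z[OF w dual_module_functional[OF \<theta>_dual[OF v]]] z[OF w f] \<theta>_x[OF v] v_x by simp
      qed
      then show "f \<in> \<theta> ` carrier M" using v by auto
    qed (use \<theta>_dual in auto)
  qed
  ultimately show ?thesis unfolding self_dual_def module_iso_def by blast
qed

text \<open>Two distinct basis elements \<open>b\<close>, \<open>b'\<close> would satisfy the
  relation \<open>f b b' = f b' b\<close> for every form \<open>f\<close>, forcing
  \<open>f b = 0\<close>. Then both coordinates of \<open>b\<close> vanish, so \<open>b\<close> is
  zero, which a basis excludes.\<close>

lemma free_imp_cyclic:
  assumes "free_module R M"
  obtains b where "b \<in> carrier M" "\<And>z. z \<in> carrier M \<Longrightarrow> \<exists>s\<in>carrier R. z = s \<odot>\<^bsub>M\<^esub> b"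
proof -
  from assms obtain B where B: "B \<subseteq> carrier M" "\<not> lin_dep B" "span B = carrier M"
    unfolding free_module_def module_basis_def by blast
  have *: "f b = \<zero>" if b: "b \<in> B" "b' \<in> B" "b \<noteq> b'" and f: "f \<in> module_hom R M (self_module R)" for b b' f
  proof (rule ccontr)
    assume "f b \<noteq> \<zero>"
    have bc: "b \<in> carrier M" "b' \<in> carrier M" using b B by auto
    let ?a = "\<lambda>v. if v = b' then f b else \<ominus> f b'"
    have "lincomb ?a {b', b} = f b \<odot>\<^bsub>M\<^esub> b' \<oplus>\<^bsub>M\<^esub> (\<ominus> f b') \<odot>\<^bsub>M\<^esub> b"
      using bc b(3) functional_closed[OF f] by (simp add: lincomb_def)
    also have "\<dots> = \<zero>\<^bsub>M\<^esub>"
      using functional_exchange[OF f bc] functional_closed[OF f] bc by (simp add: smult_l_minus M.r_neg)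
    finally have "lin_dep B"
      using b bc functional_closed[OF f] \<open>f b \<noteq> \<zero>\<close>
      by (intro lin_dep_crit[of "{b', b}" _ ?a b']) auto
    with B show False by simp
  qed
  \<comment> \<open>This covers the empty basis too, where any element of the zero module
    serves.\<close>
  have "\<exists>b\<in>carrier M. B \<subseteq> {b}"
  proof (cases "B = {}")
    case False
    then obtain b where b: "b \<in> B" by blast
    have "b' = b" if "b' \<in> B" for b'
    proof (rule ccontr)
      assume "b' \<noteq> b"
      with *[OF b that _ \<eta>(1)] *[OF b that _ \<eta>(2)] have "\<eta>1 b = \<zero>" "\<eta>2 b = \<zero>" by auto
      then have "b = \<zero>\<^bsub>M\<^esub>"
        using b B \<eta> by (intro eta_eqI) (auto simp: functional_zero)
      moreover have "\<zero>\<^bsub>M\<^esub> \<notin> B" using zero_nin_lin_indpt[OF B(1,2)] one_neq_zero R.one_closed by auto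
      ultimately show False using b by simp
    qed
    with b B show ?thesis by blast
  qed auto
  then obtain b where b: "b \<in> carrier M" "B \<subseteq> {b}" by blast
  have "span B \<subseteq> span {b}" using b(2) by (rule span_is_monotone)
  then have "carrier M \<subseteq> (\<lambda>s. s \<odot>\<^bsub>M\<^esub> b) ` carrier R" using B(3) span_singleton[OF b(1)] by simp
  with b(1) that show thesis by blast
qed

end

section \<open>Localization\<close>

text \<open>\<open>frac_add\<close> and \<open>frac_smult\<close> are unions over representatives.
  Independence of representatives makes the family constant, and since the index sets are nonempty
  the union is the common class.\<close>

lemma UN_pairs_constant:
  assumes "(x, s) \<in> X" "(y, t) \<in> Y"
    and "\<And>x' s' y' t'. (x', s') \<in> X \<Longrightarrow> (y', t') \<in> Y \<Longrightarrow> F x' s' y' t' = C"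
  shows "(\<Union>(x, s)\<in>X. \<Union>(y, t)\<in>Y. F x s y t) = C"
proof -
  have inner: "(\<Union>(y, t)\<in>Y. F a b y t) = C" if "(a, b) \<in> X" for a b
  proof -
    have "(\<Union>(y, t)\<in>Y. F a b y t) = (\<Union>_\<in>Y. C)"
      by (rule SUP_cong[OF HOL.refl]) (use assms(3) that in auto)
    then show ?thesis using assms(2) by auto
  qed
  have "(\<Union>(x, s)\<in>X. \<Union>(y, t)\<in>Y. F x s y t) = (\<Union>_\<in>X. C)"
  proof (rule SUP_cong[OF HOL.refl])
    fix u assume "u \<in> X"
    then show "(case u of (x, s) \<Rightarrow> \<Union>(y, t)\<in>Y. F x s y t) = C"
      by (cases u) (simp only: prod.case inner)
  qed
  then show ?thesis using assms(1) by auto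
qed

lemma (in cring) module_self: "module R (self_module R)"
  by (rule moduleI[OF is_cring], rule abelian_groupI)
    (auto simp: self_module_def a_ac l_distr r_distr m_assoc intro: bexI[of _ "\<ominus> _"] l_neg)

definition prime_compl :: "('a, 'r) ring_scheme \<Rightarrow> 'a set \<Rightarrow> 'a set"
  where "prime_compl R p = carrier R - p"

locale localization = plain_module R M for R (structure) and M (structure) +
  fixes p
  assumes prime: "primeideal p R"
begin

interpretation P: primeideal p R by (rule prime)

abbreviation "T \<equiv> prime_compl R p"

lemma T_one [simp]: "\<one> \<in> T" using P.I_notcarr P.one_imp_carrier unfolding prime_compl_def by blast

lemma T_mult [simp]: "s \<in> T \<Longrightarrow> t \<in> T \<Longrightarrow> s \<otimes> t \<in> T"
  using P.I_prime unfolding prime_compl_def by blast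

lemma T_closed [simp]: "s \<in> T \<Longrightarrow> s \<in> carrier R" by (simp add: prime_compl_def)

lemma frac_rel_iff:
  "((x, s), (y, t)) \<in> frac_rel R p M \<longleftrightarrow> x \<in> carrier M \<and> y \<in> carrier M \<and> s \<in> T \<and> t \<in> T \<and>
    (\<exists>u\<in>T. u \<odot>\<^bsub>M\<^esub> (t \<odot>\<^bsub>M\<^esub> x) = u \<odot>\<^bsub>M\<^esub> (s \<odot>\<^bsub>M\<^esub> y))"
  unfolding frac_rel_def prime_compl_def by blast

lemma frac_rel_equiv: "equiv (carrier M \<times> T) (frac_rel R p M)"
proof (rule equivI)
  show "frac_rel R p M \<subseteq> (carrier M \<times> T) \<times> carrier M \<times> T" by (auto simp: frac_rel_iff)
  show "refl_on (carrier M \<times> T) (frac_rel R p M)"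
    using T_one by (auto simp: refl_on_def frac_rel_iff)
  show "sym (frac_rel R p M)"
  proof (rule symI)
    fix X Y assume "(X, Y) \<in> frac_rel R p M"
    moreover obtain x s y t where XY: "X = (x, s)" "Y = (y, t)" by (cases X; cases Y)
    ultimately obtain u where c: "x \<in> carrier M" "y \<in> carrier M" "s \<in> T" "t \<in> T"
      and u: "u \<in> T" "u \<odot>\<^bsub>M\<^esub> (t \<odot>\<^bsub>M\<^esub> x) = u \<odot>\<^bsub>M\<^esub> (s \<odot>\<^bsub>M\<^esub> y)"
      by (auto simp: frac_rel_iff)
    show "(Y, X) \<in> frac_rel R p M"
      unfolding XY frac_rel_iff using c u(1) u(2)[symmetric] by blast
  qed
  show "trans (frac_rel R p M)"
  proof (rule transI)
    fix X Y Z assume "(X, Y) \<in> frac_rel R p M" "(Y, Z) \<in> frac_rel R p M"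
    moreover obtain x s y t z r where XYZ: "X = (x, s)" "Y = (y, t)" "Z = (z, r)" by (cases X; cases Y; cases Z)
    ultimately obtain u v where c: "x \<in> carrier M" "y \<in> carrier M" "z \<in> carrier M" "s \<in> T" "t \<in> T" "r \<in> T"
      and u: "u \<in> T" "u \<odot>\<^bsub>M\<^esub> (t \<odot>\<^bsub>M\<^esub> x) = u \<odot>\<^bsub>M\<^esub> (s \<odot>\<^bsub>M\<^esub> y)"
      and v: "v \<in> T" "v \<odot>\<^bsub>M\<^esub> (r \<odot>\<^bsub>M\<^esub> y) = v \<odot>\<^bsub>M\<^esub> (t \<odot>\<^bsub>M\<^esub> z)"
      by (auto simp: frac_rel_iff)
    note cR = c(1-3) c(4-6)[THEN T_closed] u(1)[THEN T_closed] v(1)[THEN T_closed]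
    \<comment> \<open>The first relation is multiplied by \<open>v r\<close>, the second by
      \<open>u s\<close>; the common factor \<open>u v t\<close> lies outside the prime.\<close>
    have "(u \<otimes> v \<otimes> t) \<odot>\<^bsub>M\<^esub> (r \<odot>\<^bsub>M\<^esub> x) = (v \<otimes> r) \<odot>\<^bsub>M\<^esub> (u \<odot>\<^bsub>M\<^esub> (t \<odot>\<^bsub>M\<^esub> x))"
      using cR by (simp add: smult_assoc1[symmetric] R.m_ac)
    also have "\<dots> = (u \<otimes> s) \<odot>\<^bsub>M\<^esub> (v \<odot>\<^bsub>M\<^esub> (r \<odot>\<^bsub>M\<^esub> y))"
      unfolding u(2) using cR by (simp add: smult_assoc1[symmetric] R.m_ac)
    also have "\<dots> = (u \<otimes> v \<otimes> t) \<odot>\<^bsub>M\<^esub> (s \<odot>\<^bsub>M\<^esub> z)"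
      unfolding v(2) using cR by (simp add: smult_assoc1[symmetric] R.m_ac)
    finally show "(X, Z) \<in> frac_rel R p M"
      unfolding XYZ frac_rel_iff using c u(1) v(1) T_mult by blast
  qed
qed

lemma fraction_eq_iff:
  assumes "x \<in> carrier M" "y \<in> carrier M" "s \<in> T" "t \<in> T"
  shows "fraction R p M x s = fraction R p M y t \<longleftrightarrow> (\<exists>u\<in>T. u \<odot>\<^bsub>M\<^esub> (t \<odot>\<^bsub>M\<^esub> x) = u \<odot>\<^bsub>M\<^esub> (s \<odot>\<^bsub>M\<^esub> y))"
  using eq_equiv_class_iff[OF frac_rel_equiv, of "(x, s)" "(y, t)"] assms
  by (simp add: fraction_def frac_rel_iff)

lemma fraction_eqI:
  assumes "x \<in> carrier M" "y \<in> carrier M" "s \<in> T" "t \<in> T" "t \<odot>\<^bsub>M\<^esub> x = s \<odot>\<^bsub>M\<^esub> y"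
  shows "fraction R p M x s = fraction R p M y t"
  unfolding fraction_eq_iff[OF assms(1-4)] using assms(5) T_one by (intro bexI[of _ \<one>]) auto

lemma in_fraction_iff:
  "(y, t) \<in> fraction R p M x s \<longleftrightarrow> ((x, s), (y, t)) \<in> frac_rel R p M"
  by (simp add: fraction_def)

lemma frac_quotient_iff:
  "X \<in> (carrier M \<times> T) // frac_rel R p M \<longleftrightarrow> (\<exists>x\<in>carrier M. \<exists>s\<in>T. X = fraction R p M x s)"
  by (auto simp: quotient_def fraction_def)

lemma fraction_self_mem: "x \<in> carrier M \<Longrightarrow> s \<in> T \<Longrightarrow> (x, s) \<in> fraction R p M x s"
  using T_one by (auto simp: in_fraction_iff frac_rel_iff)

lemma frac_add_fraction:
  assumes c: "x \<in> carrier M" "y \<in> carrier M" "s \<in> T" "t \<in> T"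
  shows "frac_add R p M (fraction R p M x s) (fraction R p M y t) =
    fraction R p M (t \<odot>\<^bsub>M\<^esub> x \<oplus>\<^bsub>M\<^esub> s \<odot>\<^bsub>M\<^esub> y) (s \<otimes> t)"
proof -
  have "fraction R p M (t' \<odot>\<^bsub>M\<^esub> x' \<oplus>\<^bsub>M\<^esub> s' \<odot>\<^bsub>M\<^esub> y') (s' \<otimes> t') =
      fraction R p M (t \<odot>\<^bsub>M\<^esub> x \<oplus>\<^bsub>M\<^esub> s \<odot>\<^bsub>M\<^esub> y) (s \<otimes> t)"
    if "(x', s') \<in> fraction R p M x s" "(y', t') \<in> fraction R p M y t" for x' s' y' t'
  proof -
    from that obtain u v where c': "x' \<in> carrier M" "y' \<in> carrier M" "s' \<in> T" "t' \<in> T"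
      and u: "u \<in> T" "u \<odot>\<^bsub>M\<^esub> (s' \<odot>\<^bsub>M\<^esub> x) = u \<odot>\<^bsub>M\<^esub> (s \<odot>\<^bsub>M\<^esub> x')"
      and v: "v \<in> T" "v \<odot>\<^bsub>M\<^esub> (t' \<odot>\<^bsub>M\<^esub> y) = v \<odot>\<^bsub>M\<^esub> (t \<odot>\<^bsub>M\<^esub> y')"
      unfolding in_fraction_iff frac_rel_iff by blast
    note cR = c(1,2) c'(1,2) c(3,4)[THEN T_closed] c'(3,4)[THEN T_closed] u(1)[THEN T_closed] v(1)[THEN T_closed]
    have "(u \<otimes> v) \<odot>\<^bsub>M\<^esub> ((s \<otimes> t) \<odot>\<^bsub>M\<^esub> (t' \<odot>\<^bsub>M\<^esub> x' \<oplus>\<^bsub>M\<^esub> s' \<odot>\<^bsub>M\<^esub> y')) =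
      (t \<otimes> t' \<otimes> v) \<odot>\<^bsub>M\<^esub> (u \<odot>\<^bsub>M\<^esub> (s \<odot>\<^bsub>M\<^esub> x')) \<oplus>\<^bsub>M\<^esub> (s \<otimes> s' \<otimes> u) \<odot>\<^bsub>M\<^esub> (v \<odot>\<^bsub>M\<^esub> (t \<odot>\<^bsub>M\<^esub> y'))"
      using cR by (simp add: smult_r_distr smult_assoc1[symmetric] R.m_ac)
    also have "\<dots> = (u \<otimes> v) \<odot>\<^bsub>M\<^esub> ((s' \<otimes> t') \<odot>\<^bsub>M\<^esub> (t \<odot>\<^bsub>M\<^esub> x \<oplus>\<^bsub>M\<^esub> s \<odot>\<^bsub>M\<^esub> y))"
      unfolding u(2)[symmetric] v(2)[symmetric] using cR by (simp add: smult_r_distr smult_assoc1[symmetric] R.m_ac)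
    finally show ?thesis
      using c c' u(1) v(1) T_mult cR by (subst fraction_eq_iff) auto
  qed
  then show ?thesis
    unfolding frac_add_def by (rule UN_pairs_constant[OF fraction_self_mem[OF c(1,3)] fraction_self_mem[OF c(2,4)]])
qed

lemma localized_module_simps:
  "carrier (localized_module R p M) = (carrier M \<times> T) // frac_rel R p M"
  "\<zero>\<^bsub>localized_module R p M\<^esub> = fraction R p M \<zero>\<^bsub>M\<^esub> \<one>"
  "X \<oplus>\<^bsub>localized_module R p M\<^esub> Y = frac_add R p M X Y"
  "A \<odot>\<^bsub>localized_module R p M\<^esub> X = frac_smult R p M A X"
  by (simp_all add: localized_module_def prime_compl_def)

lemma localized_moduleE:
  assumes "X \<in> carrier (localized_module R p M)"
  obtains x s where "x \<in> carrier M" "s \<in> T" "X = fraction R p M x s"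
  using assms unfolding localized_module_simps frac_quotient_iff by blast

lemma fraction_closed: "x \<in> carrier M \<Longrightarrow> s \<in> T \<Longrightarrow> fraction R p M x s \<in> carrier (localized_module R p M)"
  unfolding localized_module_simps frac_quotient_iff by blast

lemma localized_abelian_group: "abelian_group (localized_module R p M)"
proof (rule abelian_groupI)
  let ?L = "localized_module R p M"
  fix X assume X: "X \<in> carrier ?L"
  then obtain x s where x: "x \<in> carrier M" "s \<in> T" "X = fraction R p M x s" by (rule localized_moduleE)
  have s: "s \<in> carrier R" using x by simp
  show "\<zero>\<^bsub>?L\<^esub> \<oplus>\<^bsub>?L\<^esub> X = X"
    unfolding localized_module_simps x(3) using x s by (simp add: frac_add_fraction)
  have "fraction R p M (\<ominus>\<^bsub>M\<^esub> x) s \<oplus>\<^bsub>?L\<^esub> X = \<zero>\<^bsub>?L\<^esub>"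
    unfolding localized_module_simps x(3) using x s T_mult[OF x(2,2)]
    by (simp add: frac_add_fraction smult_r_distr[symmetric] M.l_neg) (intro fraction_eqI; simp)
  then show "\<exists>Y\<in>carrier ?L. Y \<oplus>\<^bsub>?L\<^esub> X = \<zero>\<^bsub>?L\<^esub>" using x fraction_closed by blast
next
  let ?L = "localized_module R p M"
  fix X Y assume "X \<in> carrier ?L" "Y \<in> carrier ?L"
  then obtain x s y t where x: "x \<in> carrier M" "s \<in> T" "X = fraction R p M x s"
    and y: "y \<in> carrier M" "t \<in> T" "Y = fraction R p M y t" by (elim localized_moduleE)
  note c = x(1) y(1) x(2)[THEN T_closed] y(2)[THEN T_closed]
  have XY: "X \<oplus>\<^bsub>?L\<^esub> Y = fraction R p M (t \<odot>\<^bsub>M\<^esub> x \<oplus>\<^bsub>M\<^esub> s \<odot>\<^bsub>M\<^esub> y) (s \<otimes> t)"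
    unfolding localized_module_simps x(3) y(3) by (rule frac_add_fraction[OF x(1) y(1) x(2) y(2)])
  have YX: "Y \<oplus>\<^bsub>?L\<^esub> X = fraction R p M (s \<odot>\<^bsub>M\<^esub> y \<oplus>\<^bsub>M\<^esub> t \<odot>\<^bsub>M\<^esub> x) (t \<otimes> s)"
    unfolding localized_module_simps x(3) y(3) by (rule frac_add_fraction[OF y(1) x(1) y(2) x(2)])
  show "X \<oplus>\<^bsub>?L\<^esub> Y \<in> carrier ?L"
    unfolding XY using c x(2) y(2) by (intro fraction_closed T_mult) auto
  show "X \<oplus>\<^bsub>?L\<^esub> Y = Y \<oplus>\<^bsub>?L\<^esub> X"
    unfolding XY YX using c by (simp add: M.a_comm R.m_comm)
next
  let ?L = "localized_module R p M"
  fix X Y Z assume "X \<in> carrier ?L" "Y \<in> carrier ?L" "Z \<in> carrier ?L"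
  then obtain x s y t z r where x: "x \<in> carrier M" "s \<in> T" "X = fraction R p M x s"
    and y: "y \<in> carrier M" "t \<in> T" "Y = fraction R p M y t"
    and z: "z \<in> carrier M" "r \<in> T" "Z = fraction R p M z r" by (elim localized_moduleE)
  note c = x(1) y(1) z(1) x(2)[THEN T_closed] y(2)[THEN T_closed] z(2)[THEN T_closed]
  have 1: "t \<odot>\<^bsub>M\<^esub> x \<oplus>\<^bsub>M\<^esub> s \<odot>\<^bsub>M\<^esub> y \<in> carrier M" "r \<odot>\<^bsub>M\<^esub> y \<oplus>\<^bsub>M\<^esub> t \<odot>\<^bsub>M\<^esub> z \<in> carrier M" using c by auto
  show "X \<oplus>\<^bsub>?L\<^esub> Y \<oplus>\<^bsub>?L\<^esub> Z = X \<oplus>\<^bsub>?L\<^esub> (Y \<oplus>\<^bsub>?L\<^esub> Z)"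
    unfolding localized_module_simps x(3) y(3) z(3)
      frac_add_fraction[OF x(1) y(1) x(2) y(2)] frac_add_fraction[OF y(1) z(1) y(2) z(2)]
      frac_add_fraction[OF 1(1) z(1) T_mult[OF x(2) y(2)] z(2)] frac_add_fraction[OF x(1) 1(2) x(2) T_mult[OF y(2) z(2)]]
    using c by (simp add: smult_r_distr smult_assoc1[symmetric] R.m_ac M.a_ac)
qed (use fraction_closed in \<open>auto simp: localized_module_simps(2)\<close>)

end

context localization
begin

text \<open>\<open>localized_ring\<close> has the operations of the localization of \<open>R\<close>
  as a module over itself, so most of its ring laws are instances of laws of localized
  modules.\<close>

interpretation self: localization R "self_module R" p
  by (simp add: localization_def localization_axioms_def plain_module_def R.module_self prime)

lemma localized_ring_simps:
  "carrier (localized_ring R p) = carrier (localized_module R p (self_module R))"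
  "\<zero>\<^bsub>localized_ring R p\<^esub> = \<zero>\<^bsub>localized_module R p (self_module R)\<^esub>"
  "A \<oplus>\<^bsub>localized_ring R p\<^esub> B = A \<oplus>\<^bsub>localized_module R p (self_module R)\<^esub> B"
  "A \<otimes>\<^bsub>localized_ring R p\<^esub> B = A \<odot>\<^bsub>localized_module R p (self_module R)\<^esub> B"
  "\<one>\<^bsub>localized_ring R p\<^esub> = fraction R p (self_module R) \<one> \<one>"
  by (simp_all add: localized_ring_def localized_module_def)

lemma frac_smult_fraction:
  assumes c: "a \<in> carrier R" "s \<in> T" "x \<in> carrier M" "t \<in> T"
  shows "frac_smult R p M (fraction R p (self_module R) a s) (fraction R p M x t) =
    fraction R p M (a \<odot>\<^bsub>M\<^esub> x) (s \<otimes> t)"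
proof -
  have "fraction R p M (a' \<odot>\<^bsub>M\<^esub> x') (s' \<otimes> t') = fraction R p M (a \<odot>\<^bsub>M\<^esub> x) (s \<otimes> t)"
    if "(a', s') \<in> fraction R p (self_module R) a s" "(x', t') \<in> fraction R p M x t" for a' s' x' t'
  proof -
    from that obtain u v where c': "a' \<in> carrier R" "x' \<in> carrier M" "s' \<in> T" "t' \<in> T"
      and u: "u \<in> T" "u \<otimes> (s' \<otimes> a) = u \<otimes> (s \<otimes> a')"
      and v: "v \<in> T" "v \<odot>\<^bsub>M\<^esub> (t' \<odot>\<^bsub>M\<^esub> x) = v \<odot>\<^bsub>M\<^esub> (t \<odot>\<^bsub>M\<^esub> x')"
      unfolding in_fraction_iff self.in_fraction_iff frac_rel_iff self.frac_rel_iff by auto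
    note cR = c(1,3) c'(1,2) c(2,4)[THEN T_closed] c'(3,4)[THEN T_closed] u(1)[THEN T_closed] v(1)[THEN T_closed]
    have "(u \<otimes> v) \<odot>\<^bsub>M\<^esub> ((s \<otimes> t) \<odot>\<^bsub>M\<^esub> (a' \<odot>\<^bsub>M\<^esub> x')) =
        (u \<otimes> (s \<otimes> a')) \<odot>\<^bsub>M\<^esub> (v \<odot>\<^bsub>M\<^esub> (t \<odot>\<^bsub>M\<^esub> x'))"
      using cR by (simp add: smult_assoc1[symmetric] R.m_ac)
    also have "\<dots> = (u \<otimes> v) \<odot>\<^bsub>M\<^esub> ((s' \<otimes> t') \<odot>\<^bsub>M\<^esub> (a \<odot>\<^bsub>M\<^esub> x))"
      unfolding u(2)[symmetric] v(2)[symmetric] using cR by (simp add: smult_assoc1[symmetric] R.m_ac)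
    finally show ?thesis
      using c c' u(1) v(1) T_mult cR by (subst fraction_eq_iff) auto
  qed
  moreover have "(a, s) \<in> fraction R p (self_module R) a s" using self.fraction_self_mem[of a s] c by simp
  ultimately show ?thesis
    unfolding frac_smult_def by (intro UN_pairs_constant[OF _ fraction_self_mem[OF c(3,4)]])
qed

lemma localized_smult:
  assumes "a \<in> carrier R" "s \<in> T" "x \<in> carrier M" "t \<in> T"
  shows "fraction R p (self_module R) a s \<odot>\<^bsub>localized_module R p M\<^esub> fraction R p M x t =
    fraction R p M (a \<odot>\<^bsub>M\<^esub> x) (s \<otimes> t)"
  unfolding localized_module_simps by (rule frac_smult_fraction[OF assms])

lemma localized_add:
  assumes "x \<in> carrier M" "y \<in> carrier M" "s \<in> T" "t \<in> T"
  shows "fraction R p M x s \<oplus>\<^bsub>localized_module R p M\<^esub> fraction R p M y t =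
    fraction R p M (t \<odot>\<^bsub>M\<^esub> x \<oplus>\<^bsub>M\<^esub> s \<odot>\<^bsub>M\<^esub> y) (s \<otimes> t)"
  unfolding localized_module_simps by (rule frac_add_fraction[OF assms])

lemma localized_ringE:
  assumes "A \<in> carrier (localized_ring R p)"
  obtains a s where "a \<in> carrier R" "s \<in> T" "A = fraction R p (self_module R) a s"
  using assms unfolding localized_ring_simps by (auto elim!: self.localized_moduleE)

lemma localized_smult_closed:
  assumes "A \<in> carrier (localized_ring R p)" "X \<in> carrier (localized_module R p M)"
  shows "A \<odot>\<^bsub>localized_module R p M\<^esub> X \<in> carrier (localized_module R p M)"
proof -
  from assms obtain a s x t where "a \<in> carrier R" "s \<in> T" "A = fraction R p (self_module R) a s"
    "x \<in> carrier M" "t \<in> T" "X = fraction R p M x t"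
    by (elim localized_ringE localized_moduleE)
  then show ?thesis by (simp only: localized_smult fraction_closed smult_closed T_mult)
qed

lemma localized_smult_l_distr:
  assumes "A \<in> carrier (localized_ring R p)" "B \<in> carrier (localized_ring R p)" "X \<in> carrier (localized_module R p M)"
  shows "(A \<oplus>\<^bsub>localized_ring R p\<^esub> B) \<odot>\<^bsub>localized_module R p M\<^esub> X =
    A \<odot>\<^bsub>localized_module R p M\<^esub> X \<oplus>\<^bsub>localized_module R p M\<^esub> B \<odot>\<^bsub>localized_module R p M\<^esub> X"
proof -
  from assms obtain a s b t x r where a: "a \<in> carrier R" "s \<in> T" "A = fraction R p (self_module R) a s"
    and b: "b \<in> carrier R" "t \<in> T" "B = fraction R p (self_module R) b t"
    and x: "x \<in> carrier M" "r \<in> T" "X = fraction R p M x r"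
    by (elim localized_ringE localized_moduleE)
  note c = a(1) b(1) x(1) a(2)[THEN T_closed] b(2)[THEN T_closed] x(2)[THEN T_closed]
  have AB: "A \<oplus>\<^bsub>localized_ring R p\<^esub> B = fraction R p (self_module R) (t \<otimes> a \<oplus> s \<otimes> b) (s \<otimes> t)"
    unfolding localized_ring_simps self.localized_module_simps a(3) b(3)
    using self.frac_add_fraction[of a b s t] a b by simp
  have ab: "t \<otimes> a \<oplus> s \<otimes> b \<in> carrier R" "a \<odot>\<^bsub>M\<^esub> x \<in> carrier M" "b \<odot>\<^bsub>M\<^esub> x \<in> carrier M" using c by auto
  show ?thesis
    unfolding AB unfolding a(3) b(3) x(3) localized_smult[OF a(1,2) x(1,2)] localized_smult[OF b(1,2) x(1,2)]
      localized_smult[OF ab(1) T_mult[OF a(2) b(2)] x(1,2)]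
      localized_add[OF ab(2,3) T_mult[OF a(2) x(2)] T_mult[OF b(2) x(2)]]
  proof (rule fraction_eqI)
    show "(s \<otimes> r \<otimes> (t \<otimes> r)) \<odot>\<^bsub>M\<^esub> ((t \<otimes> a \<oplus> s \<otimes> b) \<odot>\<^bsub>M\<^esub> x) =
      (s \<otimes> t \<otimes> r) \<odot>\<^bsub>M\<^esub> ((t \<otimes> r) \<odot>\<^bsub>M\<^esub> (a \<odot>\<^bsub>M\<^esub> x) \<oplus>\<^bsub>M\<^esub> (s \<otimes> r) \<odot>\<^bsub>M\<^esub> (b \<odot>\<^bsub>M\<^esub> x))"
      using c by (simp add: smult_r_distr smult_l_distr smult_assoc1[symmetric] R.m_ac)
  qed (use c a(2) b(2) x(2) in \<open>auto intro!: T_mult\<close>)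
qed

lemma localized_smult_r_distr:
  assumes "A \<in> carrier (localized_ring R p)" "X \<in> carrier (localized_module R p M)" "Y \<in> carrier (localized_module R p M)"
  shows "A \<odot>\<^bsub>localized_module R p M\<^esub> (X \<oplus>\<^bsub>localized_module R p M\<^esub> Y) =
    A \<odot>\<^bsub>localized_module R p M\<^esub> X \<oplus>\<^bsub>localized_module R p M\<^esub> A \<odot>\<^bsub>localized_module R p M\<^esub> Y"
proof -
  from assms obtain a s x t y r where a: "a \<in> carrier R" "s \<in> T" "A = fraction R p (self_module R) a s"
    and x: "x \<in> carrier M" "t \<in> T" "X = fraction R p M x t"
    and y: "y \<in> carrier M" "r \<in> T" "Y = fraction R p M y r"
    by (elim localized_ringE localized_moduleE)
  note c = a(1) x(1) y(1) a(2)[THEN T_closed] x(2)[THEN T_closed] y(2)[THEN T_closed]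
  have xy: "r \<odot>\<^bsub>M\<^esub> x \<oplus>\<^bsub>M\<^esub> t \<odot>\<^bsub>M\<^esub> y \<in> carrier M" "a \<odot>\<^bsub>M\<^esub> x \<in> carrier M" "a \<odot>\<^bsub>M\<^esub> y \<in> carrier M" using c by auto
  show ?thesis
    unfolding a(3) x(3) y(3) localized_smult[OF a(1,2) x(1,2)] localized_smult[OF a(1,2) y(1,2)]
      localized_add[OF x(1) y(1) x(2) y(2)] localized_smult[OF a(1,2) xy(1) T_mult[OF x(2) y(2)]]
      localized_add[OF xy(2,3) T_mult[OF a(2) x(2)] T_mult[OF a(2) y(2)]]
  proof (rule fraction_eqI)
    show "(s \<otimes> t \<otimes> (s \<otimes> r)) \<odot>\<^bsub>M\<^esub> (a \<odot>\<^bsub>M\<^esub> (r \<odot>\<^bsub>M\<^esub> x \<oplus>\<^bsub>M\<^esub> t \<odot>\<^bsub>M\<^esub> y)) =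
      (s \<otimes> (t \<otimes> r)) \<odot>\<^bsub>M\<^esub> ((s \<otimes> r) \<odot>\<^bsub>M\<^esub> (a \<odot>\<^bsub>M\<^esub> x) \<oplus>\<^bsub>M\<^esub> (s \<otimes> t) \<odot>\<^bsub>M\<^esub> (a \<odot>\<^bsub>M\<^esub> y))"
      using c by (simp add: smult_r_distr smult_assoc1[symmetric] R.m_ac)
  qed (use c a(2) x(2) y(2) in \<open>auto intro!: T_mult\<close>)
qed

lemma localized_smult_one:
  assumes "X \<in> carrier (localized_module R p M)"
  shows "\<one>\<^bsub>localized_ring R p\<^esub> \<odot>\<^bsub>localized_module R p M\<^esub> X = X"
proof -
  from assms obtain x t where x: "x \<in> carrier M" "t \<in> T" "X = fraction R p M x t" by (rule localized_moduleE)
  show ?thesis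
    unfolding localized_ring_simps x(3) localized_smult[OF R.one_closed T_one x(1,2)] using x T_closed by simp
qed

end

context localization
begin

interpretation self: localization R "self_module R" p
  by (simp add: localization_def localization_axioms_def plain_module_def R.module_self prime)

lemma localized_smult_assoc:
  assumes "A \<in> carrier (localized_ring R p)" "B \<in> carrier (localized_ring R p)" "X \<in> carrier (localized_module R p M)"
  shows "(A \<otimes>\<^bsub>localized_ring R p\<^esub> B) \<odot>\<^bsub>localized_module R p M\<^esub> X =
    A \<odot>\<^bsub>localized_module R p M\<^esub> (B \<odot>\<^bsub>localized_module R p M\<^esub> X)"
proof -
  from assms obtain a s b t x r where a: "a \<in> carrier R" "s \<in> T" "A = fraction R p (self_module R) a s"
    and b: "b \<in> carrier R" "t \<in> T" "B = fraction R p (self_module R) b t"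
    and x: "x \<in> carrier M" "r \<in> T" "X = fraction R p M x r"
    by (elim localized_ringE localized_moduleE)
  note c = a(1) b(1) x(1) a(2)[THEN T_closed] b(2)[THEN T_closed] x(2)[THEN T_closed]
  have AB: "A \<otimes>\<^bsub>localized_ring R p\<^esub> B = fraction R p (self_module R) (a \<otimes> b) (s \<otimes> t)"
    unfolding localized_ring_simps self.localized_module_simps a(3) b(3)
    using self.frac_smult_fraction[of a s b t] a b by simp
  have ab: "a \<otimes> b \<in> carrier R" "b \<odot>\<^bsub>M\<^esub> x \<in> carrier M" using c by auto
  show ?thesis
    unfolding AB unfolding a(3) b(3) x(3) localized_smult[OF b(1,2) x(1,2)]
      localized_smult[OF ab(1) T_mult[OF a(2) b(2)] x(1,2)] localized_smult[OF a(1,2) ab(2) T_mult[OF b(2) x(2)]]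
    using c by (simp add: smult_assoc1 R.m_assoc)
qed

end

context localization
begin

interpretation self: localization R "self_module R" p
  by (simp add: localization_def localization_axioms_def plain_module_def R.module_self prime)

lemma localized_ring_cring: "cring (localized_ring R p)"
proof (rule cringI)
  interpret A: abelian_group "localized_module R p (self_module R)" by (rule self.localized_abelian_group)
  let ?L = "localized_ring R p"
  show "abelian_group ?L"
  proof (rule abelian_groupI, goal_cases)
    case (6 X)
    then show ?case unfolding localized_ring_simps(1-3) 
      by (intro bexI[of _ "\<ominus>\<^bsub>localized_module R p (self_module R)\<^esub> X"] A.l_neg A.a_inv_closed)
  qed (simp_all add: localized_ring_simps(1-3) A.a_ac)
  have one: "\<one>\<^bsub>?L\<^esub> \<in> carrier ?L"
    unfolding localized_ring_simps using self.fraction_closed[of \<one> \<one>] by simp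
  have comm: "A \<otimes>\<^bsub>?L\<^esub> B = B \<otimes>\<^bsub>?L\<^esub> A" if AB: "A \<in> carrier ?L" "B \<in> carrier ?L" for A B
  proof -
    from AB obtain a s b t where a: "a \<in> carrier R" "s \<in> T" "A = fraction R p (self_module R) a s"
      and b: "b \<in> carrier R" "t \<in> T" "B = fraction R p (self_module R) b t" by (elim localized_ringE)
    show ?thesis
      unfolding localized_ring_simps a(3) b(3)
      using self.localized_smult[of a s b t] self.localized_smult[of b t a s] a b
      by (simp add: R.m_comm)
  qed
  show "comm_monoid ?L"
  proof (rule comm_monoidI)
    show "A \<otimes>\<^bsub>?L\<^esub> B \<in> carrier ?L" if "A \<in> carrier ?L" "B \<in> carrier ?L" for A B
      using self.localized_smult_closed that by (simp only: localized_ring_simps)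
    show "A \<otimes>\<^bsub>?L\<^esub> B \<otimes>\<^bsub>?L\<^esub> C = A \<otimes>\<^bsub>?L\<^esub> (B \<otimes>\<^bsub>?L\<^esub> C)"
      if "A \<in> carrier ?L" "B \<in> carrier ?L" "C \<in> carrier ?L" for A B C
      using self.localized_smult_assoc[of A B C] that by (simp only: localized_ring_simps)
    show "\<one>\<^bsub>?L\<^esub> \<otimes>\<^bsub>?L\<^esub> A = A" if "A \<in> carrier ?L" for A
      using self.localized_smult_one[of A] that by (simp only: localized_ring_simps)
  qed (use one comm in auto)
  show "(A \<oplus>\<^bsub>?L\<^esub> B) \<otimes>\<^bsub>?L\<^esub> C = A \<otimes>\<^bsub>?L\<^esub> C \<oplus>\<^bsub>?L\<^esub> B \<otimes>\<^bsub>?L\<^esub> C"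
    if "A \<in> carrier ?L" "B \<in> carrier ?L" "C \<in> carrier ?L" for A B C
    using self.localized_smult_l_distr[of A B C] that by (simp only: localized_ring_simps)
qed

lemma localized_module_module: "module (localized_ring R p) (localized_module R p M)"
  by (rule moduleI[OF localized_ring_cring localized_abelian_group])
    (fact localized_smult_closed localized_smult_l_distr localized_smult_r_distr localized_smult_assoc localized_smult_one)+

text \<open>Once \<open>f q\<close> is invertible, \<open>ex\<close> reads
  \<open>z = (f z / f q) q\<close>, so \<open>q\<close> generates. If \<open>a q\<close> vanishes,
  applying \<open>f\<close> gives \<open>a f q = 0\<close> and hence \<open>a = 0\<close>, up to
  factors outside the prime.\<close>

lemma localized_basis_singleton:
  assumes q: "q \<in> carrier M" and f: "f \<in> module_hom R M (self_module R)" and fq: "f q \<in> T"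
    and ex: "\<And>z. z \<in> carrier M \<Longrightarrow> f q \<odot>\<^bsub>M\<^esub> z = f z \<odot>\<^bsub>M\<^esub> q"
  shows "module_basis (localized_ring R p) (localized_module R p M) {fraction R p M q \<one>}"
proof -
  interpret L: module "localized_ring R p" "localized_module R p M" by (rule localized_module_module)
  let ?b = "fraction R p M q \<one>"
  have b: "?b \<in> carrier (localized_module R p M)" using q by (simp add: fraction_closed)
  have smult: "fraction R p (self_module R) a s \<odot>\<^bsub>localized_module R p M\<^esub> ?b = fraction R p M (a \<odot>\<^bsub>M\<^esub> q) s"
    if "a \<in> carrier R" "s \<in> T" for a s
    using localized_smult[OF that q T_one] T_closed[OF that(2)] by simp
  have "\<not> L.lin_dep {?b}"
  proof (rule L.lin_indpt_singletonI[OF b])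
    fix A assume A: "A \<in> carrier (localized_ring R p)" and 0: "A \<odot>\<^bsub>localized_module R p M\<^esub> ?b = \<zero>\<^bsub>localized_module R p M\<^esub>"
    from A obtain a s where a: "a \<in> carrier R" "s \<in> T" "A = fraction R p (self_module R) a s" by (rule localized_ringE)
    from 0 have "fraction R p M (a \<odot>\<^bsub>M\<^esub> q) s = fraction R p M \<zero>\<^bsub>M\<^esub> \<one>"
      unfolding a(3) smult[OF a(1,2)] localized_module_simps(2) .
    then obtain u where u: "u \<in> T" "u \<odot>\<^bsub>M\<^esub> (\<one> \<odot>\<^bsub>M\<^esub> (a \<odot>\<^bsub>M\<^esub> q)) = u \<odot>\<^bsub>M\<^esub> (s \<odot>\<^bsub>M\<^esub> \<zero>\<^bsub>M\<^esub>)"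
      using a q by (subst (asm) fraction_eq_iff) auto
    have uc: "u \<in> carrier R" "s \<in> carrier R" "f q \<in> carrier R" using u(1) a fq by auto
    have "u \<odot>\<^bsub>M\<^esub> (a \<odot>\<^bsub>M\<^esub> q) = \<zero>\<^bsub>M\<^esub>" using u(2) uc a q by simp
    then have "u \<otimes> (a \<otimes> f q) = \<zero>"
      using arg_cong[of _ _ f] functional_smult[OF f] functional_zero[OF f] uc a q
      by (metis smult_closed)
    then have "(u \<otimes> f q) \<otimes> (\<one> \<otimes> a) = (u \<otimes> f q) \<otimes> (s \<otimes> \<zero>)" using uc a by (simp add: R.m_ac)
    then have "fraction R p (self_module R) a s = fraction R p (self_module R) \<zero> \<one>"
      using self.fraction_eq_iff[of a \<zero> s \<one>] a T_mult[OF u(1) fq] by auto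
    then show "A = \<zero>\<^bsub>localized_ring R p\<^esub>"
      unfolding a(3) localized_ring_simps self.localized_module_simps by simp
  qed
  moreover have "L.span {?b} = carrier (localized_module R p M)"
    unfolding L.span_singleton[OF b]
  proof (intro equalityI subsetI)
    fix X assume "X \<in> carrier (localized_module R p M)"
    then obtain x t where x: "x \<in> carrier M" "t \<in> T" "X = fraction R p M x t" by (rule localized_moduleE)
    have fx: "f x \<in> carrier R" "t \<otimes> f q \<in> T" using functional_closed[OF f x(1)] T_mult[OF x(2) fq] by auto
    have "X = fraction R p M (f x \<odot>\<^bsub>M\<^esub> q) (t \<otimes> f q)"
      unfolding x(3) using x fx q ex[OF x(1)] fq by (intro fraction_eqI) (auto simp: smult_assoc1)
    also have "\<dots> = fraction R p (self_module R) (f x) (t \<otimes> f q) \<odot>\<^bsub>localized_module R p M\<^esub> ?b"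
      using smult[OF fx] ..
    finally show "X \<in> (\<lambda>A. A \<odot>\<^bsub>localized_module R p M\<^esub> ?b) ` carrier (localized_ring R p)"
      using self.fraction_closed[of "f x" "t \<otimes> f q"] fx unfolding localized_ring_simps by auto
  qed (use b in auto)
  ultimately show ?thesis unfolding module_basis_def using b by simp
qed

end

text \<open>The diagonal entries \<open>\<eta>1 p1\<close> and \<open>\<eta>2 p2\<close> add up to
  \<open>1\<close>, so a prime misses one of them, and the corresponding \<open>p1\<close> or
  \<open>p2\<close> is a local basis.\<close>

lemma (in rank_one_module) has_rank_one: "has_rank R M 1"
  unfolding has_rank_def
proof (intro allI impI)
  have p1: "p1 \<in> carrier M" and p2: "p2 \<in> carrier M" by simp_all
  fix p assume p: "primeideal p R"
  interpret L: localization R M p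
    by (intro localization.intro localization_axioms.intro plain_module_axioms p)
  interpret P: primeideal p R by (rule p)
  have "\<eta>1 p1 \<notin> p \<or> \<eta>2 p2 \<notin> p"
  proof (rule ccontr)
    assume "\<not> ?thesis"
    then have "\<eta>1 p1 \<oplus> \<eta>2 p2 \<in> p" by (intro P.a_closed) auto
    then show False using L.T_one by (simp add: trace prime_compl_def)
  qed
  then have "\<exists>q. module_basis (localized_ring R p) (localized_module R p M) {fraction R p M q \<one>}"
  proof
    assume "\<eta>1 p1 \<notin> p"
    then show ?thesis
      using L.localized_basis_singleton[OF p1 \<eta>(1) _ functional_exchange[OF \<eta>(1) p1]]
      by (auto simp: prime_compl_def)
  next
    assume "\<eta>2 p2 \<notin> p"
    then show ?thesis
      using L.localized_basis_singleton[OF p2 \<eta>(2) _ functional_exchange[OF \<eta>(2) p2]]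
      by (auto simp: prime_compl_def)
  qed
  then show "\<exists>B. module_basis (localized_ring R p) (localized_module R p M) B \<and> finite B \<and> card B = 1"
  proof
    fix q assume "module_basis (localized_ring R p) (localized_module R p M) {fraction R p M q \<one>}"
    then show ?thesis by (intro exI[of _ "{fraction R p M q \<one>}"]) simp
  qed
qed

section \<open>The image of a symmetric matrix\<close>

text \<open>The hypothesis on free modules concerns one carrier type only; the dual basis has to be
  moved to an isomorphic copy in that type.\<close>

lemma (in rank_one_module) transport:
  assumes N: "module R N" and g: "g \<in> module_hom R M N" "bij_betw g (carrier M) (carrier N)"
  shows "rank_one_module R N (g p1) (g p2)
    (\<lambda>z. \<eta>1 (the_inv_into (carrier M) g z)) (\<lambda>z. \<eta>2 (the_inv_into (carrier M) g z))"
proof -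
  interpret N: module R N by fact
  let ?h = "the_inv_into (carrier M) g"
  have hg: "?h (g z) = z" if "z \<in> carrier M" for z
    using g(2) that by (simp add: bij_betw_def the_inv_into_f_f)
  have gh: "g (?h z) = z" and hc: "?h z \<in> carrier M" if "z \<in> carrier N" for z
    using g(2) that f_the_inv_into_f_bij_betw[OF g(2)] bij_betwE[OF bij_betw_the_inv_into[OF g(2)]] by auto
  have gc: "g z \<in> carrier N" if "z \<in> carrier M" for z using g(2) that bij_betwE by blast
  have h_add: "?h (z \<oplus>\<^bsub>N\<^esub> w) = ?h z \<oplus>\<^bsub>M\<^esub> ?h w" if "z \<in> carrier N" "w \<in> carrier N" for z w
  proof -
    have "z \<oplus>\<^bsub>N\<^esub> w = g (?h z \<oplus>\<^bsub>M\<^esub> ?h w)" using that g(1) gh hc by (simp add: module_hom_add)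
    then show ?thesis using hg hc that by simp
  qed
  have h_smult: "?h (a \<odot>\<^bsub>N\<^esub> z) = a \<odot>\<^bsub>M\<^esub> ?h z" if "a \<in> carrier R" "z \<in> carrier N" for a z
  proof -
    have "a \<odot>\<^bsub>N\<^esub> z = g (a \<odot>\<^bsub>M\<^esub> ?h z)" using that g(1) gh hc by (simp add: module_hom_smult)
    then show ?thesis using hg hc that by simp
  qed
  have \<eta>h: "(\<lambda>z. f (?h z)) \<in> module_hom R N (self_module R)" if f: "f \<in> module_hom R M (self_module R)" for f
    by (rule N.functionalI)
      (use f hc in \<open>simp_all add: h_add h_smult functional_closed functional_add functional_smult\<close>)
  show ?thesis
  proof (intro rank_one_module.intro plain_module.intro rank_one_module_axioms.intro)
    show "\<eta>1 (?h z) \<odot>\<^bsub>N\<^esub> g p1 \<oplus>\<^bsub>N\<^esub> \<eta>2 (?h z) \<odot>\<^bsub>N\<^esub> g p2 = z" if "z \<in> carrier N" for z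
    proof -
      have "\<eta>1 (?h z) \<odot>\<^bsub>N\<^esub> g p1 \<oplus>\<^bsub>N\<^esub> \<eta>2 (?h z) \<odot>\<^bsub>N\<^esub> g p2 = g (\<eta>1 (?h z) \<odot>\<^bsub>M\<^esub> p1 \<oplus>\<^bsub>M\<^esub> \<eta>2 (?h z) \<odot>\<^bsub>M\<^esub> p2)"
        using g(1) hc[OF that] by (simp add: module_hom_add module_hom_smult)
      then show ?thesis using expand[OF hc[OF that]] gh[OF that] by simp
    qed
  qed (use N \<eta>h \<eta> gc hc minor hg trace one_neq_zero in simp_all)
qed

context cring
begin

text \<open>\<open>A = (a, b; b, c)\<close> has determinant \<open>0\<close>, and \<open>X = (x, y; 0, z)\<close> satisfies \<open>tr (A X) = 1\<close>, so that
  \<open>E = A X\<close> is idempotent by Cayley-Hamilton. The module is the image of \<open>E\<close>, which is also the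
  image of \<open>A\<close>; it is self-dual because \<open>A\<close> is symmetric. If it is generated by one element, then
  \<open>A\<close> is a column times a row, both unimodular.\<close>

lemma symmetric_rank_one_unimodular:
  assumes c: "a \<in> carrier R" "b \<in> carrier R" "c \<in> carrier R" "x \<in> carrier R" "y \<in> carrier R" "z \<in> carrier R"
    and tr: "x \<otimes> a \<oplus> y \<otimes> b \<oplus> z \<otimes> c = \<one>" and det: "a \<otimes> c = b \<otimes> b" and nontrivial: "\<one> \<noteq> \<zero>"
    and iso: "\<And>M :: ('a, 'a \<times> 'a) module. module R M \<Longrightarrow> two_generated R M \<Longrightarrow>
      \<exists>P :: ('a, 'm) module. module R P \<and> module_iso R M P"
    and free: "\<And>P :: ('a, 'm) module. module R P \<Longrightarrow> projective_module R P \<Longrightarrow> has_rank R P 1 \<Longrightarrow>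
      self_dual R P \<Longrightarrow> two_generated R P \<Longrightarrow> free_module R P"
  shows "\<exists>x1\<in>carrier R. \<exists>x2\<in>carrier R. \<exists>y1\<in>carrier R. \<exists>y2\<in>carrier R.
    x1 \<otimes> a \<otimes> y1 \<oplus> x1 \<otimes> b \<otimes> y2 \<oplus> x2 \<otimes> b \<otimes> y1 \<oplus> x2 \<otimes> c \<otimes> y2 = \<one>"
proof -
  define e11 e12 e21 e22 where "e11 = a \<otimes> x" and "e12 = a \<otimes> y \<oplus> b \<otimes> z" and "e21 = b \<otimes> x" and "e22 = b \<otimes> y \<oplus> c \<otimes> z"
  have ec: "e11 \<in> carrier R" "e12 \<in> carrier R" "e21 \<in> carrier R" "e22 \<in> carrier R"
    using c by (simp_all add: e11_def e12_def e21_def e22_def)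
  have etr: "e11 \<oplus> e22 = \<one>"
    unfolding e11_def e22_def
    by (rule ring_eqI1[OF tr, of "[a,b,c,x,y,z]" _ _ _ _ \<one>], (rule reify)+, code_simp, use c in simp)
  have edet: "e11 \<otimes> e22 = e12 \<otimes> e21"
    unfolding e11_def e22_def e12_def e21_def
    by (rule ring_eqI1[OF det, of "[a,b,c,x,y,z]" _ _ _ _ "x \<otimes> z"], (rule reify)+, code_simp, use c in simp)
  \<comment> \<open>The fixed vectors of \<open>E\<close>, which form its image because
    \<open>E\<close> is idempotent.\<close>
  define M :: "('a, 'a \<times> 'a) module" where "M = \<lparr>
    carrier = {(u, v). u \<in> carrier R \<and> v \<in> carrier R \<and> e11 \<otimes> u \<oplus> e12 \<otimes> v = u \<and> e21 \<otimes> u \<oplus> e22 \<otimes> v = v},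
    mult = undefined, one = undefined, zero = (\<zero>, \<zero>),
    add = (\<lambda>z w. (fst z \<oplus> fst w, snd z \<oplus> snd w)), smult = (\<lambda>s z. (s \<otimes> fst z, s \<otimes> snd z))\<rparr>"
  have M: "(u, v) \<in> carrier M \<longleftrightarrow> u \<in> carrier R \<and> v \<in> carrier R \<and> e11 \<otimes> u \<oplus> e12 \<otimes> v = u \<and> e21 \<otimes> u \<oplus> e22 \<otimes> v = v"
    "\<zero>\<^bsub>M\<^esub> = (\<zero>, \<zero>)" "(u, v) \<oplus>\<^bsub>M\<^esub> (u', v') = (u \<oplus> u', v \<oplus> v')" "s \<odot>\<^bsub>M\<^esub> (u, v) = (s \<otimes> u, s \<otimes> v)" for u v u' v' s
    by (simp_all add: M_def)
  have Madd: "Z \<oplus>\<^bsub>M\<^esub> W \<in> carrier M" if "Z \<in> carrier M" "W \<in> carrier M" for Z W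
  proof -
    obtain u v u' v' where ZW: "Z = (u, v)" "W = (u', v')" by (cases Z; cases W)
    note h = that[unfolded ZW M(1)]
    have "e11 \<otimes> (u \<oplus> u') \<oplus> e12 \<otimes> (v \<oplus> v') = u \<oplus> u'"
      by (rule ring_eqI2[of "e11 \<otimes> u \<oplus> e12 \<otimes> v" u "e11 \<otimes> u' \<oplus> e12 \<otimes> v'" u' "[e11,e12,u,v,u',v']" _ _ _ _ \<one> _ _ _ \<one>],
        use h in simp, use h in simp, (rule reify)+, code_simp, use h ec in simp)
    moreover have "e21 \<otimes> (u \<oplus> u') \<oplus> e22 \<otimes> (v \<oplus> v') = v \<oplus> v'"
      by (rule ring_eqI2[of "e21 \<otimes> u \<oplus> e22 \<otimes> v" v "e21 \<otimes> u' \<oplus> e22 \<otimes> v'" v' "[e21,e22,u,v,u',v']" _ _ _ _ \<one> _ _ _ \<one>],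
        use h in simp, use h in simp, (rule reify)+, code_simp, use h ec in simp)
    ultimately show ?thesis using h by (simp add: ZW M)
  qed
  have Msmult: "s \<odot>\<^bsub>M\<^esub> Z \<in> carrier M" if s: "s \<in> carrier R" and Z: "Z \<in> carrier M" for s Z
  proof -
    obtain u v where ZW: "Z = (u, v)" by (cases Z)
    note h = Z[unfolded ZW M(1)]
    have "e11 \<otimes> (s \<otimes> u) \<oplus> e12 \<otimes> (s \<otimes> v) = s \<otimes> u"
      by (rule ring_eqI1[of "e11 \<otimes> u \<oplus> e12 \<otimes> v" u "[e11,e12,u,v,s]" _ _ _ _ s],
        use h in simp, (rule reify)+, code_simp, use h ec s in simp)
    moreover have "e21 \<otimes> (s \<otimes> u) \<oplus> e22 \<otimes> (s \<otimes> v) = s \<otimes> v"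
      by (rule ring_eqI1[of "e21 \<otimes> u \<oplus> e22 \<otimes> v" v "[e21,e22,u,v,s]" _ _ _ _ s],
        use h in simp, (rule reify)+, code_simp, use h ec s in simp)
    ultimately show ?thesis using h s by (simp add: ZW M)
  qed
  have ag: "abelian_group M"
  proof (rule abelian_groupI, goal_cases)
    case (6 Z)
    then show ?case
      by (intro bexI[OF _ Msmult[of "\<ominus> \<one>" Z]]) (auto simp: M_def l_minus l_neg)
  qed (use Madd ec in \<open>auto simp: M_def a_ac\<close>)
  have modM: "module R M"
    by (rule moduleI[OF is_cring ag Msmult]) (auto simp: M_def l_distr r_distr m_assoc)
  have pc: "(e11, e21) \<in> carrier M" "(e12, e22) \<in> carrier M"
  proof -
    have 1: "e11 \<otimes> e11 \<oplus> e12 \<otimes> e21 = e11"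
      by (rule ring_eqI2[OF etr edet, of "[e11,e12,e21,e22]" _ _ _ _ e11 _ _ _ "\<ominus> \<one>"], (rule reify)+, code_simp, use ec in simp)
    have 2: "e21 \<otimes> e11 \<oplus> e22 \<otimes> e21 = e21"
      by (rule ring_eqI1[OF etr, of "[e11,e12,e21,e22]" _ _ _ _ e21], (rule reify)+, code_simp, use ec in simp)
    have 3: "e11 \<otimes> e12 \<oplus> e12 \<otimes> e22 = e12"
      by (rule ring_eqI1[OF etr, of "[e11,e12,e21,e22]" _ _ _ _ e12], (rule reify)+, code_simp, use ec in simp)
    have 4: "e21 \<otimes> e12 \<oplus> e22 \<otimes> e22 = e22"
      by (rule ring_eqI2[OF etr edet, of "[e11,e12,e21,e22]" _ _ _ _ e22 _ _ _ "\<ominus> \<one>"], (rule reify)+, code_simp, use ec in simp)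
    show "(e11, e21) \<in> carrier M" "(e12, e22) \<in> carrier M" using 1 2 3 4 ec by (simp_all add: M)
  qed
  \<comment> \<open>The equations amount to \<open>A X A = A\<close>, by the identity
    \<open>A X A = tr (A X) A - det A adj X\<close> for 2 by 2 matrices.\<close>
  have xc: "(a, b) \<in> carrier M" "(b, c) \<in> carrier M"
  proof -
    have 1: "e11 \<otimes> a \<oplus> e12 \<otimes> b = a" unfolding e11_def e12_def
      by (rule ring_eqI2[OF tr det, of "[a,b,c,x,y,z]" _ _ _ _ a _ _ _ "\<ominus> z"], (rule reify)+, code_simp, use c in simp)
    have 2: "e21 \<otimes> a \<oplus> e22 \<otimes> b = b" unfolding e21_def e22_def
      by (rule ring_eqI2[OF tr det, of "[a,b,c,x,y,z]" _ _ _ _ b _ _ _ \<zero>], (rule reify)+, code_simp, use c in simp)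
    have 3: "e11 \<otimes> b \<oplus> e12 \<otimes> c = b" unfolding e11_def e12_def
      by (rule ring_eqI2[OF tr det, of "[a,b,c,x,y,z]" _ _ _ _ b _ _ _ y], (rule reify)+, code_simp, use c in simp)
    have 4: "e21 \<otimes> b \<oplus> e22 \<otimes> c = c" unfolding e21_def e22_def
      by (rule ring_eqI2[OF tr det, of "[a,b,c,x,y,z]" _ _ _ _ c _ _ _ "\<ominus> x"], (rule reify)+, code_simp, use c in simp)
    show "(a, b) \<in> carrier M" "(b, c) \<in> carrier M" using 1 2 3 4 c by (simp_all add: M)
  qed
  interpret M: module R M by (rule modM)
  interpret M: rank_one_module R M "(e11, e21)" "(e12, e22)" fst snd
  proof
    show "fst \<in> module_hom R M (self_module R)" "snd \<in> module_hom R M (self_module R)"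
      by (rule M.functionalI; auto simp: M_def)+
    fix Z W assume Z: "Z \<in> carrier M" and W: "W \<in> carrier M"
    obtain u v u' v' where ZW: "Z = (u, v)" "W = (u', v')" by (cases Z; cases W)
    note h = Z[unfolded ZW M(1)] W[unfolded ZW M(1)]
    have "(e11 \<otimes> u \<oplus> e12 \<otimes> v) \<otimes> (e21 \<otimes> u' \<oplus> e22 \<otimes> v') = (e21 \<otimes> u \<oplus> e22 \<otimes> v) \<otimes> (e11 \<otimes> u' \<oplus> e12 \<otimes> v')"
      by (rule ring_eqI1[OF edet, of "[e11,e12,e21,e22,u,v,u',v']" _ _ _ _ "u \<otimes> v' \<ominus> v \<otimes> u'"], (rule reify)+, code_simp,
        use ec h in simp)
    then show "fst Z \<otimes> snd W = snd Z \<otimes> fst W" using h by (simp add: ZW)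
  next
    fix Z assume Z: "Z \<in> carrier M"
    obtain u v where ZW: "Z = (u, v)" by (cases Z)
    show "fst Z \<odot>\<^bsub>M\<^esub> (e11, e21) \<oplus>\<^bsub>M\<^esub> snd Z \<odot>\<^bsub>M\<^esub> (e12, e22) = Z"
      using Z ec unfolding ZW M by (simp add: M m_comm)
  qed (use pc etr nontrivial in auto)
  from iso[OF modM M.two_generated] obtain P :: "('a, 'm) module" and g where
    P: "module R P" and g: "g \<in> module_hom R M P" "bij_betw g (carrier M) (carrier P)"
    unfolding module_iso_def by blast
  let ?h = "the_inv_into (carrier M) g"
  interpret P: rank_one_module R P "g (e11, e21)" "g (e12, e22)" "\<lambda>z. fst (?h z)" "\<lambda>z. snd (?h z)"
    by (rule M.transport[OF P g])
  have hg: "?h (g Z) = Z" if "Z \<in> carrier M" for Z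
    using g(2) that by (simp add: bij_betw_def the_inv_into_f_f)
  have gc: "g Z \<in> carrier P" if "Z \<in> carrier M" for Z using g(2) that bij_betwE by blast
  have "self_dual R P"
  proof (rule P.self_dual[of "g (a, b)" "g (b, c)" x \<zero> y z])
    have p: "(e11, e21) = x \<odot>\<^bsub>M\<^esub> (a, b) \<oplus>\<^bsub>M\<^esub> \<zero> \<odot>\<^bsub>M\<^esub> (b, c)" "(e12, e22) = y \<odot>\<^bsub>M\<^esub> (a, b) \<oplus>\<^bsub>M\<^esub> z \<odot>\<^bsub>M\<^esub> (b, c)"
      using c by (simp_all add: M e11_def e12_def e21_def e22_def m_comm)
    show "g (e11, e21) = x \<odot>\<^bsub>P\<^esub> g (a, b) \<oplus>\<^bsub>P\<^esub> \<zero> \<odot>\<^bsub>P\<^esub> g (b, c)"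
      unfolding p(1) using g(1) xc c by (simp only: module_hom_add module_hom_smult Msmult zero_closed)
    show "g (e12, e22) = y \<odot>\<^bsub>P\<^esub> g (a, b) \<oplus>\<^bsub>P\<^esub> z \<odot>\<^bsub>P\<^esub> g (b, c)"
      unfolding p(2) using g(1) xc c by (simp only: module_hom_add module_hom_smult Msmult)
  qed (use xc hg gc c in simp_all)
  then have "free_module R P"
    by (intro free P P.projective P.has_rank_one P.two_generated)
  then obtain B where B: "B \<in> carrier P" "\<And>Z. Z \<in> carrier P \<Longrightarrow> \<exists>s\<in>carrier R. Z = s \<odot>\<^bsub>P\<^esub> B"
    using P.free_imp_cyclic by blast
  define \<beta>1 \<beta>2 where "\<beta>1 = fst (?h B)" and "\<beta>2 = snd (?h B)"
  have \<beta>: "\<beta>1 \<in> carrier R" "\<beta>2 \<in> carrier R" using P.eta_closed[OF B(1)] by (simp_all add: \<beta>1_def \<beta>2_def)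
  have coord: "\<exists>s\<in>carrier R. u = s \<otimes> \<beta>1 \<and> v = s \<otimes> \<beta>2" if "(u, v) \<in> carrier M" for u v
  proof -
    from B(2)[OF gc[OF that]] obtain s where s: "s \<in> carrier R" "g (u, v) = s \<odot>\<^bsub>P\<^esub> B" by blast
    have "u = s \<otimes> \<beta>1" "v = s \<otimes> \<beta>2"
      using P.eta_smult(1)[OF s(1) B(1)] P.eta_smult(2)[OF s(1) B(1)]
      unfolding s(2)[symmetric] hg[OF that] \<beta>1_def \<beta>2_def fst_conv snd_conv by simp_all
    with s(1) show ?thesis by blast
  qed
  \<comment> \<open>Both columns of \<open>A\<close> are multiples of the generator
    \<open>(\<beta>1, \<beta>2)\<close>, so \<open>A\<close> is this column times the row
    \<open>(v1, v2)\<close>. The trace of \<open>E\<close> makes the column unimodular.\<close>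
  from coord[OF xc(1)] obtain v1 where v1: "v1 \<in> carrier R" "a = v1 \<otimes> \<beta>1" "b = v1 \<otimes> \<beta>2" by blast
  from coord[OF xc(2)] obtain v2 where v2: "v2 \<in> carrier R" "b = v2 \<otimes> \<beta>1" "c = v2 \<otimes> \<beta>2" by blast
  from coord[OF pc(1)] obtain w1 where w1: "w1 \<in> carrier R" "e11 = w1 \<otimes> \<beta>1" by blast
  from coord[OF pc(2)] obtain w2 where w2: "w2 \<in> carrier R" "e22 = w2 \<otimes> \<beta>2" by blast
  have w: "w1 \<otimes> \<beta>1 \<oplus> w2 \<otimes> \<beta>2 = \<one>" using etr w1 w2 by simp
  have v: "x \<otimes> (v1 \<otimes> \<beta>1) \<oplus> y \<otimes> (v1 \<otimes> \<beta>2) \<oplus> z \<otimes> (v2 \<otimes> \<beta>2) = \<one>" using tr by (simp flip: v1(2,3) v2(3))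
  \<comment> \<open>The column \<open>X (\<beta>1, \<beta>2)\<close>: its product with the row
    \<open>(v1, v2)\<close> is \<open>tr (A X) = 1\<close>.\<close>
  define y1 y2 where "y1 = x \<otimes> \<beta>1 \<oplus> y \<otimes> \<beta>2" and "y2 = z \<otimes> \<beta>2"
  have yc: "y1 \<in> carrier R" "y2 \<in> carrier R" using c \<beta> by (simp_all add: y1_def y2_def)
  have "w1 \<otimes> (v1 \<otimes> \<beta>1) \<otimes> y1 \<oplus> w1 \<otimes> (v2 \<otimes> \<beta>1) \<otimes> y2 \<oplus> w2 \<otimes> (v1 \<otimes> \<beta>2) \<otimes> y1 \<oplus> w2 \<otimes> (v2 \<otimes> \<beta>2) \<otimes> y2 = \<one>"
    unfolding y1_def y2_def
    by (rule ring_eqI2[OF w v, of "[w1,w2,v1,v2,\<beta>1,\<beta>2,x,y,z]" _ _ _ _ \<one> _ _ _ "w1 \<otimes> \<beta>1 \<oplus> w2 \<otimes> \<beta>2"],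
      (rule reify)+, code_simp, use w1(1) w2(1) v1(1) v2(1) \<beta> c in simp)
  then have "w1 \<otimes> a \<otimes> y1 \<oplus> w1 \<otimes> b \<otimes> y2 \<oplus> w2 \<otimes> b \<otimes> y1 \<oplus> w2 \<otimes> c \<otimes> y2 = \<one>"
    unfolding v1(2)[symmetric] v1(3)[symmetric] v2(2)[symmetric] v2(3)[symmetric] .
  with w1(1) w2(1) yc show ?thesis by blast
qed

section \<open>Passage to the quotients of \<open>R\<close> by principal ideals\<close>

lemma symmetric_cond_quotient:
  assumes free: "\<And>d (P :: ('a set, 'a \<times> 'a) module). d \<in> carrier R \<Longrightarrow>
      module (R Quot (PIdl d)) P \<Longrightarrow> projective_module (R Quot (PIdl d)) P \<Longrightarrow> has_rank (R Quot (PIdl d)) P 1 \<Longrightarrow>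
      self_dual (R Quot (PIdl d)) P \<Longrightarrow> two_generated (R Quot (PIdl d)) P \<Longrightarrow> free_module (R Quot (PIdl d)) P"
  shows symmetric_cond
  unfolding symmetric_cond_def
proof (intro ballI impI)
  fix d a b c x y z k l
  assume cl: "d \<in> carrier R" "a \<in> carrier R" "b \<in> carrier R" "c \<in> carrier R" "x \<in> carrier R" "y \<in> carrier R"
      "z \<in> carrier R" "k \<in> carrier R" "l \<in> carrier R"
    and tr: "x \<otimes> a \<oplus> y \<otimes> b \<oplus> z \<otimes> c \<oplus> d \<otimes> k = \<one>" and det: "a \<otimes> c = b \<otimes> b \<oplus> d \<otimes> l"
  let ?S = "R Quot (PIdl d)" and ?q = "\<lambda>x. PIdl d +> x"
  have I: "ideal (PIdl d) R" using cl by (intro cgenideal_ideal)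
  interpret S: cring ?S by (rule ideal.quotient_is_cring[OF I is_cring])
  note hom = ideal.rcos_ring_hom[OF I]
  have q_zero: "?q \<zero> = \<zero>\<^bsub>?S\<^esub>" by (rule ring_hom_zero[OF hom ring_axioms S.ring_axioms])
  note q_simps = ring_hom_add[OF hom] ring_hom_mult[OF hom] ring_hom_one[OF hom]
  note q_closed = ring_hom_closed[OF hom]
  have q_carrier: "X \<in> carrier ?S \<longleftrightarrow> (\<exists>x\<in>carrier R. X = ?q x)" for X
    by (auto simp: FactRing_def A_RCOSETS_def')
  show "\<exists>x1\<in>carrier R. \<exists>x2\<in>carrier R. \<exists>y1\<in>carrier R. \<exists>y2\<in>carrier R. \<exists>k\<in>carrier R.
      x1 \<otimes> a \<otimes> y1 \<oplus> x1 \<otimes> b \<otimes> y2 \<oplus> x2 \<otimes> b \<otimes> y1 \<oplus> x2 \<otimes> c \<otimes> y2 \<oplus> d \<otimes> k = \<one>"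
  proof (cases "\<one>\<^bsub>?S\<^esub> = \<zero>\<^bsub>?S\<^esub>")
    \<comment> \<open>In the zero quotient there is no rank one module to consider, but then
      \<open>d\<close> is a unit and \<open>x = y = 0\<close> solves the equation.\<close>
    case True
    then have "?q \<one> = ?q \<zero>" by (simp only: q_zero q_simps)
    then obtain m where m: "m \<in> carrier R" "\<one> = \<zero> \<oplus> d \<otimes> m"
      unfolding cgen_coset_eq[OF cl(1) one_closed zero_closed] cong_mod_def by blast
    then have "\<zero> \<otimes> a \<otimes> \<zero> \<oplus> \<zero> \<otimes> b \<otimes> \<zero> \<oplus> \<zero> \<otimes> b \<otimes> \<zero> \<oplus> \<zero> \<otimes> c \<otimes> \<zero> \<oplus> d \<otimes> m = \<one>" using cl by simp
    with m(1) zero_closed show ?thesis by blast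
  next
    case False
    have "?q (x \<otimes> a \<oplus> y \<otimes> b \<oplus> z \<otimes> c) = ?q \<one>"
      unfolding cgen_coset_eq[OF cl(1) a_closed[OF a_closed[OF m_closed m_closed] m_closed] one_closed, OF cl(5,2,6,3,7,4)]
        cong_mod_def
    proof
      show "x \<otimes> a \<oplus> y \<otimes> b \<oplus> z \<otimes> c = \<one> \<oplus> d \<otimes> (\<ominus> k)"
        by (rule ring_eqI1[OF tr, of "[a,b,c,x,y,z,d,k]" _ _ _ _ \<one>], (rule reify)+, code_simp, use cl in simp)
    qed (use cl in simp)
    then have 1: "?q x \<otimes>\<^bsub>?S\<^esub> ?q a \<oplus>\<^bsub>?S\<^esub> ?q y \<otimes>\<^bsub>?S\<^esub> ?q b \<oplus>\<^bsub>?S\<^esub> ?q z \<otimes>\<^bsub>?S\<^esub> ?q c = \<one>\<^bsub>?S\<^esub>"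
      using cl by (simp only: q_simps m_closed a_closed)
    have "?q (a \<otimes> c) = ?q (b \<otimes> b)"
      unfolding cgen_coset_eq[OF cl(1) m_closed[OF cl(2,4)] m_closed[OF cl(3,3)]] cong_mod_def
      using det cl by blast
    then have 2: "?q a \<otimes>\<^bsub>?S\<^esub> ?q c = ?q b \<otimes>\<^bsub>?S\<^esub> ?q b"
      using cl by (simp only: q_simps)
    have "\<exists>x1\<in>carrier ?S. \<exists>x2\<in>carrier ?S. \<exists>y1\<in>carrier ?S. \<exists>y2\<in>carrier ?S.
      x1 \<otimes>\<^bsub>?S\<^esub> ?q a \<otimes>\<^bsub>?S\<^esub> y1 \<oplus>\<^bsub>?S\<^esub> x1 \<otimes>\<^bsub>?S\<^esub> ?q b \<otimes>\<^bsub>?S\<^esub> y2 \<oplus>\<^bsub>?S\<^esub> x2 \<otimes>\<^bsub>?S\<^esub> ?q b \<otimes>\<^bsub>?S\<^esub> y1 \<oplus>\<^bsub>?S\<^esub>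
        x2 \<otimes>\<^bsub>?S\<^esub> ?q c \<otimes>\<^bsub>?S\<^esub> y2 = \<one>\<^bsub>?S\<^esub>"
    proof (rule S.symmetric_rank_one_unimodular[OF _ _ _ _ _ _ 1 2 False])
      \<comment> \<open>The image module consists of pairs of cosets, whereas the hypothesis speaks
        of modules on pairs of elements of \<open>R\<close>; two generators suffice for such a
        copy.\<close>
      show "\<exists>P :: ('a set, 'a \<times> 'a) module. module ?S P \<and> module_iso ?S M P"
        if "module ?S M" "two_generated ?S M" for M :: "('a set, 'a set \<times> 'a set) module"
        by (rule two_generated_quot_iso_type[OF I that])
    qed (fact q_closed[OF cl(2)] q_closed[OF cl(3)] q_closed[OF cl(4)] q_closed[OF cl(5)] q_closed[OF cl(6)]
        q_closed[OF cl(7)] free[OF cl(1)])+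
    then obtain X1 X2 Y1 Y2 where "X1 \<in> carrier ?S" "X2 \<in> carrier ?S" "Y1 \<in> carrier ?S" "Y2 \<in> carrier ?S"
      and 3: "X1 \<otimes>\<^bsub>?S\<^esub> ?q a \<otimes>\<^bsub>?S\<^esub> Y1 \<oplus>\<^bsub>?S\<^esub> X1 \<otimes>\<^bsub>?S\<^esub> ?q b \<otimes>\<^bsub>?S\<^esub> Y2 \<oplus>\<^bsub>?S\<^esub> X2 \<otimes>\<^bsub>?S\<^esub> ?q b \<otimes>\<^bsub>?S\<^esub> Y1 \<oplus>\<^bsub>?S\<^esub>
        X2 \<otimes>\<^bsub>?S\<^esub> ?q c \<otimes>\<^bsub>?S\<^esub> Y2 = \<one>\<^bsub>?S\<^esub>"
      by blast
    then obtain x1 x2 y1 y2 where r: "x1 \<in> carrier R" "X1 = ?q x1" "x2 \<in> carrier R" "X2 = ?q x2"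
      "y1 \<in> carrier R" "Y1 = ?q y1" "y2 \<in> carrier R" "Y2 = ?q y2"
      unfolding q_carrier by blast
    let ?w = "x1 \<otimes> a \<otimes> y1 \<oplus> x1 \<otimes> b \<otimes> y2 \<oplus> x2 \<otimes> b \<otimes> y1 \<oplus> x2 \<otimes> c \<otimes> y2"
    have wc: "?w \<in> carrier R" using r cl by simp
    have "?q ?w = ?q \<one>"
      using 3 r(1,3,5,7) cl unfolding r(2,4,6,8) by (simp only: q_simps m_closed a_closed)
    then obtain m where m: "m \<in> carrier R" "?w = \<one> \<oplus> d \<otimes> m"
      unfolding cgen_coset_eq[OF cl(1) wc one_closed] cong_mod_def by blast
    have "?w \<oplus> d \<otimes> (\<ominus> m) = \<one>" unfolding m(2)
      by (rule ring_eqI[of "[d,m]"], (rule reify)+, code_simp, use cl m in simp)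
    with r(1,3,5,7) m(1) a_inv_closed[OF m(1)] show ?thesis by blast
  qed
qed

end

theorem corollary1p18:
  fixes R :: "'a ring"
  assumes "cring R"
    and "hermite_ring R"
    and "\<And>a (P :: ('a set, 'a \<times> 'a) module).
      a \<in> carrier R \<Longrightarrow>
      module (R Quot (PIdl\<^bsub>R\<^esub> a)) P \<Longrightarrow>
      projective_module (R Quot (PIdl\<^bsub>R\<^esub> a)) P \<Longrightarrow>
      has_rank (R Quot (PIdl\<^bsub>R\<^esub> a)) P 1 \<Longrightarrow>
      self_dual (R Quot (PIdl\<^bsub>R\<^esub> a)) P \<Longrightarrow>
      two_generated (R Quot (PIdl\<^bsub>R\<^esub> a)) P \<Longrightarrow>
      free_module (R Quot (PIdl\<^bsub>R\<^esub> a)) P"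
  shows "(WU2_ring R \<longleftrightarrow> elementary_divisor_ring R) \<and>
    (SU2_ring R \<longrightarrow> elementary_divisor_ring R)"
proof -
  interpret cring R by fact
  have symmetric_cond by (rule symmetric_cond_quotient) (rule assms(3))
  then show ?thesis
    using WU2_imp_kaplansky SU2_imp_kaplansky kaplansky_imp_elementary_divisor
      elementary_divisor_imp_WU2 assms(2) by blast
qed

end
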